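(* Let $\Gamma$ be a countable group acting without inversion on a non-trivial tree $\mathcal T$. Assume that for each edge $e$ of $\mathcal T$, the stabilizer of $e$ in $\Gamma$ is highly core-free in the stabilizer of each of the two endpoints of $e$. Then $\Gamma\in\mathcal H(\mathbb U_S)$ for every bounded distance set $S$.
   Context: A tree is non-trivial if it has at least one edge. A subgroup $\Sigma$ of a countable group $G$ is highly core-free in $G$ if for every finite subset $F\subseteq G$ there is $\gamma\in G$ such that the map $\Sigma\times F\to G$, $(\sigma,f)\mapsto\sigma\gamma f$, is injective and its range $\Sigma\gamma F$ is disjoint from $F$. A bounded distance set is a countable set $S\subseteq[0,+\infty[$ containing $0$ and at least one other element, which has a maximum $M=\max(S)>0$ and satisfies $\min(s+t,M)\in S$ for all $s,t\in S$. An $S$-metric space is a metric space whose metric takes values in $S$. The $S$-Urysohn space $\mathbb U_S$ is the unique (up to isometry) countable $S$-metric space with the extension property: whenever $X\subseteq Y$ are finite $S$-metric spaces (with the restricted metric on $X$), every isometric embedding $X\to\mathbb U_S$ extends to an isometric embedding $Y\to\mathbb U_S$. An action of a group $\Gamma$ by isometries on $\mathbb U_S$ is homogeneous if for every isometry $\varphi$ between two finite subsets of $\mathbb U_S$ there is $\gamma\in\Gamma$ with $\gamma x=\varphi(x)$ for all $x\in\operatorname{dom}\varphi$. $\mathcal H(\mathbb U_S)$ is the class of countable groups which admit a faithful homogeneous action by isometries on $\mathbb U_S$ (equivalently, which are isomorphic to a dense subgroup of the isometry group of $\mathbb U_S$ for the topology of pointwise convergence, $\mathbb U_S$ being viewed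 as a discrete set). *)

theory Defs
  imports
    "HOL-Analysis.Abstract_Metric_Spaces"
    "HOL-Algebra.Group_Action"
    "Graph_Theory.Bidirected_Digraph"
    "Graph_Theory.Digraph_Component"
begin

section \<open>Actions on trees\<close>

text \<open>
  Trees are graphs in the sense of Serre: every geometric edge is a pair of mutually reverse arcs
  \<open>e\<close>, \<open>rev e\<close>. A circuit is a cycle that does not traverse some \<open>e\<close> and then \<open>rev e\<close>;
  the restriction only excludes the degenerate cycles \<open>[e, rev e]\<close> of length two.
  (The predicate \<open>tree\<close> of \<open>Digraph_Component\<close> is not suitable, since it excludes those
  degenerate cycles too and so describes oriented trees.) Connectedness includes non-emptiness.
\<close>

locale serre_tree = bidirected_digraph T rev
  for T :: "('v, 'e) pre_digraph" and rev :: "'e \<Rightarrow> 'e" +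
  assumes connected: "strongly_connected T"
    and no_circuit:
      "\<And>p. pre_digraph.cycle T p \<Longrightarrow> \<exists>i. Suc i < length p \<and> p ! Suc i = rev (p ! i)"

locale tree_action =
  serre_tree T rev + V: group_action \<Gamma> "verts T" \<phi> + E: group_action \<Gamma> "arcs T" \<psi>
  for T :: "('v, 'e) pre_digraph" and rev :: "'e \<Rightarrow> 'e"
    and \<Gamma> :: "('g, 'x) monoid_scheme"
    and \<phi> :: "'g \<Rightarrow> 'v \<Rightarrow> 'v" and \<psi> :: "'g \<Rightarrow> 'e \<Rightarrow> 'e" +
  assumes act_tail: "\<lbrakk>g \<in> carrier \<Gamma>; e \<in> arcs T\<rbrakk> \<Longrightarrow> tail T (\<psi> g e) = \<phi> g (tail T e)"
    and act_head: "\<lbrakk>g \<in> carrier \<Gamma>; e \<in> arcs T\<rbrakk> \<Longrightarrow> head T (\<psi> g e) = \<phi> g (head T e)"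
    and act_rev: "\<lbrakk>g \<in> carrier \<Gamma>; e \<in> arcs T\<rbrakk> \<Longrightarrow> \<psi> g (rev e) = rev (\<psi> g e)"

text \<open>
  For an action without inversion the stabilizer of an arc is also the stabilizer of the
  corresponding geometric edge.
\<close>

locale tree_action_without_inversion = tree_action +
  assumes no_inversion: "\<lbrakk>g \<in> carrier \<Gamma>; e \<in> arcs T\<rbrakk> \<Longrightarrow> \<psi> g e \<noteq> rev e"


section \<open>Highly core-free subgroups\<close>

definition highly_core_free :: "'a set \<Rightarrow> ('a, 'b) monoid_scheme \<Rightarrow> bool" where
  "highly_core_free \<Sigma> G \<longleftrightarrow>
     subgroup \<Sigma> G \<and>
     (\<forall>F. finite F \<and> F \<subseteq> carrier G \<longrightarrow>
       (\<exists>\<gamma>\<in>carrier G.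
          inj_on (\<lambda>(\<sigma>, f). \<sigma> \<otimes>\<^bsub>G\<^esub> \<gamma> \<otimes>\<^bsub>G\<^esub> f) (\<Sigma> \<times> F) \<and>
          (\<lambda>(\<sigma>, f). \<sigma> \<otimes>\<^bsub>G\<^esub> \<gamma> \<otimes>\<^bsub>G\<^esub> f) ` (\<Sigma> \<times> F) \<inter> F = {}))"


section \<open>Urysohn spaces with prescribed distance sets\<close>

definition bounded_distance_set :: "real set \<Rightarrow> bool" where
  "bounded_distance_set S \<longleftrightarrow>
     countable S \<and> S \<subseteq> {0..} \<and> 0 \<in> S \<and> (\<exists>s\<in>S. s \<noteq> 0) \<and>
     (\<exists>M\<in>S. M > 0 \<and> (\<forall>s\<in>S. s \<le> M) \<and> (\<forall>s\<in>S. \<forall>t\<in>S. min (s + t) M \<in> S))"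

definition S_metric_space :: "real set \<Rightarrow> 'a set \<Rightarrow> ('a \<Rightarrow> 'a \<Rightarrow> real) \<Rightarrow> bool" where
  "S_metric_space S X d \<longleftrightarrow> Metric_space X d \<and> (\<forall>x\<in>X. \<forall>y\<in>X. d x y \<in> S)"

definition isometric_embedding ::
  "'a set \<Rightarrow> ('a \<Rightarrow> 'a \<Rightarrow> real) \<Rightarrow> 'b set \<Rightarrow> ('b \<Rightarrow> 'b \<Rightarrow> real) \<Rightarrow> ('a \<Rightarrow> 'b) \<Rightarrow> bool" where
  "isometric_embedding X d Y d' f \<longleftrightarrow>
     f \<in> X \<rightarrow> Y \<and> (\<forall>x\<in>X. \<forall>y\<in>X. d' (f x) (f y) = d x y)"

text \<open>
  A definition cannot quantify over types, so the extension property is required for finite spaces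
  \<open>Y\<close> of natural numbers only. Up to isometry these are all finite spaces; see
  \<open>S_Urysohn_space_extension\<close> below. The case \<open>X = {}\<close> yields \<open>U \<noteq> {}\<close>.
\<close>

definition S_Urysohn_space :: "real set \<Rightarrow> 'u set \<Rightarrow> ('u \<Rightarrow> 'u \<Rightarrow> real) \<Rightarrow> bool" where
  "S_Urysohn_space S U d \<longleftrightarrow>
     countable U \<and> S_metric_space S U d \<and>
     (\<forall>(Y :: nat set) dY X f.
        finite Y \<and> S_metric_space S Y dY \<and> X \<subseteq> Y \<and> isometric_embedding X dY U d f \<longrightarrow>
        (\<exists>g. isometric_embedding Y dY U d g \<and> (\<forall>x\<in>X. g x = f x)))"

lemma S_Urysohn_space_extension:
  fixes Y :: "'b set"
  assumes U: "S_Urysohn_space S U d"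
    and Y: "finite Y" "S_metric_space S Y dY"
    and X: "X \<subseteq> Y" "isometric_embedding X dY U d f"
  shows "\<exists>g. isometric_embedding Y dY U d g \<and> (\<forall>x\<in>X. g x = f x)"
proof -
  obtain h :: "'b \<Rightarrow> nat" where h: "inj_on h Y"
    using finite_imp_inj_to_nat_seg[OF Y(1)] by blast
  define k where "k = inv_into Y h"
  have kh: "k (h y) = y" if "y \<in> Y" for y
    using that h by (simp add: k_def)
  define e where "e = (\<lambda>m n. dY (k m) (k n))"
  have m: "Metric_space Y dY" and dS: "\<And>x y. x \<in> Y \<Longrightarrow> y \<in> Y \<Longrightarrow> dY x y \<in> S"
    using Y(2) by (auto simp: S_metric_space_def)
  have "Metric_space (h ` Y) e"
  proof
    show "0 \<le> e x y" for x y
      by (simp add: e_def Metric_space.nonneg[OF m])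
    show "e x y = e y x" for x y
      by (simp add: e_def Metric_space.commute[OF m])
    show "(e x y = 0) = (x = y)" if "x \<in> h ` Y" "y \<in> h ` Y" for x y
      using that by (auto simp: e_def kh Metric_space.zero[OF m])
    show "e x z \<le> e x y + e y z" if "x \<in> h ` Y" "y \<in> h ` Y" "z \<in> h ` Y" for x y z
      using that by (auto simp: e_def kh Metric_space.triangle[OF m])
  qed
  then have "S_metric_space S (h ` Y) e"
    using dS by (auto simp: S_metric_space_def e_def kh)
  moreover have "isometric_embedding (h ` X) e U d (f \<circ> k)"
    using X kh by (auto simp: isometric_embedding_def e_def subset_iff Pi_iff)
  ultimately obtain g where g: "isometric_embedding (h ` Y) e U d g"
      "\<forall>x\<in>h ` X. g x = (f \<circ> k) x"
    using U Y(1) X(1) unfolding S_Urysohn_space_def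
    by (metis finite_imageI image_mono)
  have "isometric_embedding Y dY U d (g \<circ> h)"
    using g(1) kh by (auto simp: isometric_embedding_def e_def Pi_iff)
  moreover have "\<forall>x\<in>X. (g \<circ> h) x = f x"
    using g(2) X(1) kh by (auto simp: subset_iff)
  ultimately show ?thesis by blast
qed


section \<open>Homogeneous actions\<close>

definition homogeneous_isometric_action ::
  "('g, 'x) monoid_scheme \<Rightarrow> 'u set \<Rightarrow> ('u \<Rightarrow> 'u \<Rightarrow> real) \<Rightarrow> ('g \<Rightarrow> 'u \<Rightarrow> 'u) \<Rightarrow> bool" where
  "homogeneous_isometric_action \<Gamma> U d \<alpha> \<longleftrightarrow>
     group_action \<Gamma> U \<alpha> \<and>
     (\<forall>\<gamma>\<in>carrier \<Gamma>. isometric_embedding U d U d (\<alpha> \<gamma>)) \<and>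
     (\<forall>A B f. finite A \<and> A \<subseteq> U \<and> B \<subseteq> U \<and> isometric_embedding A d B d f \<and> f ` A = B \<longrightarrow>
        (\<exists>\<gamma>\<in>carrier \<Gamma>. \<forall>x\<in>A. \<alpha> \<gamma> x = f x))"

text \<open>The class of groups associated with the countable metric space \<open>(U, d)\<close>.\<close>

definition in_class_H :: "('g, 'x) monoid_scheme \<Rightarrow> 'u set \<Rightarrow> ('u \<Rightarrow> 'u \<Rightarrow> real) \<Rightarrow> bool" where
  "in_class_H \<Gamma> U d \<longleftrightarrow>
     group \<Gamma> \<and> countable (carrier \<Gamma>) \<and>
     (\<exists>\<alpha>. faithful_action \<Gamma> U \<alpha> \<and> homogeneous_isometric_action \<Gamma> U d \<alpha>)"

end

theory Submission
  imports Defs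
begin

text \<open>
  Fix an arc \<open>e\<close> of the tree, with stabilizer \<open>\<Sigma>\<close>. Given an action \<open>a\<close> of \<open>\<Gamma>\<close> on a set and a permutation
  \<open>w\<close> commuting with \<open>a(\<Sigma>)\<close>, put the weight \<open>a(g) w a(g)\<^sup>-\<^sup>1\<close> on the arc \<open>g e\<close>, the inverse weight on its
  reverse and \<open>1\<close> on all arcs outside the orbit. In a tree the product \<open>P(g)\<close> of the weights along a walk
  from \<open>tail e\<close> to \<open>g (tail e)\<close> does not depend on the walk, and so \<open>g \<mapsto> P(g) a(g)\<close> is a new action, equal
  to \<open>a\<close> on the stabilizer of \<open>tail e\<close> and to \<open>w a w\<^sup>-\<^sup>1\<close> on the stabilizer of \<open>head e\<close>. This replaces the
  decomposition of \<open>\<Gamma>\<close> as an amalgam or HNN extension.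

  The \<open>S\<close>-Urysohn space, a free isometric action of \<open>\<Gamma>\<close> on it and an isometry \<open>w\<close> commuting with \<open>\<Sigma>\<close> are
  built together, as the limit of a generic chain of finite approximations: finitely many free orbits and
  finitely many \<open>\<Sigma>\<close>-orbits of the graph of \<open>w\<close>. In an approximation only finitely many \<open>g\<close> bring two given
  points to distance less than the maximum \<open>M\<close>; so high core-freeness moves finite sets to distance \<open>M\<close>
  from each other by elements \<open>g\<^sub>1, g\<^sub>2\<close> fixing \<open>tail e\<close> and \<open>h\<^sub>1, h\<^sub>2\<close> fixing \<open>head e\<close>, and \<open>w\<close> can be prescribed there
  so that \<open>g\<^sub>2\<^sup>-\<^sup>1 w h\<^sub>2 h\<^sub>1\<^sup>-\<^sup>1 w\<^sup>-\<^sup>1 g\<^sub>1\<close>, the image of \<open>g\<^sub>2\<^sup>-\<^sup>1 h\<^sub>2 h\<^sub>1\<^sup>-\<^sup>1 g\<^sub>1\<close> under the new action, extends a given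
  finite partial isometry. For faithfulness, a point is sent along a reduced walk
  through orbits that are new at each step.
\<close>

section \<open>Metrics on finitely many free orbits\<close>

locale bounded_distances =
  fixes S :: "real set" and M :: real
  assumes S_nonneg: "s \<in> S \<Longrightarrow> 0 \<le> s"
    and S_zero: "0 \<in> S"
    and M_S: "M \<in> S"
    and M_pos: "M > 0"
    and S_le_M: "s \<in> S \<Longrightarrow> s \<le> M"
    and S_add: "\<lbrakk>s \<in> S; t \<in> S\<rbrakk> \<Longrightarrow> min (s + t) M \<in> S"
    and S_countable: "countable S"

locale free_orbits = group G + bounded_distances S M
  for G (structure) and S M +
  assumes G_countable: "countable (carrier G)"
begin

text \<open>A free orbit is modelled as a copy of the group with left translation, labelled by a
  natural number. An orbit added to \<open>pts n\<close> gets the label \<open>n\<close> and the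
  base point \<open>(n, \<one>)\<close>, and the old points keep their names.\<close>

definition act :: "'a \<Rightarrow> nat \<times> 'a \<Rightarrow> nat \<times> 'a" where
  "act g x = (fst x, g \<otimes> snd x)"

definition pts :: "nat \<Rightarrow> (nat \<times> 'a) set" where
  "pts n = {..<n} \<times> carrier G"

lemma act_pair [simp]: "act g (i, h) = (i, g \<otimes> h)"
  by (simp add: act_def)

lemma pts_iff: "x \<in> pts n \<longleftrightarrow> fst x < n \<and> snd x \<in> carrier G"
  by (cases x) (auto simp: pts_def)

lemma act_pts [simp]: "g \<in> carrier G \<Longrightarrow> x \<in> pts n \<Longrightarrow> act g x \<in> pts n"
  by (auto simp: act_def pts_def)

lemma mult_pts [simp]: "g \<in> carrier G \<Longrightarrow> (i, h) \<in> pts n \<Longrightarrow> (i, g \<otimes> h) \<in> pts n"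
  by (auto simp: pts_def)

lemma act_act: "\<lbrakk>g \<in> carrier G; h \<in> carrier G; x \<in> pts n\<rbrakk> \<Longrightarrow> act g (act h x) = act (g \<otimes> h) x"
  by (auto simp: act_def pts_def m_assoc)

lemma act_one [simp]: "x \<in> pts n \<Longrightarrow> act \<one> x = x"
  by (auto simp: act_def pts_def)

lemma act_inv [simp]:
  "\<lbrakk>g \<in> carrier G; x \<in> pts n\<rbrakk> \<Longrightarrow> act (inv g) (act g x) = x"
  "\<lbrakk>g \<in> carrier G; x \<in> pts n\<rbrakk> \<Longrightarrow> act g (act (inv g) x) = x"
  by (simp_all add: act_act)

lemma act_inj: "\<lbrakk>g \<in> carrier G; h \<in> carrier G; x \<in> pts n; act g x = act h x\<rbrakk> \<Longrightarrow> g = h"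
  by (auto simp: act_def pts_def)

lemma pts_mono: "n \<le> m \<Longrightarrow> x \<in> pts n \<Longrightarrow> x \<in> pts m"
  by (auto simp: pts_def)

lemma pts_Suc_cases:
  assumes "x \<in> pts (Suc n)"
  obtains "x \<in> pts n" | g where "g \<in> carrier G" "x = (n, g)"
  using assms by (cases x) (auto simp: pts_def less_Suc_eq)

end

text \<open>Nothing is required of \<open>d\<close> off \<open>pts n\<close>, so extending a metric
  means agreeing with it on \<open>pts n\<close>. The finiteness in \<open>d_finite\<close> is
  preserved by each extension; it makes the set of group elements to be avoided later a finite
  one.\<close>

locale orbit_metric = free_orbits +
  fixes n :: nat and d :: "nat \<times> 'a \<Rightarrow> nat \<times> 'a \<Rightarrow> real"
  assumes d_S: "\<lbrakk>x \<in> pts n; y \<in> pts n\<rbrakk> \<Longrightarrow> d x y \<in> S"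
    and d_commute: "\<lbrakk>x \<in> pts n; y \<in> pts n\<rbrakk> \<Longrightarrow> d x y = d y x"
    and d_zero: "\<lbrakk>x \<in> pts n; y \<in> pts n\<rbrakk> \<Longrightarrow> d x y = 0 \<longleftrightarrow> x = y"
    and d_triangle: "\<lbrakk>x \<in> pts n; y \<in> pts n; z \<in> pts n\<rbrakk> \<Longrightarrow> d x z \<le> d x y + d y z"
    and d_act: "\<lbrakk>g \<in> carrier G; x \<in> pts n; y \<in> pts n\<rbrakk> \<Longrightarrow> d (act g x) (act g y) = d x y"
    and d_finite: "\<lbrakk>x \<in> pts n; y \<in> pts n\<rbrakk> \<Longrightarrow> finite {g \<in> carrier G. d x (act g y) < M}"
begin

lemma d_nonneg: "\<lbrakk>x \<in> pts n; y \<in> pts n\<rbrakk> \<Longrightarrow> 0 \<le> d x y"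
  using d_S S_nonneg by blast

lemma d_le_M: "\<lbrakk>x \<in> pts n; y \<in> pts n\<rbrakk> \<Longrightarrow> d x y \<le> M"
  using d_S S_le_M by blast

lemma d_act_inv: "\<lbrakk>g \<in> carrier G; x \<in> pts n; y \<in> pts n\<rbrakk> \<Longrightarrow> d (act (inv g) x) y = d x (act g y)"
  using d_act[of g "act (inv g) x" y] by simp

text \<open>Each point is a translate of one of the \<open>n\<close> base points, and
  \<open>d_finite\<close> treats each orbit separately.\<close>

lemma finite_near: "x \<in> pts n \<Longrightarrow> finite {y \<in> pts n. d x y < M}"
proof -
  assume x: "x \<in> pts n"
  have "{y \<in> pts n. d x y < M} \<subseteq> (\<Union>i<n. (\<lambda>g. act g (i, \<one>)) ` {g \<in> carrier G. d x (act g (i, \<one>)) < M})"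
    by (auto simp: pts_def)
  moreover have "finite \<dots>"
    using x by (intro finite_UN_I finite_imageI d_finite) (auto simp: pts_def)
  ultimately show ?thesis using finite_subset by blast
qed

text \<open>By invariance the whole metric is determined by the distances \<open>f\<close> from the
  new base point to the old points and \<open>q\<close> inside the new orbit. \<open>f_lip\<close>
  and \<open>f_up\<close> are the triangle inequalities with one new point, \<open>fq\<close> and
  \<open>qf\<close> those with two, \<open>q_mult\<close> those with three.\<close>

lemma extend_total:
  assumes fS: "\<And>x. x \<in> pts n \<Longrightarrow> f x \<in> S" and fpos: "\<And>x. x \<in> pts n \<Longrightarrow> f x > 0"
    and f_lip: "\<And>x y. \<lbrakk>x \<in> pts n; y \<in> pts n\<rbrakk> \<Longrightarrow> f x \<le> d x y + f y"
    and f_up: "\<And>x y. \<lbrakk>x \<in> pts n; y \<in> pts n\<rbrakk> \<Longrightarrow> d x y \<le> f x + f y"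
    and f_finite: "finite {x \<in> pts n. f x < M}"
    and qS: "\<And>g. g \<in> carrier G \<Longrightarrow> q g \<in> S"
    and q_zero: "\<And>g. g \<in> carrier G \<Longrightarrow> q g = 0 \<longleftrightarrow> g = \<one>"
    and q_inv: "\<And>g. g \<in> carrier G \<Longrightarrow> q (inv g) = q g"
    and q_mult: "\<And>g h. \<lbrakk>g \<in> carrier G; h \<in> carrier G\<rbrakk> \<Longrightarrow> q (g \<otimes> h) \<le> q g + q h"
    and q_finite: "finite {g \<in> carrier G. q g < M}"
    and fq: "\<And>g x. \<lbrakk>g \<in> carrier G; x \<in> pts n\<rbrakk> \<Longrightarrow> f (act g x) \<le> q g + f x"
    and qf: "\<And>g x. \<lbrakk>g \<in> carrier G; x \<in> pts n\<rbrakk> \<Longrightarrow> q g \<le> f x + f (act g x)"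
  obtains d' where "orbit_metric G S M (Suc n) d'"
    and "\<And>x y. \<lbrakk>x \<in> pts n; y \<in> pts n\<rbrakk> \<Longrightarrow> d' x y = d x y"
    and "\<And>x. x \<in> pts n \<Longrightarrow> d' (n, \<one>) x = f x"
    and "\<And>g. g \<in> carrier G \<Longrightarrow> d' (n, \<one>) (n, g) = q g"
proof -
  define d' where "d' x y =
    (if fst x < n then (if fst y < n then d x y else f (act (inv (snd y)) x))
     else (if fst y < n then f (act (inv (snd x)) y) else q (inv (snd x) \<otimes> snd y)))" for x y
  have d1: "d' x y = d x y" if "x \<in> pts n" "y \<in> pts n" for x y
    using that by (simp add: d'_def pts_iff)
  have d2: "d' x (n, g) = f (act (inv g) x)" if "x \<in> pts n" for x g
    using that by (simp add: d'_def pts_iff)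
  have d3: "d' (n, g) x = f (act (inv g) x)" if "x \<in> pts n" for x g
    using that by (simp add: d'_def pts_iff)
  have d4: "d' (n, g) (n, h) = q (inv g \<otimes> h)" for g h
    by (simp add: d'_def)
  note ds = d1 d2 d3 d4
  have q_swap: "q (inv g \<otimes> h) = q (inv h \<otimes> g)" if "g \<in> carrier G" "h \<in> carrier G" for g h
    using q_inv[of "inv g \<otimes> h"] that by (simp add: inv_mult_group)
  have "orbit_metric G S M (Suc n) d'"
  proof
    fix x y assume x: "x \<in> pts (Suc n)" and y: "y \<in> pts (Suc n)"
    show "d' x y \<in> S"
      by (rule pts_Suc_cases[OF x]; rule pts_Suc_cases[OF y]) (auto simp: ds d_S fS qS)
    show "d' x y = d' y x"
      by (rule pts_Suc_cases[OF x]; rule pts_Suc_cases[OF y]) (auto simp: ds d_commute q_swap)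
    have [simp]: "f x \<noteq> 0" if "x \<in> pts n" for x using fpos[OF that] by simp
    have [simp]: "(n, g) \<notin> pts n" for g by (simp add: pts_def)
    have [simp]: "inv g \<otimes> h = \<one> \<longleftrightarrow> g = h" if "g \<in> carrier G" "h \<in> carrier G" for g h
      using that by (metis inv_closed inv_equality inv_inv l_inv)
    show "d' x y = 0 \<longleftrightarrow> x = y"
      by (rule pts_Suc_cases[OF x]; rule pts_Suc_cases[OF y]) (auto simp: ds d_zero q_zero)
    show "finite {g \<in> carrier G. d' x (act g y) < M}"
    proof (rule pts_Suc_cases[OF y])
      assume y: "y \<in> pts n"
      show ?thesis
      proof (rule pts_Suc_cases[OF x])
        assume "x \<in> pts n"
        then have "{g \<in> carrier G. d' x (act g y) < M} = {g \<in> carrier G. d x (act g y) < M}"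
          using y by (auto simp: ds)
        then show ?thesis using d_finite[OF \<open>x \<in> pts n\<close> y] by simp
      next
        fix h assume h: "h \<in> carrier G" "x = (n, h)"
        \<comment> \<open>The action is free, so the finite set of \<open>f_finite\<close> has a
          finite preimage under this map.\<close>
        have "inj_on (\<lambda>g. act (inv h \<otimes> g) y) (carrier G)"
        proof (rule inj_onI)
          fix a b assume ab: "a \<in> carrier G" "b \<in> carrier G" "act (inv h \<otimes> a) y = act (inv h \<otimes> b) y"
          then have "inv h \<otimes> a = inv h \<otimes> b"
            using act_inj[OF _ _ y] h by simp
          then show "a = b" using ab h by simp
        qed
        from finite_vimage_IntI[OF f_finite this]
        show ?thesis
          by (rule rev_finite_subset) (use h y in \<open>auto simp: ds act_act\<close>)
      qed
    next
      fix k assume k: "k \<in> carrier G" "y = (n, k)"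
      show ?thesis
      proof (rule pts_Suc_cases[OF x])
        assume x: "x \<in> pts n"
        have "inj_on (\<lambda>g. act (inv (g \<otimes> k)) x) (carrier G)"
        proof (rule inj_onI)
          fix a b assume ab: "a \<in> carrier G" "b \<in> carrier G" "act (inv (a \<otimes> k)) x = act (inv (b \<otimes> k)) x"
          then have "inv (a \<otimes> k) = inv (b \<otimes> k)"
            using act_inj[OF _ _ x] k by simp
          then have "a \<otimes> k = b \<otimes> k"
            using ab k by (metis inv_inv m_closed)
          then show "a = b" using ab k by simp
        qed
        from finite_vimage_IntI[OF f_finite this]
        show ?thesis
          by (rule rev_finite_subset) (use k x in \<open>auto simp: ds act_act\<close>)
      next
        fix h assume h: "h \<in> carrier G" "x = (n, h)"
        have "inj_on (\<lambda>g. inv h \<otimes> (g \<otimes> k)) (carrier G)"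
          using h k by (auto intro!: inj_onI)
        from finite_vimage_IntI[OF q_finite this]
        show ?thesis
          by (rule rev_finite_subset) (use h k in \<open>auto simp: ds\<close>)
      qed
    qed
    fix g assume g: "g \<in> carrier G"
    have [simp]: "inv (g \<otimes> h) \<otimes> (g \<otimes> k) = inv h \<otimes> k" if "h \<in> carrier G" "k \<in> carrier G" for h k
      using that g by (simp add: inv_mult_group m_assoc) (simp add: m_assoc[symmetric])
    have [simp]: "act (inv (g \<otimes> h)) (act g z) = act (inv h) z" if "h \<in> carrier G" "z \<in> pts n" for h z
      using that g by (simp add: act_act inv_mult_group m_assoc)
    show "d' (act g x) (act g y) = d' x y"
      by (rule pts_Suc_cases[OF x]; rule pts_Suc_cases[OF y]) (use g in \<open>auto simp: ds d_act\<close>)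
  next
    fix x y z assume x: "x \<in> pts (Suc n)" and y: "y \<in> pts (Suc n)" and z: "z \<in> pts (Suc n)"
    have t1: "f (act (inv h) u) \<le> d u v + f (act (inv h) v)"
      if "h \<in> carrier G" "u \<in> pts n" "v \<in> pts n" for h u v
      using f_lip[of "act (inv h) u" "act (inv h) v"] d_act[of "inv h" u v] that by simp
    have t2: "d u v \<le> f (act (inv h) u) + f (act (inv h) v)"
      if "h \<in> carrier G" "u \<in> pts n" "v \<in> pts n" for h u v
      using f_up[of "act (inv h) u" "act (inv h) v"] d_act[of "inv h" u v] that by simp
    have t3: "q (inv g \<otimes> h) \<le> f (act (inv g) u) + f (act (inv h) u)"
      if "h \<in> carrier G" "g \<in> carrier G" "u \<in> pts n" for h g u
      using qf[of "inv h \<otimes> g" "act (inv g) u"] q_swap[of g h] that by (simp add: act_act m_assoc)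
    have t4: "f (act (inv g) u) \<le> q (inv g \<otimes> h) + f (act (inv h) u)"
      if "h \<in> carrier G" "g \<in> carrier G" "u \<in> pts n" for h g u
      using fq[of "inv g \<otimes> h" "act (inv h) u"] that by (simp add: act_act m_assoc)
    have t5: "q (inv g \<otimes> k) \<le> q (inv g \<otimes> h) + q (inv h \<otimes> k)"
      if "h \<in> carrier G" "g \<in> carrier G" "k \<in> carrier G" for h g k
    proof -
      have "inv g \<otimes> k = (inv g \<otimes> h) \<otimes> (inv h \<otimes> k)"
        using that by (simp add: m_assoc) (simp add: m_assoc[symmetric])
      then show ?thesis using q_mult[of "inv g \<otimes> h" "inv h \<otimes> k"] that by simp
    qed
    show "d' x z \<le> d' x y + d' y z"
    proof (rule pts_Suc_cases[OF x]; rule pts_Suc_cases[OF y]; rule pts_Suc_cases[OF z])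
      assume "x \<in> pts n" "y \<in> pts n" "z \<in> pts n"
      then show ?thesis by (simp add: ds d_triangle)
    next
      fix g assume "x \<in> pts n" "y \<in> pts n" "g \<in> carrier G" "z = (n, g)"
      then show ?thesis by (simp add: ds t1)
    next
      fix g assume "x \<in> pts n" "z \<in> pts n" "g \<in> carrier G" "y = (n, g)"
      then show ?thesis by (simp add: ds t2)
    next
      fix g h assume "x \<in> pts n" "g \<in> carrier G" "y = (n, g)" "h \<in> carrier G" "z = (n, h)"
      then show ?thesis using t4[of g h x] q_swap[of g h] by (simp add: ds)
    next
      fix g assume "y \<in> pts n" "z \<in> pts n" "g \<in> carrier G" "x = (n, g)"
      then show ?thesis using t1[of g z y] d_commute[of z y] by (simp add: ds)
    next
      fix g h assume "y \<in> pts n" "g \<in> carrier G" "x = (n, g)" "h \<in> carrier G" "z = (n, h)"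
      then show ?thesis using t3[of h g y] by (simp add: ds)
    next
      fix g h assume "z \<in> pts n" "g \<in> carrier G" "x = (n, g)" "h \<in> carrier G" "y = (n, h)"
      then show ?thesis using t4[of h g z] by (simp add: ds)
    next
      fix g h k assume "g \<in> carrier G" "x = (n, g)" "h \<in> carrier G" "y = (n, h)" "k \<in> carrier G" "z = (n, k)"
      then show ?thesis using t5[of h g k] by (simp add: ds)
    qed
  qed
  then show ?thesis
    by (rule that) (auto simp: ds)
qed

text \<open>
  The distances from the new orbit are the largest ones allowed by the data on \<open>R\<close> and \<open>K\<close>: lengths of
  shortest paths through \<open>R\<close>, truncated at \<open>M\<close>. They belong to \<open>S\<close> because paths through points of \<open>R\<close> outside
  the finite set \<open>Z\<close> have length at least \<open>M\<close>, so that the infimum is attained.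
\<close>

lemma extend_partial:
  assumes K: "subgroup K G" and R: "R \<subseteq> pts n"
    and R_act: "\<And>k r. \<lbrakk>k \<in> K; r \<in> R\<rbrakk> \<Longrightarrow> act k r \<in> R"
    and fS: "\<And>x. x \<in> R \<Longrightarrow> f x \<in> S" and fpos: "\<And>x. x \<in> R \<Longrightarrow> f x > 0"
    and f_lip: "\<And>x y. \<lbrakk>x \<in> R; y \<in> R\<rbrakk> \<Longrightarrow> f x \<le> d x y + f y"
    and f_up: "\<And>x y. \<lbrakk>x \<in> R; y \<in> R\<rbrakk> \<Longrightarrow> d x y \<le> f x + f y"
    and f_finite: "finite {x \<in> R. f x < M}"
    and qS: "\<And>g. g \<in> K \<Longrightarrow> q g \<in> S"
    and q_zero: "\<And>g. g \<in> K \<Longrightarrow> q g = 0 \<longleftrightarrow> g = \<one>"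
    and q_inv: "\<And>g. g \<in> K \<Longrightarrow> q (inv g) = q g"
    and q_mult: "\<And>g h. \<lbrakk>g \<in> K; h \<in> K\<rbrakk> \<Longrightarrow> q (g \<otimes> h) \<le> q g + q h"
    and q_finite: "finite {g \<in> K. q g < M}"
    and fq: "\<And>g x. \<lbrakk>g \<in> K; x \<in> R\<rbrakk> \<Longrightarrow> f (act g x) \<le> q g + f x"
    and qf: "\<And>g x. \<lbrakk>g \<in> K; x \<in> R\<rbrakk> \<Longrightarrow> q g \<le> f x + f (act g x)"
  obtains d' where "orbit_metric G S M (Suc n) d'"
    and "\<And>x y. \<lbrakk>x \<in> pts n; y \<in> pts n\<rbrakk> \<Longrightarrow> d' x y = d x y"
    and "\<And>x. x \<in> R \<Longrightarrow> d' (n, \<one>) x = f x"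
    and "\<And>g. g \<in> K \<Longrightarrow> d' (n, \<one>) (n, g) = q g"
proof -
  define Z where "Z = {x \<in> R. f x < M}"
  \<comment> \<open>The \<open>M\<close> in the minimum truncates the path length and keeps the
    minimum meaningful for empty \<open>Z\<close>.\<close>
  define F where "F x = Min (insert M ((\<lambda>r. f r + d r x) ` Z))" for x
  \<comment> \<open>The path runs from the base point through \<open>r\<close> to
    \<open>(n, g)\<close>; by invariance its second half has length
    \<open>F (act (inv g) r)\<close>. Restricting \<open>r\<close> to \<open>Z\<close> loses
    nothing, as \<open>m_le\<close> shows.\<close>
  define m where "m g = Min (insert M ((\<lambda>r. F r + F (act (inv g) r)) ` Z))" for g
  \<comment> \<open>Inside \<open>K\<close> the value is prescribed; \<open>qf\<close> keeps it
    below the path length \<open>m\<close>, which is \<open>Q_le_m\<close>.\<close>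
  define Q where "Q g = (if g \<in> K then q g else m g)" for g
  have finZ: "finite Z" using f_finite by (simp add: Z_def)
  have Z: "r \<in> R" "r \<in> pts n" if "r \<in> Z" for r using that R by (auto simp: Z_def)
  have Kc: "k \<in> carrier G" if "k \<in> K" for k using that subgroup.subset[OF K] by blast
  have K1: "\<one> \<in> K" and Kinv: "\<And>k. k \<in> K \<Longrightarrow> inv k \<in> K"
    and Kmult: "\<And>k l. k \<in> K \<Longrightarrow> l \<in> K \<Longrightarrow> k \<otimes> l \<in> K"
    using K by (auto simp: subgroup_def)

  have F_le_M: "F x \<le> M" for x using finZ by (auto simp: F_def)
  have F_cases: "F x = M \<or> (\<exists>r\<in>Z. F x = f r + d r x)" for x
    using Min_in[of "insert M ((\<lambda>r. f r + d r x) ` Z)"] finZ by (auto simp: F_def)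
  have F_le: "F x \<le> f r + d r x" if "r \<in> R" "x \<in> pts n" for r x
  proof (cases "f r < M")
    case True
    then have "r \<in> Z" using that by (simp add: Z_def)
    then show ?thesis using finZ by (auto simp: F_def)
  next
    case False
    then show ?thesis using F_le_M[of x] d_nonneg[of r x] that R by force
  qed
  have F_S: "F x \<in> S" if "x \<in> pts n" for x
    using F_cases[of x]
  proof
    assume "\<exists>r\<in>Z. F x = f r + d r x"
    then obtain r where r: "r \<in> Z" "F x = f r + d r x" by blast
    then have "min (f r + d r x) M \<in> S" using S_add fS d_S Z that by blast
    then show ?thesis using F_le_M[of x] r by (simp add: min_def split: if_splits)
  qed (simp add: M_S)
  have F_pos: "F x > 0" if "x \<in> pts n" for x
    using F_cases[of x] M_pos fpos d_nonneg Z that by (metis add_pos_nonneg)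
  have F_nonneg: "F x \<ge> 0" if "x \<in> pts n" for x
    using F_pos[OF that] by simp
  have F_R: "F r = f r" if "r \<in> R" for r
  proof (rule antisym)
    have r: "r \<in> pts n" using that R by blast
    show "F r \<le> f r" using F_le[OF that r] d_zero[OF r r] by simp
    show "f r \<le> F r"
      using F_cases[of r]
    proof
      assume "\<exists>s\<in>Z. F r = f s + d s r"
      then obtain s where "s \<in> Z" "F r = f s + d s r" by blast
      then show ?thesis using f_lip[of r s] d_commute[of r s] Z r that by fastforce
    qed (use fS S_le_M that in simp)
  qed
  have F_lip: "F x \<le> d x y + F y" if x: "x \<in> pts n" and y: "y \<in> pts n" for x y
    using F_cases[of y]
  proof
    assume "F y = M"
    then show ?thesis using F_le_M[of x] d_nonneg[OF x y] by simp
  next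
    assume "\<exists>r\<in>Z. F y = f r + d r y"
    then obtain r where r: "r \<in> Z" "F y = f r + d r y" by blast
    show ?thesis using F_le[OF Z(1) x, OF r(1)] d_triangle[OF Z(2) y x, OF r(1)] r(2) d_commute[OF x y] by simp
  qed
  have F_up: "d x y \<le> F x + F y" if x: "x \<in> pts n" and y: "y \<in> pts n" for x y
  proof (cases "F x = M \<or> F y = M")
    case True
    then show ?thesis using d_le_M[OF x y] F_nonneg[OF x] F_nonneg[OF y] by auto
  next
    case False
    then obtain r s where r: "r \<in> Z" "F x = f r + d r x" and s: "s \<in> Z" "F y = f s + d s y"
      using F_cases by metis
    note rs = Z[OF r(1)] Z[OF s(1)]
    have "d x y \<le> d x r + (d r s + d s y)"
      using d_triangle[of x r y] d_triangle[of r s y] rs x y by simp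
    then show ?thesis
      using f_up[OF rs(1) rs(3)] r s d_commute[of x r] rs x by simp
  qed
  have F_finite: "finite {x \<in> pts n. F x < M}"
  proof (rule finite_subset)
    show "{x \<in> pts n. F x < M} \<subseteq> (\<Union>r\<in>Z. {x \<in> pts n. d r x < M})"
    proof safe
      fix i g assume x: "(i, g) \<in> pts n" "F (i, g) < M"
      then obtain r where r: "r \<in> Z" "F (i, g) = f r + d r (i, g)"
        using F_cases[of "(i, g)"] by auto
      then have "d r (i, g) < M" using x fpos[OF Z(1)] by fastforce
      then show "(i, g) \<in> (\<Union>r\<in>Z. {x \<in> pts n. d r x < M})" using x r by blast
    qed
    show "finite (\<Union>r\<in>Z. {x \<in> pts n. d r x < M})"
      using finZ finite_near Z by blast
  qed
  have F_q: "F (act k x) \<le> q k + F x" if k: "k \<in> K" and x: "x \<in> pts n" for k x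
    using F_cases[of x]
  proof
    assume "F x = M"
    then show ?thesis using F_le_M[of "act k x"] S_nonneg[OF qS[OF k]] by simp
  next
    assume "\<exists>r\<in>Z. F x = f r + d r x"
    then obtain r where r: "r \<in> Z" "F x = f r + d r x" by blast
    have "F (act k x) \<le> f (act k r) + d (act k r) (act k x)"
      using r Z R_act k x Kc by (intro F_le) auto
    also have "\<dots> \<le> q k + f r + d r x"
      using fq[OF k Z(1)] d_act[OF Kc Z(2) x] k r(1) by simp
    finally show ?thesis using r by simp
  qed

  have m_le_M: "m g \<le> M" for g using finZ by (auto simp: m_def)
  have m_cases: "m g = M \<or> (\<exists>r\<in>Z. m g = F r + F (act (inv g) r))" for g
    using Min_in[of "insert M ((\<lambda>r. F r + F (act (inv g) r)) ` Z)"] finZ by (auto simp: m_def)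
  have m_le: "m g \<le> F x + F (act (inv g) x)" if x: "x \<in> pts n" and g: "g \<in> carrier G" for g x
    using F_cases[of x]
  proof
    assume "F x = M"
    then show ?thesis using m_le_M[of g] F_nonneg[of "act (inv g) x"] x g by simp
  next
    assume "\<exists>r\<in>Z. F x = f r + d r x"
    then obtain r where r: "r \<in> Z" "F x = f r + d r x" by blast
    have "m g \<le> F r + F (act (inv g) r)"
      using finZ r by (auto simp: m_def)
    moreover have "F (act (inv g) r) \<le> d r x + F (act (inv g) x)"
      using F_lip[of "act (inv g) r" "act (inv g) x"] d_act[of "inv g" r x] Z r x g by simp
    ultimately show ?thesis using r F_R Z by fastforce
  qed
  have m_inv: "m (inv g) \<le> m g" if g: "g \<in> carrier G" for g
    using m_cases[of g]
  proof
    assume "\<exists>r\<in>Z. m g = F r + F (act (inv g) r)"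
    then obtain r where r: "r \<in> Z" "m g = F r + F (act (inv g) r)" by blast
    then show ?thesis using m_le[of "act (inv g) r" "inv g"] Z(2)[OF r(1)] g by simp
  qed (use m_le_M in simp)
  have Q_le_m: "Q g \<le> m g" if g: "g \<in> carrier G" for g
  proof (cases "g \<in> K")
    case k: True
    show ?thesis using m_cases[of g]
    proof
      assume "m g = M"
      then show ?thesis using k S_le_M qS by (simp add: Q_def)
    next
      assume "\<exists>r\<in>Z. m g = F r + F (act (inv g) r)"
      then obtain r where r: "r \<in> Z" "m g = F r + F (act (inv g) r)" by blast
      then show ?thesis
        using k qf[OF Kinv[OF k] Z(1)] q_inv[OF k] F_R Z R_act[OF Kinv[OF k]] by (simp add: Q_def)
    qed
  qed (simp add: Q_def)
  have Q_inv_le: "Q (inv g) \<le> Q g" if "g \<in> carrier G" for g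
  proof -
    have "inv g \<in> K \<longleftrightarrow> g \<in> K" using Kinv[of "inv g"] Kinv[of g] that by auto
    then show ?thesis using q_inv m_inv[OF that] by (auto simp: Q_def)
  qed
  have Q_inv: "Q (inv g) = Q g" if "g \<in> carrier G" for g
    using Q_inv_le[OF that] Q_inv_le[of "inv g"] that by simp
  \<comment> \<open>Left translation by \<open>g\<close> carries a path for \<open>h\<close> to one
    for \<open>g \<otimes> h\<close>, and \<open>F_q\<close> bounds the cost of moving its first
    half.\<close>
  have Q_mult1: "Q (g \<otimes> h) \<le> Q g + Q h" if g: "g \<in> K" and h: "h \<in> carrier G" for g h
  proof (cases "h \<in> K")
    case True
    then show ?thesis using q_mult g Kmult by (simp add: Q_def)
  next
    case False
    have gh: "g \<otimes> h \<in> carrier G" using Kc g h by simp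
    have "m (g \<otimes> h) \<le> q g + m h" using m_cases[of h]
    proof
      assume "m h = M"
      then show ?thesis using m_le_M[of "g \<otimes> h"] S_nonneg qS g by fastforce
    next
      assume "\<exists>r\<in>Z. m h = F r + F (act (inv h) r)"
      then obtain r where r: "r \<in> Z" "m h = F r + F (act (inv h) r)" by blast
      have "act (inv (g \<otimes> h)) (act g r) = act (inv h) r"
        using Kc[OF g] h Z(2)[OF r(1)] by (simp add: act_act inv_mult_group m_assoc)
      then have "m (g \<otimes> h) \<le> F (act g r) + F (act (inv h) r)"
        using m_le[of "act g r" "g \<otimes> h"] gh Kc[OF g] Z[OF r(1)] by simp
      then show ?thesis using F_q[OF g Z(2)] r by fastforce
    qed
    then show ?thesis using Q_le_m[OF gh] g False by (simp add: Q_def)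
  qed
  have Q_mult: "Q (g \<otimes> h) \<le> Q g + Q h" if g: "g \<in> carrier G" and h: "h \<in> carrier G" for g h
  proof -
    consider "g \<in> K" | "h \<in> K" | "g \<notin> K" "h \<notin> K" by blast
    then show ?thesis
    proof cases
      case 1
      then show ?thesis using Q_mult1 h by blast
    next
      case 2
      have "Q (g \<otimes> h) = Q (inv h \<otimes> inv g)"
        using Q_inv[of "g \<otimes> h"] g h by (simp add: inv_mult_group)
      also have "\<dots> \<le> Q (inv h) + Q (inv g)"
        using Q_mult1[OF Kinv[OF 2]] g by simp
      finally show ?thesis using Q_inv g h by simp
    next
      \<comment> \<open>Two paths, through \<open>r\<close> and through \<open>s\<close>, meet at a
        new point. \<open>F_up\<close> replaces the detour through it by the old distance from
        \<open>act (inv g) r\<close> to \<open>s\<close>, and \<open>F_lip\<close> then leaves a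
        path through \<open>r\<close> alone.\<close>
      case 3
      have "m (g \<otimes> h) \<le> m g + m h"
      proof (cases "m g = M \<or> m h = M")
        case True
        have "0 \<le> m k" if "k \<in> carrier G" for k
          using m_cases[of k] M_pos F_nonneg Z that by (metis act_pts add_nonneg_nonneg inv_closed less_imp_le)
        then show ?thesis using True m_le_M[of "g \<otimes> h"] g h by fastforce
      next
        case False
        then obtain r s where r: "r \<in> Z" "m g = F r + F (act (inv g) r)"
            and s: "s \<in> Z" "m h = F s + F (act (inv h) s)"
          using m_cases by metis
        note rs = Z(2)[OF r(1)] Z(2)[OF s(1)]
        have "m (g \<otimes> h) \<le> F r + F (act (inv h) (act (inv g) r))"
          using m_le[OF rs(1), of "g \<otimes> h"] g h rs by (simp add: act_act inv_mult_group)
        moreover have "F (act (inv h) (act (inv g) r)) \<le> d (act (inv g) r) s + F (act (inv h) s)"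
          using F_lip[of "act (inv h) (act (inv g) r)" "act (inv h) s"] d_act[of "inv h" "act (inv g) r" s] g h rs
          by simp
        moreover have "d (act (inv g) r) s \<le> F (act (inv g) r) + F s"
          using F_up g rs by simp
        ultimately show ?thesis using r s by simp
      qed
      then show ?thesis using Q_le_m[of "g \<otimes> h"] g h 3 by (simp add: Q_def)
    qed
  qed
  have m_pos: "m g > 0" if "g \<in> carrier G" for g
    using m_cases[of g] M_pos F_pos Z that by (metis act_pts add_pos_pos inv_closed)
  have m_S: "m g \<in> S" if "g \<in> carrier G" for g
    using m_cases[of g]
  proof
    assume "\<exists>r\<in>Z. m g = F r + F (act (inv g) r)"
    then obtain r where r: "r \<in> Z" "m g = F r + F (act (inv g) r)" by blast
    then have "min (F r + F (act (inv g) r)) M \<in> S" using S_add F_S Z that by simp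
    then show ?thesis using m_le_M[of g] r by (simp add: min_def split: if_splits)
  qed (simp add: M_S)
  have Q_finite: "finite {g \<in> carrier G. Q g < M}"
  proof (rule finite_subset)
    let ?P = "\<lambda>r. (\<lambda>g. act (inv g) r) -` {x \<in> pts n. F x < M} \<inter> carrier G"
    show "{g \<in> carrier G. Q g < M} \<subseteq> {g \<in> K. q g < M} \<union> (\<Union>r\<in>Z. ?P r)"
    proof
      fix g assume g: "g \<in> {g \<in> carrier G. Q g < M}"
      show "g \<in> {g \<in> K. q g < M} \<union> (\<Union>r\<in>Z. ?P r)"
      proof (cases "g \<in> K")
        case False
        then obtain r where r: "r \<in> Z" "F r + F (act (inv g) r) < M"
          using m_cases[of g] g by (auto simp: Q_def)
        then have "F (act (inv g) r) < M" using F_pos[OF Z(2)] by fastforce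
        then show ?thesis using r g Z by auto
      qed (use g in \<open>auto simp: Q_def\<close>)
    qed
    have "inj_on (\<lambda>g. act (inv g) r) (carrier G)" if "r \<in> Z" for r
    proof (rule inj_onI)
      fix a b assume ab: "a \<in> carrier G" "b \<in> carrier G" "act (inv a) r = act (inv b) r"
      then have "inv a = inv b" using act_inj[OF _ _ Z(2)] that by simp
      then show "a = b" using ab by (metis inv_inv)
    qed
    then show "finite ({g \<in> K. q g < M} \<union> (\<Union>r\<in>Z. ?P r))"
      using q_finite finZ F_finite by (intro finite_UnI finite_UN_I finite_vimage_IntI) simp_all
  qed
  have Q_zero: "Q g = 0 \<longleftrightarrow> g = \<one>" if "g \<in> carrier G" for g
    using q_zero[of g] m_pos[OF that] K1 by (auto simp: Q_def)
  have FQ: "F (act g x) \<le> Q g + F x" if g: "g \<in> carrier G" and x: "x \<in> pts n" for g x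
  proof (cases "g \<in> K")
    case True
    then show ?thesis using F_q x by (simp add: Q_def)
  next
    case False
    have "F (act g x) \<le> m g + F x" using m_cases[of g]
    proof
      assume "m g = M"
      then show ?thesis using F_le_M[of "act g x"] F_nonneg[OF x] by simp
    next
      assume "\<exists>r\<in>Z. m g = F r + F (act (inv g) r)"
      then obtain r where r: "r \<in> Z" "m g = F r + F (act (inv g) r)" by blast
      note r' = Z(2)[OF r(1)]
      have "d (act g x) r = d x (act (inv g) r)"
        using d_act_inv[of "inv g" x r] g x r' by simp
      then show ?thesis
        using F_lip[of "act g x" r] F_up[of x "act (inv g) r"] g x r' r by simp
    qed
    then show ?thesis using False by (simp add: Q_def)
  qed
  have QF: "Q g \<le> F x + F (act g x)" if g: "g \<in> carrier G" and x: "x \<in> pts n" for g x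
    using Q_le_m[OF g] m_le[of "act g x" g] g x by simp
  obtain d' where d': "orbit_metric G S M (Suc n) d'"
    "\<And>x y. \<lbrakk>x \<in> pts n; y \<in> pts n\<rbrakk> \<Longrightarrow> d' x y = d x y"
    "\<And>x. x \<in> pts n \<Longrightarrow> d' (n, \<one>) x = F x"
    "\<And>g. g \<in> carrier G \<Longrightarrow> d' (n, \<one>) (n, g) = Q g"
    by (rule extend_total[of F Q])
      (use F_S F_pos F_lip F_up F_finite Q_zero Q_inv Q_mult Q_finite FQ QF qS m_S in \<open>auto simp: Q_def\<close>)
  show ?thesis
    by (rule that[OF d'(1,2)]) (use d' R F_R Kc in \<open>auto simp: Q_def\<close>)
qed

end

section \<open>Finite approximations\<close>

text \<open>
  \<open>trace G \<rho> p x z\<close> means that the word \<open>p\<close> maps \<open>x\<close> to \<open>z\<close>, where \<open>(h, True)\<close> stands for \<open>h w h\<^sup>-\<^sup>1\<close> and \<open>(h, False)\<close>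
  for its inverse, \<open>\<rho>\<close> being the graph of \<open>w\<close>; the last letter acts first.
\<close>

definition step :: "('a, 'm) monoid_scheme \<Rightarrow> ((nat \<times> 'a) \<times> (nat \<times> 'a)) set \<Rightarrow> 'a \<times> bool \<Rightarrow> nat \<times> 'a \<Rightarrow> nat \<times> 'a \<Rightarrow> bool"
  where "step G \<rho> c x z =
    (let t = (\<lambda>y. (fst y, inv\<^bsub>G\<^esub> (fst c) \<otimes>\<^bsub>G\<^esub> snd y)) in
     snd x \<in> carrier G \<and> snd z \<in> carrier G \<and>
     (if snd c then (t x, t z) \<in> \<rho> else (t z, t x) \<in> \<rho>))"

primrec trace :: "('a, 'm) monoid_scheme \<Rightarrow> ((nat \<times> 'a) \<times> (nat \<times> 'a)) set \<Rightarrow> ('a \<times> bool) list \<Rightarrow> nat \<times> 'a \<Rightarrow> nat \<times> 'a \<Rightarrow> bool"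
  where
    "trace G \<rho> [] x z \<longleftrightarrow> x = z"
  | "trace G \<rho> (c # p) x z \<longleftrightarrow> (\<exists>y. trace G \<rho> p x y \<and> step G \<rho> c y z)"

lemma trace_snoc: "trace G \<rho> (p @ [c]) x z \<longleftrightarrow> (\<exists>y. step G \<rho> c x y \<and> trace G \<rho> p y z)"
  by (induction p arbitrary: z) auto

lemma trace_mono: "\<rho> \<subseteq> \<rho>' \<Longrightarrow> trace G \<rho> p x z \<Longrightarrow> trace G \<rho>' p x z"
proof (induction p arbitrary: z)
  case (Cons c p)
  then show ?case by (auto simp: step_def Let_def split: if_splits) blast+
qed simp

text \<open>\<open>H\<close>, \<open>A\<close> and \<open>B\<close> stand for the stabilizers of an
  arc, its tail and its head. \<open>spread\<close> is high core-freeness in the form in which it is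
  applied: both the coset \<open>H \<gamma>\<close> and the nontrivial elements of a conjugate of
  \<open>H\<close> avoid a given finite set.\<close>

locale twisting_data = free_orbits +
  fixes H A B :: "'a set"
  assumes H: "subgroup H G" and AB: "A \<subseteq> carrier G" "B \<subseteq> carrier G"
    and spread: "\<lbrakk>X \<in> {A, B}; finite K\<rbrakk> \<Longrightarrow>
      \<exists>\<gamma>\<in>X. \<forall>s\<in>H. s \<otimes> \<gamma> \<notin> K \<and> (s \<noteq> \<one> \<longrightarrow> inv \<gamma> \<otimes> s \<otimes> \<gamma> \<notin> K)"
begin

lemma Hc [simp]: "s \<in> H \<Longrightarrow> s \<in> carrier G"
  using subgroup.subset[OF H] by blast

lemma H_closed [simp]: "\<one> \<in> H" "s \<in> H \<Longrightarrow> inv s \<in> H" "s \<in> H \<Longrightarrow> t \<in> H \<Longrightarrow> s \<otimes> t \<in> H"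
  using H by (auto simp: subgroup_def)

definition sat :: "((nat \<times> 'a) \<times> (nat \<times> 'a)) set \<Rightarrow> ((nat \<times> 'a) \<times> (nat \<times> 'a)) set" where
  "sat w = {(act s a, act s b) |s a b. s \<in> H \<and> (a, b) \<in> w}"

text \<open>
  The finite set \<open>w\<close> contains representatives of the \<open>H\<close>-orbits of the graph \<open>sat w\<close>. Compatibility of all pairs
  makes \<open>sat w\<close> isometric, hence the graph of an injective function.
\<close>

definition compatible :: "(nat \<times> 'a \<Rightarrow> nat \<times> 'a \<Rightarrow> real) \<Rightarrow>
    (nat \<times> 'a) \<times> (nat \<times> 'a) \<Rightarrow> (nat \<times> 'a) \<times> (nat \<times> 'a) \<Rightarrow> bool" where
  "compatible d p p' \<longleftrightarrow> (\<forall>s\<in>H. d (fst p) (act s (fst p')) = d (snd p) (act s (snd p')))"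

definition cond :: "nat \<Rightarrow> (nat \<times> 'a \<Rightarrow> nat \<times> 'a \<Rightarrow> real) \<Rightarrow> ((nat \<times> 'a) \<times> (nat \<times> 'a)) set \<Rightarrow> bool" where
  "cond n d w \<longleftrightarrow> orbit_metric G S M n d \<and> finite w \<and> w \<subseteq> pts n \<times> pts n \<and>
     (\<forall>p\<in>w. \<forall>p'\<in>w. compatible d p p')"

definition agree :: "nat \<Rightarrow> (nat \<times> 'a \<Rightarrow> nat \<times> 'a \<Rightarrow> real) \<Rightarrow> (nat \<times> 'a \<Rightarrow> nat \<times> 'a \<Rightarrow> real) \<Rightarrow> bool" where
  "agree n d d' \<longleftrightarrow> (\<forall>x\<in>pts n. \<forall>y\<in>pts n. d' x y = d x y)"

section \<open>The saturated graph as a partial isometry\<close>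

lemma sat_mono: "w \<subseteq> w' \<Longrightarrow> sat w \<subseteq> sat w'"
  unfolding sat_def by blast

lemma sat_I: "s \<in> H \<Longrightarrow> (a, b) \<in> w \<Longrightarrow> (act s a, act s b) \<in> sat w"
  unfolding sat_def by blast

lemma sat_converse: "sat (w\<inverse>) = (sat w)\<inverse>"
  unfolding sat_def by blast

lemma sat_insert: "sat (insert (a, b) w) = sat w \<union> {(act s a, act s b) |s. s \<in> H}"
  unfolding sat_def by blast

lemma cond_D:
  assumes "cond n d w"
  shows "orbit_metric G S M n d" "finite w" "w \<subseteq> pts n \<times> pts n"
    "\<And>p p'. p \<in> w \<Longrightarrow> p' \<in> w \<Longrightarrow> compatible d p p'"
  using assms by (auto simp: cond_def)

lemma cond_converse: "cond n d w \<Longrightarrow> cond n d (w\<inverse>)"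
  by (fastforce simp: cond_def compatible_def)

lemma sat_pts: "w \<subseteq> pts n \<times> pts n \<Longrightarrow> sat w \<subseteq> pts n \<times> pts n"
  by (auto 4 3 simp: sat_def subset_iff)

lemma sat_subset: "w \<subseteq> pts n \<times> pts n \<Longrightarrow> w \<subseteq> sat w"
proof
  fix p assume w: "w \<subseteq> pts n \<times> pts n" and p: "p \<in> w"
  then have "(act \<one> (fst p), act \<one> (snd p)) \<in> sat w" by (intro sat_I) auto
  moreover have "act \<one> (fst p) = fst p" "act \<one> (snd p) = snd p"
    using w p by (auto intro!: act_one)
  ultimately show "p \<in> sat w" by simp
qed

lemma sat_act:
  assumes "w \<subseteq> pts n \<times> pts n" "(x, y) \<in> sat w" "s \<in> H"
  shows "(act s x, act s y) \<in> sat w"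
proof -
  obtain t a b where t: "t \<in> H" "(a, b) \<in> w" "x = act t a" "y = act t b"
    using assms(2) by (auto simp: sat_def)
  then have "a \<in> pts n" "b \<in> pts n" using assms(1) by auto
  then show ?thesis
    using t sat_I[of "s \<otimes> t" a b w] assms(3) by (simp add: act_act)
qed

text \<open>Translation by the inverse of one of the two elements of \<open>H\<close> turns the
  claim into \<open>compatible\<close> for two representatives.\<close>

lemma sat_isometric:
  assumes c: "cond n d w" and xy: "(x, y) \<in> sat w" "(x', y') \<in> sat w"
  shows "d x x' = d y y'"
proof -
  interpret orbit_metric G S M n d by (rule cond_D[OF c])
  obtain s a b where s: "s \<in> H" "(a, b) \<in> w" "x = act s a" "y = act s b"
    using xy(1) by (auto simp: sat_def)
  obtain t a' b' where t: "t \<in> H" "(a', b') \<in> w" "x' = act t a'" "y' = act t b'"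
    using xy(2) by (auto simp: sat_def)
  have p: "a \<in> pts n" "b \<in> pts n" "a' \<in> pts n" "b' \<in> pts n"
    using cond_D(3)[OF c] s t by auto
  have "d (act s u) (act t v) = d u (act (inv s \<otimes> t) v)" if "u \<in> pts n" "v \<in> pts n" for u v
    using d_act_inv[of "inv s" u "act t v"] that s t by (simp add: act_act)
  moreover have "d a (act (inv s \<otimes> t) a') = d b (act (inv s \<otimes> t) b')"
    using cond_D(4)[OF c s(2) t(2)] s t by (simp add: compatible_def)
  ultimately show ?thesis using s t p by simp
qed

text \<open>The two images of a point are at distance zero.\<close>

lemma sat_fun:
  assumes "cond n d w" "(x, y) \<in> sat w" "(x, y') \<in> sat w"
  shows "y = y'"
proof -
  interpret orbit_metric G S M n d by (rule cond_D[OF assms(1)])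
  have "x \<in> pts n" "y \<in> pts n" "y' \<in> pts n"
    using sat_pts[OF cond_D(3)[OF assms(1)]] assms by auto
  then show ?thesis
    using sat_isometric[OF assms] d_zero[of x x] d_zero[of y y'] by simp
qed

lemma compatible_sym:
  assumes "orbit_metric G S M n d" "p \<in> pts n \<times> pts n" "p' \<in> pts n \<times> pts n" "compatible d p p'"
  shows "compatible d p' p"
  unfolding compatible_def
proof
  interpret orbit_metric G S M n d by fact
  fix s assume s: "s \<in> H"
  have sw: "d u (act s v) = d v (act (inv s) u)" if "u \<in> pts n" "v \<in> pts n" for u v
    using d_act_inv[of s u v] d_commute[of "act (inv s) u" v] that s by simp
  show "d (fst p') (act s (fst p)) = d (snd p') (act s (snd p))"
    using sw assms(2-4) s by (simp add: mem_Times_iff compatible_def)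
qed

section \<open>Extending approximations by one orbit\<close>

lemma cond_extend_metric:
  assumes "cond n d w" "orbit_metric G S M m d'" "agree n d d'" "n \<le> m"
  shows "cond m d' w"
proof -
  have "w \<subseteq> pts m \<times> pts m"
    using cond_D(3)[OF assms(1)] pts_mono[OF assms(4)] by fastforce
  moreover have "compatible d' p p'" if "p \<in> w" "p' \<in> w" for p p'
  proof -
    have "p \<in> pts n \<times> pts n" "p' \<in> pts n \<times> pts n" using cond_D(3)[OF assms(1)] that by auto
    then show ?thesis
      using cond_D(4)[OF assms(1) that] assms(3)
      by (auto simp: compatible_def agree_def mem_Times_iff)
  qed
  ultimately show ?thesis using assms cond_D[OF assms(1)] by (simp add: cond_def)
qed

text \<open>With the trivial subgroup as \<open>K\<close>, only the distances to \<open>F\<close>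
  are prescribed; all others are as large as these allow. The points of the new orbit stay outside
  the graph of \<open>w\<close>.\<close>

lemma add_katetov:
  assumes c: "cond n d w" and F: "finite F" "F \<subseteq> pts n"
    and f: "\<And>a. a \<in> F \<Longrightarrow> f a \<in> S" "\<And>a. a \<in> F \<Longrightarrow> f a > 0"
      "\<And>a b. \<lbrakk>a \<in> F; b \<in> F\<rbrakk> \<Longrightarrow> f a \<le> d a b + f b"
      "\<And>a b. \<lbrakk>a \<in> F; b \<in> F\<rbrakk> \<Longrightarrow> d a b \<le> f a + f b"
  obtains d' where "cond (Suc n) d' w" "agree n d d'" "\<And>a. a \<in> F \<Longrightarrow> d' (n, \<one>) a = f a"
proof -
  interpret orbit_metric G S M n d by (rule cond_D[OF c])
  have one: "act \<one> r = r" if "r \<in> F" for r using that F by (intro act_one[of _ n]) auto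
  have "subgroup {\<one>} G" by (rule triv_subgroup)
  then obtain d' where d': "orbit_metric G S M (Suc n) d'"
    "\<And>x y. \<lbrakk>x \<in> pts n; y \<in> pts n\<rbrakk> \<Longrightarrow> d' x y = d x y"
    "\<And>x. x \<in> F \<Longrightarrow> d' (n, \<one>) x = f x"
    by (rule extend_partial[of "{\<one>}" F f "\<lambda>_. 0"])
      (use F f S_zero one in \<open>auto intro: less_imp_le\<close>)
  show ?thesis
    by (rule that[of d']) (use d' c cond_extend_metric[OF c d'(1)] in \<open>auto simp: agree_def\<close>)
qed

lemma add_orbit:
  assumes "cond n d w"
  obtains d' where "cond (Suc n) d' w" "agree n d d'"
  using add_katetov[OF assms, of "{}"] by auto

text \<open>The image of \<open>x\<close> is the base point of a fresh orbit. Being isometric and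
  commuting with \<open>H\<close> forces its distance to a point \<open>y\<close> of the range,
  namely that from \<open>x\<close> to the preimage of \<open>y\<close>, and its distances to its
  own \<open>H\<close>-translates; the remaining ones are left to
  \<open>extend_partial\<close>.\<close>

lemma add_domain:
  assumes c: "cond n d w" and x: "x \<in> pts n" "x \<notin> Domain (sat w)"
  obtains d' where "cond (Suc n) d' (insert (x, (n, \<one>)) w)" "agree n d d'"
proof -
  interpret orbit_metric G S M n d by (rule cond_D[OF c])
  define R where "R = Range (sat w)"
  define pre where "pre y = (SOME z. (z, y) \<in> sat w)" for y
  have pre: "(pre y, y) \<in> sat w" if "y \<in> R" for y
    using that unfolding R_def pre_def by (metis Range.cases someI_ex)
  have w: "w \<subseteq> pts n \<times> pts n" by (rule cond_D[OF c])
  have pre_pts: "pre y \<in> pts n" and R_pts: "y \<in> pts n" if "y \<in> R" for y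
    using pre[OF that] sat_pts[OF w] by auto
  have pre_eq: "pre y = z" if "(z, y) \<in> sat w" for z y
    using sat_fun[OF cond_converse[OF c], of y z "pre y"] pre[of y] that
    unfolding sat_converse R_def by auto
  have pre_act: "act s y \<in> R" "pre (act s y) = act s (pre y)" if "s \<in> H" "y \<in> R" for s y
    using sat_act[OF w pre[OF that(2)] that(1)] pre_eq by (auto simp: R_def)
  have pre_iso: "d (pre y) (pre z) = d y z" if "y \<in> R" "z \<in> R" for y z
    using sat_isometric[OF c pre pre] that by blast
  define f where "f y = d x (pre y)" for y
  define q where "q s = d x (act s x)" for s
  \<comment> \<open>\<open>R\<close> is a union of finitely many \<open>H\<close>-orbits, and
    \<open>d_finite\<close> for \<open>x\<close> and the first component of a representative leaves
    finitely many translates in each.\<close>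
  have f_finite: "finite {y \<in> R. f y < M}"
  proof (rule finite_surj)
    let ?Z = "\<Union>(a, b)\<in>w. (\<lambda>s. (s, b)) ` {s \<in> carrier G. d x (act s a) < M}"
    show "finite ?Z"
    proof (rule finite_UN_I[OF cond_D(2)[OF c]])
      fix p assume "p \<in> w"
      then have "fst p \<in> pts n" using w by auto
      then show "finite (case p of (a, b) \<Rightarrow> (\<lambda>s. (s, b)) ` {s \<in> carrier G. d x (act s a) < M})"
        using d_finite[OF x(1)] by (simp add: case_prod_beta)
    qed
    show "{y \<in> R. f y < M} \<subseteq> (\<lambda>(s, b). act s b) ` ?Z"
    proof
      fix y assume y: "y \<in> {y \<in> R. f y < M}"
      then obtain s a b where s: "s \<in> H" "(a, b) \<in> w" "pre y = act s a" "y = act s b"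
        using pre[of y] unfolding sat_def by auto
      have "s \<in> {s \<in> carrier G. d x (act s a) < M}" using s y by (simp add: f_def)
      then have "(s, b) \<in> ?Z" using s(2) by blast
      then show "y \<in> (\<lambda>(s, b). act s b) ` ?Z" using s by force
    qed
  qed
  have q_finite: "finite {s \<in> H. q s < M}"
    by (rule finite_subset[OF _ d_finite[OF x(1) x(1)]]) (auto simp: q_def)
  obtain d' where d': "orbit_metric G S M (Suc n) d'"
    "\<And>x y. \<lbrakk>x \<in> pts n; y \<in> pts n\<rbrakk> \<Longrightarrow> d' x y = d x y"
    "\<And>y. y \<in> R \<Longrightarrow> d' (n, \<one>) y = f y"
    "\<And>s. s \<in> H \<Longrightarrow> d' (n, \<one>) (n, s) = q s"
  proof (rule extend_partial[of H R f q])
    show "R \<subseteq> pts n" using R_pts by blast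
    show "0 < f y" if "y \<in> R" for y
    proof -
      have "x \<noteq> pre y" using pre[OF that] x(2) by auto
      then show ?thesis
        using d_zero[OF x(1) pre_pts[OF that]] d_nonneg[OF x(1) pre_pts[OF that]] by (simp add: f_def)
    qed
    show "f y \<le> d y z + f z" if "y \<in> R" "z \<in> R" for y z
      using d_triangle[OF x(1) pre_pts[OF that(2)] pre_pts[OF that(1)]] pre_iso[OF that]
        d_commute[OF pre_pts pre_pts, OF that] by (simp add: f_def)
    show "d y z \<le> f y + f z" if "y \<in> R" "z \<in> R" for y z
      using d_triangle[OF pre_pts[OF that(1)] x(1) pre_pts[OF that(2)]] pre_iso[OF that]
        d_commute[OF x(1) pre_pts[OF that(1)]] by (simp add: f_def)
    show "q s = 0 \<longleftrightarrow> s = \<one>" if "s \<in> H" for s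
      using d_zero[of x "act s x"] x act_inj[of s \<one> x n] that by (auto simp: q_def)
    show "q (inv s) = q s" if "s \<in> H" for s
      using d_act_inv[of s x x] d_commute[of x "act (inv s) x"] x that by (simp add: q_def)
    show "q (s \<otimes> t) \<le> q s + q t" if "s \<in> H" "t \<in> H" for s t
      using d_triangle[of x "act s x" "act s (act t x)"] d_act[of s x "act t x"] x that
      by (simp add: q_def act_act)
    show "f (act s y) \<le> q s + f y" if "s \<in> H" "y \<in> R" for s y
      using d_triangle[of x "act s x" "act s (pre y)"] d_act[of s x "pre y"] x that pre_pts[of y]
      by (simp add: q_def f_def pre_act)
    show "q s \<le> f y + f (act s y)" if "s \<in> H" "y \<in> R" for s y
      using d_triangle[of x "act s (pre y)" "act s x"] d_act[of s x "pre y"] x that pre_pts[of y]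
        d_commute[of "act s x" "act s (pre y)"]
      by (simp add: q_def f_def pre_act)
  qed (use H f_finite q_finite d_S x pre_pts pre_act in \<open>auto simp: f_def q_def\<close>)
  have ag: "agree n d d'" using d'(2) by (simp add: agree_def)
  have y: "(n, \<one>) \<in> pts (Suc n)" by (simp add: pts_def)
  have x': "x \<in> pts (Suc n)" using pts_mono[OF _ x(1)] by simp
  have w': "w \<subseteq> pts (Suc n) \<times> pts (Suc n)"
    using w pts_mono[of n "Suc n"] by fastforce
  have c': "cond (Suc n) d' w" by (rule cond_extend_metric[OF c d'(1) ag]) simp
  have 1: "compatible d' (x, (n, \<one>)) p" if "p \<in> w" for p
  proof -
    have p: "fst p \<in> pts n" "snd p \<in> pts n" using that w by auto
    have "d' x (act s (fst p)) = d' (n, \<one>) (act s (snd p))" if s: "s \<in> H" for s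
    proof -
      have *: "(act s (fst p), act s (snd p)) \<in> sat w"
        by (intro sat_I) (use s \<open>p \<in> w\<close> in auto)
      then have "act s (snd p) \<in> R" by (auto simp: R_def)
      then show ?thesis
        using d'(2)[of x "act s (fst p)"] d'(3)[of "act s (snd p)"] pre_eq[OF *] p s x by (simp add: f_def)
    qed
    then show ?thesis by (simp add: compatible_def)
  qed
  have 2: "compatible d' (x, (n, \<one>)) (x, (n, \<one>))"
    using d'(2)[of x] d'(4) x by (simp add: compatible_def q_def)
  have 3: "compatible d' p (x, (n, \<one>))" if "p \<in> w" for p
    by (rule compatible_sym[OF d'(1) _ _ 1[OF that]]) (use x' y w' that in auto)
  have "cond (Suc n) d' (insert (x, (n, \<one>)) w)"
    using 1 2 3 cond_D[OF c'] x' y by (simp add: cond_def)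
  then show ?thesis using ag that by blast
qed

lemma add_range:
  assumes c: "cond n d w" and x: "x \<in> pts n" "x \<notin> Range (sat w)"
  obtains d' where "cond (Suc n) d' (insert ((n, \<one>), x) w)" "agree n d d'"
proof -
  have "x \<notin> Domain (sat (w\<inverse>))" using x by (simp add: sat_converse)
  then obtain d' where d': "cond (Suc n) d' (insert (x, (n, \<one>)) (w\<inverse>))" "agree n d d'"
    using add_domain[OF cond_converse[OF c] x(1)] by blast
  have "(insert (x, (n, \<one>)) (w\<inverse>))\<inverse> = insert ((n, \<one>), x) w" by auto
  then show ?thesis using cond_converse[OF d'(1)] d'(2) that by simp
qed

text \<open>\<open>K\<close> consists of the group elements that bring some point of
  \<open>F\<close> to distance less than \<open>M\<close> from a point of \<open>F\<close>. Keeping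
  \<open>s \<gamma>\<close> out of \<open>K\<close> separates \<open>F\<close> from all
  \<open>H\<close>-translates of its image under \<gamma>; keeping the conjugates out separates
  these translates from each other.\<close>

lemma spread_points:
  assumes "orbit_metric G S M n d" and F: "finite F" "F \<subseteq> pts n" and X: "X \<in> {A, B}"
  obtains \<gamma> where "\<gamma> \<in> X"
    "\<And>f f' s. \<lbrakk>f \<in> F; f' \<in> F; s \<in> H\<rbrakk> \<Longrightarrow> d f' (act s (act \<gamma> f)) = M"
    "\<And>f f' s. \<lbrakk>f \<in> F; f' \<in> F; s \<in> H; s \<noteq> \<one>\<rbrakk> \<Longrightarrow> d (act \<gamma> f') (act s (act \<gamma> f)) = M"
proof -
  interpret orbit_metric G S M n d by fact
  define K where "K = (\<Union>f\<in>F. \<Union>f'\<in>F. {g \<in> carrier G. d f' (act g f) < M})"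
  have "finite K" unfolding K_def using F by (intro finite_UN_I d_finite) auto
  then obtain \<gamma> where \<gamma>: "\<gamma> \<in> X" "\<forall>s\<in>H. s \<otimes> \<gamma> \<notin> K \<and> (s \<noteq> \<one> \<longrightarrow> inv \<gamma> \<otimes> s \<otimes> \<gamma> \<notin> K)"
    using spread[OF X] by blast
  have \<gamma>c: "\<gamma> \<in> carrier G" using \<gamma>(1) AB X by auto
  have far: "d f' (act g f) = M" if "f \<in> F" "f' \<in> F" "g \<in> carrier G" "g \<notin> K" for f f' g
  proof -
    have "\<not> d f' (act g f) < M" using that by (auto simp: K_def)
    moreover have "d f' (act g f) \<le> M" using that F by (intro d_le_M) auto
    ultimately show ?thesis by simp
  qed
  show ?thesis
  proof (rule that[OF \<gamma>(1)])
    fix f f' s assume f: "f \<in> F" "f' \<in> F" and s: "s \<in> H"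
    have p: "f \<in> pts n" "f' \<in> pts n" using f F by auto
    show "d f' (act s (act \<gamma> f)) = M"
      using far[OF f, of "s \<otimes> \<gamma>"] \<gamma>(2) s \<gamma>c p by (simp add: act_act)
    show "d (act \<gamma> f') (act s (act \<gamma> f)) = M" if "s \<noteq> \<one>"
    proof -
      have "d (act \<gamma> f') (act s (act \<gamma> f)) = d f' (act (inv \<gamma>) (act s (act \<gamma> f)))"
        using d_act_inv[of "inv \<gamma>" f' "act s (act \<gamma> f)"] s \<gamma>c p by simp
      also have "\<dots> = M"
        using far[OF f, of "inv \<gamma> \<otimes> s \<otimes> \<gamma>"] \<gamma>(2) s \<gamma>c p that by (simp add: act_act m_assoc)
      finally show ?thesis .
    qed
  qed
qed

text \<open>Two families of pairs are added to \<open>w\<close>, one for each equation that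
  \<open>w\<close> has to satisfy. After spreading, distances between different families, or between
  different \<open>H\<close>-translates within a new family, equal \<open>M\<close> on both sides,
  so they are compatible. What remains is \<open>s = \<one>\<close> inside one family: there the
  first family is compatible by invariance of \<open>d\<close>, the second because \<open>L\<close>
  is a partial isometry.\<close>

lemma add_homogeneity:
  assumes c: "cond n d w" and L: "finite L" "L \<subseteq> pts n \<times> pts n"
    and iso: "\<And>p p'. \<lbrakk>p \<in> L; p' \<in> L\<rbrakk> \<Longrightarrow> d (fst p) (fst p') = d (snd p) (snd p')"
  obtains w' g\<^sub>1 g\<^sub>2 h\<^sub>1 h\<^sub>2 where "cond n d w'" "w \<subseteq> w'" "g\<^sub>1 \<in> A" "g\<^sub>2 \<in> A" "h\<^sub>1 \<in> B" "h\<^sub>2 \<in> B"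
    "\<And>a b. (a, b) \<in> L \<Longrightarrow> (act h\<^sub>1 a, act g\<^sub>1 a) \<in> w' \<and> (act h\<^sub>2 a, act g\<^sub>2 b) \<in> w'"
proof -
  interpret orbit_metric G S M n d by (rule cond_D[OF c])
  note w = cond_D(2,3)[OF c]
  define F1 where "F1 = fst ` L \<union> fst ` w"
  have F1: "finite F1" "F1 \<subseteq> pts n" using L w by (auto simp: F1_def)
  obtain h\<^sub>1 where h1: "h\<^sub>1 \<in> B"
    "\<And>f f' s. \<lbrakk>f \<in> F1; f' \<in> F1; s \<in> H\<rbrakk> \<Longrightarrow> d f' (act s (act h\<^sub>1 f)) = M"
    "\<And>f f' s. \<lbrakk>f \<in> F1; f' \<in> F1; s \<in> H; s \<noteq> \<one>\<rbrakk> \<Longrightarrow> d (act h\<^sub>1 f') (act s (act h\<^sub>1 f)) = M"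
    using spread_points[OF cond_D(1)[OF c] F1, of B] by blast
  \<comment> \<open>The second family has to be far from the first one as well, so its translate is
    chosen after \<open>h\<^sub>1\<close>.\<close>
  define F2 where "F2 = F1 \<union> act h\<^sub>1 ` fst ` L"
  have h1c: "h\<^sub>1 \<in> carrier G" using h1 AB by auto
  have F2: "finite F2" "F2 \<subseteq> pts n" using L F1 h1c by (auto 4 3 simp: F2_def subset_iff)
  obtain h\<^sub>2 where h2: "h\<^sub>2 \<in> B"
    "\<And>f f' s. \<lbrakk>f \<in> F2; f' \<in> F2; s \<in> H\<rbrakk> \<Longrightarrow> d f' (act s (act h\<^sub>2 f)) = M"
    "\<And>f f' s. \<lbrakk>f \<in> F2; f' \<in> F2; s \<in> H; s \<noteq> \<one>\<rbrakk> \<Longrightarrow> d (act h\<^sub>2 f') (act s (act h\<^sub>2 f)) = M"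
    using spread_points[OF cond_D(1)[OF c] F2, of B] by blast
  \<comment> \<open>On the range side the second family starts from the second components of
    \<open>L\<close>, the first family from the first components.\<close>
  define F3 where "F3 = fst ` L \<union> snd ` L \<union> snd ` w"
  have F3: "finite F3" "F3 \<subseteq> pts n" using L w by (auto simp: F3_def)
  obtain g\<^sub>1 where g1: "g\<^sub>1 \<in> A"
    "\<And>f f' s. \<lbrakk>f \<in> F3; f' \<in> F3; s \<in> H\<rbrakk> \<Longrightarrow> d f' (act s (act g\<^sub>1 f)) = M"
    "\<And>f f' s. \<lbrakk>f \<in> F3; f' \<in> F3; s \<in> H; s \<noteq> \<one>\<rbrakk> \<Longrightarrow> d (act g\<^sub>1 f') (act s (act g\<^sub>1 f)) = M"
    using spread_points[OF cond_D(1)[OF c] F3, of A] by blast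
  define F4 where "F4 = F3 \<union> act g\<^sub>1 ` fst ` L"
  have g1c: "g\<^sub>1 \<in> carrier G" using g1 AB by auto
  have F4: "finite F4" "F4 \<subseteq> pts n" using L F3 g1c by (auto 4 3 simp: F4_def subset_iff)
  obtain g\<^sub>2 where g2: "g\<^sub>2 \<in> A"
    "\<And>f f' s. \<lbrakk>f \<in> F4; f' \<in> F4; s \<in> H\<rbrakk> \<Longrightarrow> d f' (act s (act g\<^sub>2 f)) = M"
    "\<And>f f' s. \<lbrakk>f \<in> F4; f' \<in> F4; s \<in> H; s \<noteq> \<one>\<rbrakk> \<Longrightarrow> d (act g\<^sub>2 f') (act s (act g\<^sub>2 f)) = M"
    using spread_points[OF cond_D(1)[OF c] F4, of A] by blast
  have cc: "h\<^sub>2 \<in> carrier G" "g\<^sub>2 \<in> carrier G" using h2 g2 AB by auto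
  define w1 where "w1 = (\<lambda>p. (act h\<^sub>1 (fst p), act g\<^sub>1 (fst p))) ` L"
  define w2 where "w2 = (\<lambda>p. (act h\<^sub>2 (fst p), act g\<^sub>2 (snd p))) ` L"
  have Lp: "fst p \<in> pts n" "snd p \<in> pts n" if "p \<in> L" for p using that L by auto
  have sub: "w1 \<subseteq> pts n \<times> pts n" "w2 \<subseteq> pts n \<times> pts n"
    using Lp cc h1c g1c by (auto simp: w1_def w2_def)
  have 01: "compatible d p p'" if "p \<in> w" "p' \<in> w1" for p p'
  proof -
    obtain l where l: "l \<in> L" "p' = (act h\<^sub>1 (fst l), act g\<^sub>1 (fst l))"
      using \<open>p' \<in> w1\<close> by (auto simp: w1_def)
    have "fst l \<in> F1" "fst p \<in> F1" "fst l \<in> F3" "snd p \<in> F3"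
      using l that by (auto simp: F1_def F3_def)
    then show ?thesis using h1(2) g1(2) l by (simp add: compatible_def)
  qed
  have 02: "compatible d p p'" if "p \<in> w \<union> w1" "p' \<in> w2" for p p'
  proof -
    obtain l where l: "l \<in> L" "p' = (act h\<^sub>2 (fst l), act g\<^sub>2 (snd l))"
      using \<open>p' \<in> w2\<close> by (auto simp: w2_def)
    have "fst l \<in> F2" "snd l \<in> F4"
      using l by (auto simp: F1_def F2_def F3_def F4_def)
    moreover have "fst p \<in> F2 \<and> snd p \<in> F4"
    proof (cases "p \<in> w")
      case False
      then obtain l where "l \<in> L" "p = (act h\<^sub>1 (fst l), act g\<^sub>1 (fst l))"
        using \<open>p \<in> w \<union> w1\<close> by (auto simp: w1_def)
      then show ?thesis by (simp add: F2_def F4_def)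
    qed (simp add: F1_def F2_def F3_def F4_def)
    ultimately show ?thesis using h2(2) g2(2) l by (simp add: compatible_def)
  qed
  have 11: "compatible d p p'" if "p \<in> w1" "p' \<in> w1" for p p'
    unfolding compatible_def
  proof
    fix s assume s: "s \<in> H"
    obtain l l' where l: "l \<in> L" "l' \<in> L" "p = (act h\<^sub>1 (fst l), act g\<^sub>1 (fst l))"
        "p' = (act h\<^sub>1 (fst l'), act g\<^sub>1 (fst l'))"
      using \<open>p \<in> w1\<close> \<open>p' \<in> w1\<close> by (auto simp: w1_def)
    show "d (fst p) (act s (fst p')) = d (snd p) (act s (snd p'))"
    proof (cases "s = \<one>")
      case True
      have "act s (fst p') = fst p'" "act s (snd p') = snd p'"
        using l sub \<open>p' \<in> w1\<close> True by (auto intro!: act_one)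
      then show ?thesis using l Lp h1c g1c by (simp add: d_act)
    next
      case False
      then show ?thesis using h1(3) g1(3) s l by (auto simp: F1_def F3_def)
    qed
  qed
  have 22: "compatible d p p'" if "p \<in> w2" "p' \<in> w2" for p p'
    unfolding compatible_def
  proof
    fix s assume s: "s \<in> H"
    obtain l l' where l: "l \<in> L" "l' \<in> L" "p = (act h\<^sub>2 (fst l), act g\<^sub>2 (snd l))"
        "p' = (act h\<^sub>2 (fst l'), act g\<^sub>2 (snd l'))"
      using \<open>p \<in> w2\<close> \<open>p' \<in> w2\<close> by (auto simp: w2_def)
    show "d (fst p) (act s (fst p')) = d (snd p) (act s (snd p'))"
    proof (cases "s = \<one>")
      case True
      have "act s (fst p') = fst p'" "act s (snd p') = snd p'"
        using l sub \<open>p' \<in> w2\<close> True by (auto intro!: act_one)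
      then show ?thesis using l Lp cc iso by (simp add: d_act)
    next
      case False
      then show ?thesis using h2(3) g2(3) s l by (auto simp: F1_def F2_def F3_def F4_def)
    qed
  qed
  have sym: "compatible d p' p" if "compatible d p p'" "p \<in> w \<union> w1 \<union> w2" "p' \<in> w \<union> w1 \<union> w2" for p p'
    using compatible_sym[OF cond_D(1)[OF c] _ _ that(1)] that(2,3) w sub by blast
  have "compatible d p p'" if "p \<in> w \<union> w1 \<union> w2" "p' \<in> w \<union> w1 \<union> w2" for p p'
    using that cond_D(4)[OF c] 01 02 11 22 sym by (metis Un_iff)
  then have "cond n d (w \<union> w1 \<union> w2)"
    using cond_D(1-3)[OF c] sub L by (auto simp: cond_def w1_def w2_def)
  then show ?thesis
    by (rule that[OF _ _ g1(1) g2(1) h1(1) h2(1)]) (force simp: w1_def w2_def)+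
qed

text \<open>
  Each letter sends the point to a new orbit. The next letter can again be chosen freely there: by the
  assumption on \<open>p\<close> it never undoes the previous one.
\<close>

lemma escape:
  assumes "cond n d w" "x \<in> pts n" "fst ` set p \<subseteq> carrier G"
    "\<And>h h'. \<lbrakk>(h, True) \<in> set p; (h', False) \<in> set p\<rbrakk> \<Longrightarrow> inv h \<otimes> h' \<notin> H"
    "\<And>h. (h, True) \<in> set p \<Longrightarrow> act (inv h) x \<notin> Domain (sat w)"
    "\<And>h. (h, False) \<in> set p \<Longrightarrow> act (inv h) x \<notin> Range (sat w)"
  shows "\<exists>n' d' w' z. cond n' d' w' \<and> n \<le> n' \<and> agree n d d' \<and> w \<subseteq> w' \<and> z \<in> pts n' \<and>
      trace G (sat w') p x z \<and> (if p = [] then z = x else n \<le> fst z)"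
  using assms
\<comment> \<open>The last letter acts first, so the word is consumed from its end.\<close>
proof (induction p arbitrary: n d w x rule: rev_induct)
  case Nil
  then have "cond n d w \<and> n \<le> n \<and> agree n d d \<and> w \<subseteq> w \<and> x \<in> pts n \<and> trace G (sat w) [] x x"
    by (simp add: agree_def)
  then show ?case by (metis (full_types))
next
  case (snoc c p)
  obtain h b where cb: "c = (h, b)" by (cases c)
  have h: "h \<in> carrier G" using snoc.prems(3) cb by auto
  define x0 where "x0 = act (inv h) x"
  have x0: "x0 \<in> pts n" using snoc.prems(2) h by (simp add: x0_def)
  \<comment> \<open>The new pair makes \<open>w\<close>, or its inverse for a negative letter, send
    \<open>x0\<close> to the new base point; the letter itself then sends \<open>x\<close> to
    \<open>(n, h)\<close>.\<close>
  define e where "e = (if b then (x0, (n, \<one>)) else ((n, \<one>), x0))"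
  have "\<exists>d'. cond (Suc n) d' (insert e w) \<and> agree n d d'"
  proof (cases b)
    case True
    then have "x0 \<notin> Domain (sat w)" using snoc.prems(5)[of h] cb by (simp add: x0_def)
    then show ?thesis using add_domain[OF snoc.prems(1) x0] True by (metis e_def)
  next
    case False
    then have "x0 \<notin> Range (sat w)" using snoc.prems(6)[of h] cb by (simp add: x0_def)
    then show ?thesis using add_range[OF snoc.prems(1) x0] False by (metis e_def)
  qed
  then obtain d' where d': "cond (Suc n) d' (insert e w)" "agree n d d'" by blast
  have w: "w \<subseteq> pts n \<times> pts n" by (rule cond_D[OF snoc.prems(1)])
  have y: "(n, h) \<in> pts (Suc n)" using h by (simp add: pts_def)
  have old: "fst u < n" if "(u, v) \<in> sat w \<or> (v, u) \<in> sat w" for u v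
    using that sat_pts[OF w] by (auto simp: pts_def)
  have new: "fst (act s x0) < n" for s using x0 by (simp add: act_def pts_iff)
  \<comment> \<open>In orbit \<open>n\<close> the graph only involves \<open>H\<close>-translates of
    \<open>(n, \<one>)\<close>. A remaining letter \<open>h'\<close> that meets them lies in the
    coset \<open>h H\<close>, which the hypothesis on the word excludes for opposite signs; for
    equal signs the relevant end of the new pair lies in an old orbit.\<close>
  have inH: "inv h \<otimes> h' \<in> H" "inv h' \<otimes> h \<in> H"
    if s: "s \<in> H" "(n, inv h' \<otimes> h) = act s (n, \<one>)" and h': "h' \<in> carrier G" for s h'
  proof -
    have s': "inv h' \<otimes> h = s" using s by simp
    then have "inv h \<otimes> h' = inv s" using h h' by (auto simp: inv_mult_group)
    then show "inv h \<otimes> h' \<in> H" "inv h' \<otimes> h \<in> H" using s s' by auto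
  qed
  have pc: "h' \<in> carrier G" if "(h', b') \<in> set p" for h' b'
    using snoc.prems(3) that by force
  have "\<exists>n' d'' w' z. cond n' d'' w' \<and> Suc n \<le> n' \<and> agree (Suc n) d' d'' \<and> insert e w \<subseteq> w' \<and> z \<in> pts n' \<and>
      trace G (sat w') p (n, h) z \<and> (if p = [] then z = (n, h) else Suc n \<le> fst z)"
  proof (rule snoc.IH[OF d'(1) y])
    show "fst ` set p \<subseteq> carrier G" using snoc.prems(3) by auto
    show "inv k \<otimes> k' \<notin> H" if "(k, True) \<in> set p" "(k', False) \<in> set p" for k k'
      using snoc.prems(4) that by simp
    show "act (inv k) (n, h) \<notin> Domain (sat (insert e w))" if k: "(k, True) \<in> set p" for k
    proof
      assume "act (inv k) (n, h) \<in> Domain (sat (insert e w))"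
      then obtain v where v: "((n, inv k \<otimes> h), v) \<in> sat (insert e w)" by auto
      show False
      proof (cases b)
        case True
        then obtain s where "act s x0 = (n, inv k \<otimes> h)"
          using v old[of "(n, inv k \<otimes> h)" v] by (auto simp: e_def sat_insert)
        then show False using new[of s] by simp
      next
        case False
        then obtain s where "s \<in> H" "(n, inv k \<otimes> h) = act s (n, \<one>)"
          using v old[of "(n, inv k \<otimes> h)" v] by (auto simp: e_def sat_insert)
        then have "inv k \<otimes> h \<in> H" using inH pc[OF k] by blast
        then show False using snoc.prems(4)[of k h] k cb False by simp
      qed
    qed
    show "act (inv k) (n, h) \<notin> Range (sat (insert e w))" if k: "(k, False) \<in> set p" for k
    proof
      assume "act (inv k) (n, h) \<in> Range (sat (insert e w))"
      then obtain v where v: "(v, (n, inv k \<otimes> h)) \<in> sat (insert e w)" by auto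
      show False
      proof (cases b)
        case False
        then obtain s where "act s x0 = (n, inv k \<otimes> h)"
          using v old[of "(n, inv k \<otimes> h)" v] by (auto simp: e_def sat_insert)
        then show False using new[of s] by simp
      next
        case True
        then obtain s where "s \<in> H" "(n, inv k \<otimes> h) = act s (n, \<one>)"
          using v old[of "(n, inv k \<otimes> h)" v] by (auto simp: e_def sat_insert)
        then have "inv h \<otimes> k \<in> H" using inH pc[OF k] by blast
        then show False using snoc.prems(4)[of h k] k cb True by simp
      qed
    qed
  qed
  then obtain n' d'' w' z where z: "cond n' d'' w'" "Suc n \<le> n'" "agree (Suc n) d' d''"
      "insert e w \<subseteq> w'" "z \<in> pts n'" "trace G (sat w') p (n, h) z"
      "if p = [] then z = (n, h) else Suc n \<le> fst z" by blast
  have "e \<in> sat w'"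
    using sat_subset[OF cond_D(3)[OF z(1)]] z(4) by blast
  then have "step G (sat w') c x (n, h)"
    using h cb snoc.prems(2) by (auto simp: step_def e_def x0_def act_def pts_iff split: if_splits)
  then have "trace G (sat w') (p @ [c]) x z"
    using z(6) by (auto simp: trace_snoc)
  moreover have "agree n d d''"
    using d'(2) z(3) pts_mono[of n "Suc n"] by (simp add: agree_def)
  moreover have "n \<le> fst z" using z(7) by (auto split: if_splits)
  ultimately show ?case
    using z by (intro exI[of _ n'] exI[of _ d''] exI[of _ w'] exI[of _ z]) auto
qed

text \<open>The point is the base point of an orbit that the graph has not touched, so no letter is
  defined yet on its translates. The empty word moves it because the action is free; any other word
  leads to a still newer orbit.\<close>

lemma add_moved_point:
  assumes c: "cond n d w" and g: "g \<in> carrier G" "g \<noteq> \<one>" and p: "fst ` set p \<subseteq> carrier G"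
    "\<And>h h'. \<lbrakk>(h, True) \<in> set p; (h', False) \<in> set p\<rbrakk> \<Longrightarrow> inv h \<otimes> h' \<notin> H"
  shows "\<exists>n' d' w' x z. cond n' d' w' \<and> n \<le> n' \<and> agree n d d' \<and> w \<subseteq> w' \<and> x \<in> pts n' \<and> z \<in> pts n' \<and>
      trace G (sat w') p (act g x) z \<and> z \<noteq> x"
proof -
  obtain d' where d': "cond (Suc n) d' w" "agree n d d'" using add_orbit[OF c] .
  have x: "(n, \<one>) \<in> pts (Suc n)" "(n, g) \<in> pts (Suc n)" using g by (auto simp: pts_def)
  have old: "sat w \<subseteq> pts n \<times> pts n" by (rule sat_pts[OF cond_D(3)[OF c]])
  have "\<exists>n' d'' w' z. cond n' d'' w' \<and> Suc n \<le> n' \<and> agree (Suc n) d' d'' \<and> w \<subseteq> w' \<and> z \<in> pts n' \<and>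
      trace G (sat w') p (n, g) z \<and> (if p = [] then z = (n, g) else Suc n \<le> fst z)"
    by (rule escape[OF d'(1) x(2) p]) (use old in \<open>auto simp: pts_def\<close>)
  then obtain n' d'' w' z where z: "cond n' d'' w'" "Suc n \<le> n'" "agree (Suc n) d' d''" "w \<subseteq> w'"
      "z \<in> pts n'" "trace G (sat w') p (n, g) z" "if p = [] then z = (n, g) else Suc n \<le> fst z" by blast
  have "agree n d d''"
    using d'(2) z(3) pts_mono[of n "Suc n"] by (simp add: agree_def)
  moreover have "(n, \<one>) \<in> pts n'" using z(2) by (simp add: pts_def)
  moreover have "z \<noteq> (n, \<one>)" using z(7) g by (auto split: if_splits)
  ultimately show ?thesis
    using z g by (intro exI[of _ n'] exI[of _ d''] exI[of _ w'] exI[of _ "(n, \<one>)"] exI[of _ z]) auto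
qed

end

section \<open>The generic limit\<close>

text \<open>The Rasiowa-Sikorski lemma for countably many dense sets: they are met one after
  another. Inserting \<open>UNIV\<close> provides something to enumerate if the family is empty;
  \<open>refl\<close> handles this extra member.\<close>

lemma generic_chain:
  assumes "countable \<D>" "p0 \<in> P"
    and refl: "\<And>p. R p p"
    and dense: "\<And>D p. D \<in> \<D> \<Longrightarrow> p \<in> P \<Longrightarrow> \<exists>q\<in>P. R p q \<and> q \<in> D"
  obtains c :: "nat \<Rightarrow> 'p" where "\<And>k. c k \<in> P" "\<And>k. R (c k) (c (Suc k))"
    "\<And>D. D \<in> \<D> \<Longrightarrow> \<exists>k. c k \<in> D"
proof -
  define D where "D k = from_nat_into (insert UNIV \<D>) k" for k
  have D: "D k = UNIV \<or> D k \<in> \<D>" for k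
    using from_nat_into[of "insert UNIV \<D>" k] by (auto simp: D_def)
  have "\<exists>c. \<forall>k. c k \<in> P \<and> R (c k) (c (Suc k)) \<and> c (Suc k) \<in> D k"
  proof (rule dependent_nat_choice)
    show "\<exists>q. q \<in> P" using assms by blast
    show "\<exists>q. q \<in> P \<and> R p q \<and> q \<in> D k" if "p \<in> P" for p k
      using D[of k] dense[OF _ that] refl that by (metis UNIV_I)
  qed
  then obtain c where c: "\<And>k. c k \<in> P" "\<And>k. R (c k) (c (Suc k))" "\<And>k. c (Suc k) \<in> D k" by metis
  show ?thesis
  proof (rule that[of c, OF c(1,2)])
    fix E assume "E \<in> \<D>"
    then obtain k where "D k = E"
      using from_nat_into_surj[of "insert UNIV \<D>" E] assms(1) unfolding D_def by auto
    then show "\<exists>k. c k \<in> E" using c(3) by metis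
  qed
qed

section \<open>Approximations, their extensions and the requirements on a chain\<close>

context twisting_data
begin

definition points :: "(nat \<times> 'a) set" where "points = UNIV \<times> carrier G"

lemma points_countable: "countable points"
  using G_countable by (simp add: points_def)

lemma pts_points: "x \<in> pts n \<Longrightarrow> x \<in> points"
  by (auto simp: points_def pts_def)

lemma finite_points_pts:
  assumes "finite F" "F \<subseteq> points"
  shows "\<exists>k. \<forall>n\<ge>k. F \<subseteq> pts n"
proof -
  obtain k where "\<forall>i\<in>fst ` F. i < k" using assms(1) finite_nat_set_iff_bounded by blast
  then show ?thesis using assms(2) by (intro exI[of _ k]) (fastforce simp: pts_def points_def)
qed

lemma act_points [simp]: "g \<in> carrier G \<Longrightarrow> x \<in> points \<Longrightarrow> act g x \<in> points"
  by (auto simp: points_def act_def)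

abbreviation ext :: "nat \<times> (nat \<times> 'a \<Rightarrow> nat \<times> 'a \<Rightarrow> real) \<times> ((nat \<times> 'a) \<times> (nat \<times> 'a)) set \<Rightarrow>
    nat \<times> (nat \<times> 'a \<Rightarrow> nat \<times> 'a \<Rightarrow> real) \<times> ((nat \<times> 'a) \<times> (nat \<times> 'a)) set \<Rightarrow> bool" where
  "ext c c' \<equiv> fst c \<le> fst c' \<and> agree (fst c) (fst (snd c)) (fst (snd c')) \<and> snd (snd c) \<subseteq> snd (snd c')"

lemma ext_trans: "ext c c' \<Longrightarrow> ext c' c'' \<Longrightarrow> ext c c''"
  using pts_mono[of "fst c" "fst c'"] by (auto simp: agree_def)

lemma ext_refl: "ext c c"
  by (simp add: agree_def)

definition conds where
  "conds = {c. cond (fst c) (fst (snd c)) (snd (snd c))}"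

lemma reach:
  assumes "p \<in> conds"
  shows "\<exists>q\<in>conds. ext p q \<and> fst q \<ge> k \<and> snd (snd q) = snd (snd p)"
proof (induction k)
  case 0
  then show ?case using assms ext_refl by fastforce
next
  case (Suc k)
  then obtain q where q: "q \<in> conds" "ext p q" "fst q \<ge> k" "snd (snd q) = snd (snd p)" by blast
  obtain n d w where [simp]: "q = (n, d, w)" by (cases q)
  obtain d' where d': "cond (Suc n) d' w" "agree n d d'"
    using add_orbit[of n d w] q by (auto simp: conds_def)
  then have "(Suc n, d', w) \<in> conds" "ext q (Suc n, d', w)" by (auto simp: conds_def)
  then show ?case using q ext_trans[of p q "(Suc n, d', w)"]
    by (intro bexI[of _ "(Suc n, d', w)"]) auto
qed

lemma reach_points:
  assumes "p \<in> conds" "finite F" "F \<subseteq> points"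
  obtains n d w where "cond n d w" "ext p (n, d, w)" "F \<subseteq> pts n"
proof -
  obtain k where "\<forall>n\<ge>k. F \<subseteq> pts n" using finite_points_pts assms by blast
  moreover obtain q where "q \<in> conds" "ext p q" "fst q \<ge> k" using reach[OF assms(1)] by blast
  moreover obtain n d w where "q = (n, d, w)" by (cases q)
  ultimately show ?thesis using that[of n d w] by (auto simp: conds_def)
qed

text \<open>The requirements are indexed by points, by group elements and by lists over countable
  sets, so there are countably many of them. Where a premise on \<open>d\<close> occurs, the points
  concerned must already be present: the premise then has the same truth value at every later stage
  and in the limit.\<close>

definition dense_domain where
  "dense_domain x = {(n, d, w). x \<in> pts n \<and> x \<in> Domain (sat w)}"
definition dense_range where
  "dense_range x = {(n, d, w). x \<in> pts n \<and> x \<in> Range (sat w)}"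
definition katetov :: "_ \<Rightarrow> ((nat \<times> 'a) \<times> real) list \<Rightarrow> bool" where
  "katetov d l \<longleftrightarrow> (\<forall>p\<in>set l. snd p > 0 \<and>
    (\<forall>p'\<in>set l. snd p \<le> d (fst p) (fst p') + snd p' \<and> d (fst p) (fst p') \<le> snd p + snd p'))"
definition dense_katetov where
  "dense_katetov l = {(n, d, w). fst ` set l \<subseteq> pts n \<and>
     (katetov d l \<longrightarrow> (\<exists>y\<in>pts n. \<forall>p\<in>set l. d y (fst p) = snd p))}"
definition dense_homogeneous where
  "dense_homogeneous l = {(n, d, w). set l \<subseteq> pts n \<times> pts n \<and>
     ((\<forall>p\<in>set l. \<forall>p'\<in>set l. d (fst p) (fst p') = d (snd p) (snd p')) \<longrightarrow>
      (\<exists>g1\<in>A. \<exists>g2\<in>A. \<exists>h1\<in>B. \<exists>h2\<in>B. \<forall>p\<in>set l.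
         (act h1 (fst p), act g1 (fst p)) \<in> w \<and> (act h2 (fst p), act g2 (snd p)) \<in> w))}"
definition dense_moved where
  "dense_moved g p = {(n, d, w). \<exists>x\<in>pts n. \<exists>z\<in>pts n. trace G (sat w) p (act g x) z \<and> z \<noteq> x}"

section \<open>Density of the requirements\<close>

lemma dense_domain:
  assumes "p \<in> conds" "x \<in> points"
  shows "\<exists>q\<in>conds. ext p q \<and> q \<in> dense_domain x"
proof -
  obtain n d w where q: "cond n d w" "ext p (n, d, w)" "{x} \<subseteq> pts n"
    by (rule reach_points[OF assms(1), of "{x}"]) (use assms in auto)
  show ?thesis
  proof (cases "x \<in> Domain (sat w)")
    case True
    then show ?thesis using q by (intro bexI[of _ "(n, d, w)"]) (auto simp: dense_domain_def conds_def)
  next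
    case False
    obtain d' where d': "cond (Suc n) d' (insert (x, (n, \<one>)) w)" "agree n d d'"
      by (rule add_domain[OF q(1) _ False]) (use q in auto)
    let ?q = "(Suc n, d', insert (x, (n, \<one>)) w)"
    have "ext (n, d, w) ?q" using d' by auto
    then have "ext p ?q" using q(2) ext_trans by blast
    moreover have "(x, (n, \<one>)) \<in> sat (insert (x, (n, \<one>)) w)"
      using sat_subset[OF cond_D(3)[OF d'(1)]] by blast
    ultimately show ?thesis using d' q pts_mono[of n "Suc n" x]
      by (intro bexI[of _ ?q]) (auto simp: dense_domain_def conds_def)
  qed
qed

lemma dense_range:
  assumes "p \<in> conds" "x \<in> points"
  shows "\<exists>q\<in>conds. ext p q \<and> q \<in> dense_range x"
proof -
  obtain n d w where q: "cond n d w" "ext p (n, d, w)" "{x} \<subseteq> pts n"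
    by (rule reach_points[OF assms(1), of "{x}"]) (use assms in auto)
  show ?thesis
  proof (cases "x \<in> Range (sat w)")
    case True
    then show ?thesis using q by (intro bexI[of _ "(n, d, w)"]) (auto simp: dense_range_def conds_def)
  next
    case False
    obtain d' where d': "cond (Suc n) d' (insert ((n, \<one>), x) w)" "agree n d d'"
      by (rule add_range[OF q(1) _ False]) (use q in auto)
    let ?q = "(Suc n, d', insert ((n, \<one>), x) w)"
    have "ext (n, d, w) ?q" using d' by auto
    then have "ext p ?q" using q(2) ext_trans by blast
    moreover have "((n, \<one>), x) \<in> sat (insert ((n, \<one>), x) w)"
      using sat_subset[OF cond_D(3)[OF d'(1)]] by blast
    ultimately show ?thesis using d' q pts_mono[of n "Suc n" x]
      by (intro bexI[of _ ?q]) (auto simp: dense_range_def conds_def)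
  qed
qed

lemma dense_katetov:
  assumes "p \<in> conds" "set l \<subseteq> points \<times> S"
  shows "\<exists>q\<in>conds. ext p q \<and> q \<in> dense_katetov l"
proof -
  obtain n d w where q: "cond n d w" "ext p (n, d, w)" "fst ` set l \<subseteq> pts n"
    by (rule reach_points[OF assms(1), of "fst ` set l"]) (use assms in auto)
  interpret orbit_metric G S M n d by (rule cond_D[OF q(1)])
  show ?thesis
  proof (cases "katetov d l")
    case True
    define f where "f a = (SOME s. (a, s) \<in> set l)" for a
    have f: "(a, f a) \<in> set l" if "a \<in> fst ` set l" for a
      using that unfolding f_def by (auto intro: someI)
    have k: "f a \<le> d a b + s \<and> d a b \<le> f a + s \<and> s \<le> d b a + f a" if "a \<in> fst ` set l" "(b, s) \<in> set l" for a b s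
      using True f[OF that(1)] that(2) unfolding katetov_def by fastforce
    obtain d' where d': "cond (Suc n) d' w" "agree n d d'" "\<And>a. a \<in> fst ` set l \<Longrightarrow> d' (n, \<one>) a = f a"
    proof (rule add_katetov[OF q(1) _ q(3)])
      show "f a \<in> S" if "a \<in> fst ` set l" for a using f[OF that] assms(2) by auto
      show "f a > 0" if "a \<in> fst ` set l" for a using f[OF that] True by (fastforce simp: katetov_def)
      show "f a \<le> d a b + f b" "d a b \<le> f a + f b" if "a \<in> fst ` set l" "b \<in> fst ` set l" for a b
        using k[OF that(1) f[OF that(2)]] by auto
    qed auto
    \<comment> \<open>The first inequality of \<open>katetov\<close>, applied to two entries at the
      same point, makes the list single-valued.\<close>
    have "f a = s" if "(a, s) \<in> set l" for a s
    proof -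
      have a: "a \<in> fst ` set l" using that by force
      have "d a a = 0" using d_zero[of a a] a q(3) by blast
      then show ?thesis using k[OF a that] by simp
    qed
    then have "\<forall>p\<in>set l. d' (n, \<one>) (fst p) = snd p" using d'(3) by force
    moreover have "fst ` set l \<subseteq> pts (Suc n)" using q(3) pts_mono[of n "Suc n"] by fastforce
    moreover have "(n, \<one>) \<in> pts (Suc n)" by (simp add: pts_def)
    ultimately have "(Suc n, d', w) \<in> dense_katetov l"
      unfolding dense_katetov_def by blast
    moreover have "ext p (Suc n, d', w)"
      using q(2) d'(2) ext_trans[of p "(n, d, w)" "(Suc n, d', w)"] by simp
    ultimately show ?thesis using d'(1)
      by (intro bexI[of _ "(Suc n, d', w)"]) (auto simp: conds_def)
  next
    case False
    then show ?thesis using q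
      by (intro bexI[of _ "(n, d, w)"]) (auto simp: dense_katetov_def conds_def)
  qed
qed

lemma dense_homogeneous:
  assumes "p \<in> conds" "set l \<subseteq> points \<times> points"
  shows "\<exists>q\<in>conds. ext p q \<and> q \<in> dense_homogeneous l"
proof -
  obtain n d w where q: "cond n d w" "ext p (n, d, w)" "fst ` set l \<union> snd ` set l \<subseteq> pts n"
    by (rule reach_points[OF assms(1), of "fst ` set l \<union> snd ` set l"]) (use assms in auto)
  have l: "set l \<subseteq> pts n \<times> pts n" using q(3) by (force simp: subset_iff)
  show ?thesis
  proof (cases "\<forall>p\<in>set l. \<forall>p'\<in>set l. d (fst p) (fst p') = d (snd p) (snd p')")
    case True
    then obtain w' g1 g2 h1 h2 where w': "cond n d w'" "w \<subseteq> w'" "g1 \<in> A" "g2 \<in> A" "h1 \<in> B" "h2 \<in> B"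
        "\<And>a b. (a, b) \<in> set l \<Longrightarrow> (act h1 a, act g1 a) \<in> w' \<and> (act h2 a, act g2 b) \<in> w'"
      using add_homogeneity[OF q(1) _ l] by (metis List.finite_set)
    have "\<forall>p\<in>set l. (act h1 (fst p), act g1 (fst p)) \<in> w' \<and> (act h2 (fst p), act g2 (snd p)) \<in> w'"
      using w'(7) by (metis prod.collapse)
    then have "(n, d, w') \<in> dense_homogeneous l"
      using l w'(3-6) unfolding dense_homogeneous_def by blast
    moreover have "ext p (n, d, w')" using q(2) w'(2) by auto
    ultimately show ?thesis using w'(1)
      by (intro bexI[of _ "(n, d, w')"]) (auto simp: conds_def)
  next
    case False
    then have "(n, d, w) \<in> dense_homogeneous l"
      using l unfolding dense_homogeneous_def by blast
    then show ?thesis using q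
      by (intro bexI[of _ "(n, d, w)"]) (auto simp: conds_def)
  qed
qed

lemma dense_moved:
  assumes "p \<in> conds" "g \<in> carrier G" "g \<noteq> \<one>" "fst ` set l \<subseteq> carrier G"
    "\<And>h h'. \<lbrakk>(h, True) \<in> set l; (h', False) \<in> set l\<rbrakk> \<Longrightarrow> inv h \<otimes> h' \<notin> H"
  shows "\<exists>q\<in>conds. ext p q \<and> q \<in> dense_moved g l"
proof -
  obtain n d w where p: "p = (n, d, w)" by (cases p)
  then have "cond n d w" using assms(1) by (simp add: conds_def)
  from add_moved_point[OF this assms(2-)]
  obtain n' d' w' x z where q: "cond n' d' w'" "n \<le> n'" "agree n d d'" "w \<subseteq> w'" "x \<in> pts n'" "z \<in> pts n'"
      "trace G (sat w') l (act g x) z" "z \<noteq> x" by blast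
  then show ?thesis using p
    by (intro bexI[of _ "(n', d', w')"]) (auto simp: conds_def dense_moved_def)
qed

text \<open>\<open>code\<close> is fixed before \<open>W\<close> exists: it is the word by which the
  twisted action of \<open>g\<close> will differ from translation by \<open>g\<close>. The last
  conclusion prepares the faithfulness of that action.\<close>

lemma generic_space:
  fixes code :: "'a \<Rightarrow> ('a \<times> bool) list"
  assumes code: "\<And>g. g \<in> carrier G \<Longrightarrow> fst ` set (code g) \<subseteq> carrier G"
    "\<And>g h h'. \<lbrakk>g \<in> carrier G; (h, True) \<in> set (code g); (h', False) \<in> set (code g)\<rbrakk> \<Longrightarrow> inv h \<otimes> h' \<notin> H"
  obtains D W where "Metric_space points D" "\<And>x y. \<lbrakk>x \<in> points; y \<in> points\<rbrakk> \<Longrightarrow> D x y \<in> S"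
    "\<And>g x y. \<lbrakk>g \<in> carrier G; x \<in> points; y \<in> points\<rbrakk> \<Longrightarrow> D (act g x) (act g y) = D x y"
    "\<And>F f. \<lbrakk>finite F; F \<subseteq> points; \<And>a. a \<in> F \<Longrightarrow> f a \<in> S \<and> f a > 0;
       \<And>a b. \<lbrakk>a \<in> F; b \<in> F\<rbrakk> \<Longrightarrow> f a \<le> D a b + f b \<and> D a b \<le> f a + f b\<rbrakk> \<Longrightarrow>
       \<exists>y\<in>points. \<forall>a\<in>F. D y a = f a"
    "bij_betw W points points" "\<And>x y. \<lbrakk>x \<in> points; y \<in> points\<rbrakk> \<Longrightarrow> D (W x) (W y) = D x y"
    "\<And>s x. \<lbrakk>s \<in> H; x \<in> points\<rbrakk> \<Longrightarrow> W (act s x) = act s (W x)"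
    "\<And>L. \<lbrakk>finite L; L \<subseteq> points \<times> points;
        \<And>p p'. \<lbrakk>p \<in> L; p' \<in> L\<rbrakk> \<Longrightarrow> D (fst p) (fst p') = D (snd p) (snd p')\<rbrakk> \<Longrightarrow>
        \<exists>g1\<in>A. \<exists>g2\<in>A. \<exists>h1\<in>B. \<exists>h2\<in>B. \<forall>p\<in>L. W (act h1 (fst p)) = act g1 (fst p) \<and>
           W (act h2 (fst p)) = act g2 (snd p)"
    "\<And>g. \<lbrakk>g \<in> carrier G; g \<noteq> \<one>\<rbrakk> \<Longrightarrow>
        \<exists>x\<in>points. \<exists>z\<in>points. trace G {(x, W x) |x. x \<in> points} (code g) (act g x) z \<and> z \<noteq> x"
proof -
  define \<D> where "\<D> = dense_domain ` points \<union> dense_range ` points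
    \<union> dense_katetov ` lists (points \<times> S) \<union> dense_homogeneous ` lists (points \<times> points)
    \<union> (\<lambda>g. dense_moved g (code g)) ` (carrier G - {\<one>})"
  have "countable \<D>"
    unfolding \<D>_def using points_countable S_countable G_countable
    by (intro countable_Un countable_image countable_lists countable_SIGMA countable_Diff) auto
  moreover have "(0, \<lambda>_ _. 0, {}) \<in> conds"
  proof -
    have "orbit_metric G S M 0 (\<lambda>_ _. 0)" by unfold_locales (auto simp: pts_def)
    then show ?thesis by (simp add: conds_def cond_def)
  qed
  moreover have "\<exists>q\<in>conds. ext p q \<and> q \<in> E" if "E \<in> \<D>" "p \<in> conds" for E p
    using that(1) unfolding \<D>_def lists_eq_set
  proof (elim UnE imageE, goal_cases)
    case 1
    then show ?case using dense_domain[OF that(2)] by simp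
  next
    case 2
    then show ?case using dense_range[OF that(2)] by simp
  next
    case 3
    then show ?case using dense_katetov[OF that(2)] by simp
  next
    case 4
    then show ?case using dense_homogeneous[OF that(2)] by simp
  next
    case (5 g)
    then have g: "g \<in> carrier G" "g \<noteq> \<one>" by auto
    show ?case
      unfolding 5(1) by (rule dense_moved[OF that(2) g code[OF g(1)]])
  qed
  ultimately obtain c where c: "\<And>k. c k \<in> conds" "\<And>k. ext (c k) (c (Suc k))" "\<And>E. E \<in> \<D> \<Longrightarrow> \<exists>k. c k \<in> E"
    using generic_chain[of \<D> "(0, \<lambda>_ _. 0, {})" conds ext] ext_refl by blast
  define n d w where "n k = fst (c k)" and "d k = fst (snd (c k))" and "w k = snd (snd (c k))" for k
  have c_eq: "c k = (n k, d k, w k)" for k by (simp add: n_def d_def w_def)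
  have cond: "cond (n k) (d k) (w k)" for k using c(1)[of k] by (simp add: conds_def c_eq)
  have ext: "ext (c k) (c l)" if "k \<le> l" for k l
    using that
  proof (induction rule: dec_induct)
    case (step m)
    then show ?case using ext_trans c(2) by blast
  qed (rule ext_refl)
  have n_mono: "n k \<le> n l" and d_agree: "agree (n k) (d k) (d l)" and w_mono: "w k \<subseteq> w l" if "k \<le> l" for k l
    using ext[OF that] by (simp_all add: c_eq)
  \<comment> \<open>\<open>dense_domain\<close> also asks that its point be present, which forces
    the number of orbits to be unbounded.\<close>
  have n_big: "\<exists>k. i < n k" for i
  proof -
    have "dense_domain (i, \<one>) \<in> \<D>" by (auto simp: \<D>_def points_def)
    then show ?thesis using c(3) by (fastforce simp: dense_domain_def c_eq pts_def)
  qed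
  have stage: "\<exists>l\<ge>k. F \<subseteq> pts (n l)" if F: "finite F" "F \<subseteq> points" for F k
  proof -
    obtain i where i: "\<forall>m\<ge>i. F \<subseteq> pts m" using finite_points_pts[OF F] by blast
    obtain l where "i < n l" using n_big by blast
    then have "i \<le> n (max k l)" using n_mono[of l "max k l"] by simp
    then show ?thesis using i by (intro exI[of _ "max k l"]) simp
  qed
  \<comment> \<open>Any stage containing both points gives the same value, since later metrics agree
    with earlier ones. The default 0 matters because \<open>Metric_space\<close> demands
    nonnegativity and symmetry for all arguments.\<close>
  define D where "D x y = (if x \<in> points \<and> y \<in> points then d (LEAST k. x \<in> pts (n k) \<and> y \<in> pts (n k)) x y else 0)"
    for x y
  have D: "D x y = d k x y" if "x \<in> pts (n k)" "y \<in> pts (n k)" for x y k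
  proof -
    let ?P = "\<lambda>k. x \<in> pts (n k) \<and> y \<in> pts (n k)"
    have "?P (LEAST k. ?P k)" "(LEAST k. ?P k) \<le> k"
      using that by (auto intro: LeastI2 Least_le)
    then have "d k x y = d (LEAST k. ?P k) x y"
      using d_agree[of "LEAST k. ?P k" k] by (simp add: agree_def)
    then show ?thesis using that pts_points by (simp add: D_def)
  qed
  have om: "orbit_metric G S M (n k) (d k)" for k by (rule cond_D[OF cond])
  have st2: "\<exists>k. x \<in> pts (n k) \<and> y \<in> pts (n k)" if "x \<in> points" "y \<in> points" for x y
    using stage[of "{x, y}" 0] that by auto
  have st3: "\<exists>k. x \<in> pts (n k) \<and> y \<in> pts (n k) \<and> z \<in> pts (n k)" if "x \<in> points" "y \<in> points" "z \<in> points" for x y z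
    using stage[of "{x, y, z}" 0] that by auto
  have DS: "D x y \<in> S" if xy: "x \<in> points" "y \<in> points" for x y
    using st2[OF xy] D orbit_metric.d_S[OF om] by metis
  have D_act: "D (act g x) (act g y) = D x y" if "g \<in> carrier G" and xy: "x \<in> points" "y \<in> points" for g x y
  proof -
    obtain k where "x \<in> pts (n k)" "y \<in> pts (n k)" using st2[OF xy] by blast
    then show ?thesis
      using D[of "act g x" k "act g y"] D[of x k y] that(1) orbit_metric.d_act[OF om[of k]] by simp
  qed
  have metric: "Metric_space points D"
  proof
    show "0 \<le> D x y" for x y
      using DS[of x y] S_nonneg by (cases "x \<in> points \<and> y \<in> points") (auto simp: D_def)
    show "D x y = D y x" for x y
    proof (cases "x \<in> points \<and> y \<in> points")
      case True
      then obtain k where "x \<in> pts (n k)" "y \<in> pts (n k)" using st2 by blast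
      then show ?thesis
        using D[of x k y] D[of y k x] orbit_metric.d_commute[OF om[of k]] by simp
    qed (auto simp: D_def)
    show "D x y = 0 \<longleftrightarrow> x = y" if xy: "x \<in> points" "y \<in> points" for x y
    proof -
      obtain k where "x \<in> pts (n k)" "y \<in> pts (n k)" using st2[OF xy] by blast
      then show ?thesis
        using D[of x k y] orbit_metric.d_zero[OF om[of k]] by simp
    qed
    show "D x z \<le> D x y + D y z" if xyz: "x \<in> points" "y \<in> points" "z \<in> points" for x y z
    proof -
      obtain k where "x \<in> pts (n k)" "y \<in> pts (n k)" "z \<in> pts (n k)" using st3[OF xyz] by blast
      then show ?thesis
        using D[of x k y] D[of y k z] D[of x k z] orbit_metric.d_triangle[OF om[of k]] by simp
    qed
  qed
  have katetov_limit: "\<exists>y\<in>points. \<forall>a\<in>F. D y a = f a"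
    if F: "finite F" "F \<subseteq> points" and f: "\<And>a. a \<in> F \<Longrightarrow> f a \<in> S \<and> f a > 0"
      "\<And>a b. \<lbrakk>a \<in> F; b \<in> F\<rbrakk> \<Longrightarrow> f a \<le> D a b + f b \<and> D a b \<le> f a + f b" for F f
  proof -
    obtain l where l: "set l = F" using F(1) finite_list by blast
    define l' where "l' = map (\<lambda>a. (a, f a)) l"
    have l': "set l' = (\<lambda>a. (a, f a)) ` F" using l by (simp add: l'_def)
    have "l' \<in> lists (points \<times> S)"
      using F f l' by (force simp: lists_eq_set)
    then have "dense_katetov l' \<in> \<D>"
      unfolding \<D>_def by blast
    then obtain k where k: "c k \<in> dense_katetov l'" using c(3) by blast
    then have Fk: "F \<subseteq> pts (n k)"
      by (simp add: dense_katetov_def c_eq l' image_image)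
    have "d k a b = D a b" if "a \<in> F" "b \<in> F" for a b
      using D Fk that by (metis subsetD)
    then have "katetov (d k) l'"
      using f by (simp add: katetov_def l')
    then obtain y where y: "y \<in> pts (n k)" "\<forall>p\<in>set l'. d k y (fst p) = snd p"
      using k unfolding dense_katetov_def c_eq by blast
    have "D y a = f a" if "a \<in> F" for a
    proof -
      have "(a, f a) \<in> set l'" "a \<in> pts (n k)" using that l' Fk by auto
      then show ?thesis using y D[of y k a] by force
    qed
    then show ?thesis using pts_points[OF y(1)] by blast
  qed
  define \<rho> where "\<rho> = (\<Union>k. sat (w k))"
  have sat_mono': "sat (w k) \<subseteq> sat (w l)" if "k \<le> l" for k l
    using sat_mono[OF w_mono[OF that]] .
  have w_pts: "w k \<subseteq> pts (n k) \<times> pts (n k)" for k by (rule cond_D[OF cond])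
  have \<rho>_points: "x \<in> points" "y \<in> points" if "(x, y) \<in> \<rho>" for x y
    using that sat_pts[OF w_pts] pts_points unfolding \<rho>_def by blast+
  have \<rho>_iso: "D x x' = D y y'" if xy: "(x, y) \<in> \<rho>" "(x', y') \<in> \<rho>" for x x' y y'
  proof -
    obtain k l where "(x, y) \<in> sat (w k)" "(x', y') \<in> sat (w l)"
      using xy unfolding \<rho>_def by blast
    then have kl: "(x, y) \<in> sat (w (max k l))" "(x', y') \<in> sat (w (max k l))"
      using sat_mono'[of k "max k l"] sat_mono'[of l "max k l"] by auto
    moreover have "x \<in> pts (n (max k l))" "x' \<in> pts (n (max k l))" "y \<in> pts (n (max k l))" "y' \<in> pts (n (max k l))"
      using kl sat_pts[OF w_pts] by blast+
    ultimately show ?thesis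
      using sat_isometric[OF cond kl] D[of x "max k l" x'] D[of y "max k l" y'] by simp
  qed
  have \<rho>_dom: "\<exists>y. (x, y) \<in> \<rho>" if "x \<in> points" for x
  proof -
    have "dense_domain x \<in> \<D>" using that by (auto simp: \<D>_def)
    then show ?thesis using c(3) by (fastforce simp: dense_domain_def c_eq \<rho>_def)
  qed
  have \<rho>_ran: "\<exists>y. (y, x) \<in> \<rho>" if "x \<in> points" for x
  proof -
    have "dense_range x \<in> \<D>" using that by (auto simp: \<D>_def)
    then show ?thesis using c(3) by (fastforce simp: dense_range_def c_eq \<rho>_def)
  qed
  interpret Metric_space points D by (rule metric)
  \<comment> \<open>Distance zero on one side is distance zero on the other, so single-valuedness
    and injectivity come together.\<close>
  have \<rho>_inj: "x = x' \<longleftrightarrow> y = y'" if "(x, y) \<in> \<rho>" "(x', y') \<in> \<rho>" for x x' y y'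
    using \<rho>_iso[OF that] \<rho>_points that zero by metis
  define W where "W x = (THE y. (x, y) \<in> \<rho>)" for x
  have W: "W x = y" if "(x, y) \<in> \<rho>" for x y
    unfolding W_def using that \<rho>_inj by blast
  have W_\<rho>: "(x, W x) \<in> \<rho>" if "x \<in> points" for x
    using \<rho>_dom[OF that] W by metis
  have \<rho>_eq: "\<rho> \<subseteq> {(x, W x) |x. x \<in> points}"
  proof
    fix p assume "p \<in> \<rho>"
    then have "(fst p, snd p) \<in> \<rho>" by simp
    from W[OF this] \<rho>_points(1)[OF this] show "p \<in> {(x, W x) |x. x \<in> points}"
      by (metis (mono_tags, lifting) mem_Collect_eq prod.collapse)
  qed
  show ?thesis
  proof (rule that[OF metric DS D_act katetov_limit])
    show "bij_betw W points points"
    proof (rule bij_betwI')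
      show "W x = W y \<longleftrightarrow> x = y" if "x \<in> points" "y \<in> points" for x y
        using \<rho>_inj[OF W_\<rho>[OF that(1)] W_\<rho>[OF that(2)]] by blast
      show "W x \<in> points" if "x \<in> points" for x using W_\<rho>[OF that] \<rho>_points by blast
      show "\<exists>x\<in>points. y = W x" if "y \<in> points" for y
        using \<rho>_ran[OF that] W \<rho>_points by metis
    qed
    show "D (W x) (W y) = D x y" if "x \<in> points" "y \<in> points" for x y
      using \<rho>_iso[OF W_\<rho>[OF that(1)] W_\<rho>[OF that(2)]] by simp
    show "W (act s x) = act s (W x)" if "s \<in> H" "x \<in> points" for s x
    proof (rule W)
      obtain k where "(x, W x) \<in> sat (w k)" using W_\<rho>[OF \<open>x \<in> points\<close>] unfolding \<rho>_def by blast
      then have "(act s x, act s (W x)) \<in> sat (w k)" by (rule sat_act[OF w_pts _ \<open>s \<in> H\<close>])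
      then show "(act s x, act s (W x)) \<in> \<rho>" unfolding \<rho>_def by blast
    qed
    show "\<exists>g1\<in>A. \<exists>g2\<in>A. \<exists>h1\<in>B. \<exists>h2\<in>B. \<forall>p\<in>L. W (act h1 (fst p)) = act g1 (fst p) \<and>
           W (act h2 (fst p)) = act g2 (snd p)"
      if L: "finite L" "L \<subseteq> points \<times> points"
        and iso: "\<And>p p'. \<lbrakk>p \<in> L; p' \<in> L\<rbrakk> \<Longrightarrow> D (fst p) (fst p') = D (snd p) (snd p')" for L
    proof -
      obtain l where l: "set l = L" using L(1) finite_list by blast
      then have "l \<in> lists (points \<times> points)"
        using L by (simp add: lists_eq_set)
      then have "dense_homogeneous l \<in> \<D>"
        unfolding \<D>_def by blast
      then obtain k where k: "c k \<in> dense_homogeneous l" using c(3) by blast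
      then have Lk: "L \<subseteq> pts (n k) \<times> pts (n k)"
        by (simp add: dense_homogeneous_def c_eq l)
      then have "\<forall>p\<in>L. fst p \<in> pts (n k) \<and> snd p \<in> pts (n k)" by auto
      then have "\<forall>p\<in>L. \<forall>p'\<in>L. d k (fst p) (fst p') = d k (snd p) (snd p')"
        using iso D by metis
      then obtain g1 g2 h1 h2 where g: "g1 \<in> A" "g2 \<in> A" "h1 \<in> B" "h2 \<in> B"
        "\<forall>p\<in>L. (act h1 (fst p), act g1 (fst p)) \<in> w k \<and> (act h2 (fst p), act g2 (snd p)) \<in> w k"
        using k unfolding dense_homogeneous_def c_eq l by blast
      then have "\<forall>p\<in>L. (act h1 (fst p), act g1 (fst p)) \<in> \<rho> \<and> (act h2 (fst p), act g2 (snd p)) \<in> \<rho>"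
        using sat_subset[OF w_pts[of k]] unfolding \<rho>_def by blast
      then show ?thesis using g W by blast
    qed
    show "\<exists>x\<in>points. \<exists>z\<in>points. trace G {(x, W x) |x. x \<in> points} (code g) (act g x) z \<and> z \<noteq> x"
      if "g \<in> carrier G" "g \<noteq> \<one>" for g
    proof -
      have "dense_moved g (code g) \<in> \<D>" using that unfolding \<D>_def by blast
      then obtain k where k: "c k \<in> dense_moved g (code g)" using c(3) by blast
      then obtain x z where x: "x \<in> pts (n k)" "z \<in> pts (n k)" "trace G (sat (w k)) (code g) (act g x) z" "z \<noteq> x"
        unfolding dense_moved_def c_eq by blast
      have "sat (w k) \<subseteq> {(x, W x) |x. x \<in> points}" using \<rho>_eq unfolding \<rho>_def by blast
      from trace_mono[OF this x(3)] show ?thesis using x pts_points by blast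
    qed
  qed
qed

end

section \<open>Twisting an action along a tree\<close>

primrec mprod :: "('b, 'm) monoid_scheme \<Rightarrow> 'b list \<Rightarrow> 'b" where
  "mprod B [] = \<one>\<^bsub>B\<^esub>"
| "mprod B (x # xs) = x \<otimes>\<^bsub>B\<^esub> mprod B xs"

lemma (in monoid) mprod_closed [simp]:
  "set xs \<subseteq> carrier G \<Longrightarrow> mprod G xs \<in> carrier G"
  by (induction xs) auto

lemma (in monoid) mprod_append:
  "set xs \<subseteq> carrier G \<Longrightarrow> set ys \<subseteq> carrier G \<Longrightarrow> mprod G (xs @ ys) = mprod G xs \<otimes> mprod G ys"
  by (induction xs) (auto simp: m_assoc)

text \<open>The total counterpart of \<open>step\<close>: with \<open>a\<close> the translation
  action and \<open>w\<close> the limit isometry, \<open>trace\<close> follows the values of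
  products of letters.\<close>

definition letter :: "('y, 'm) monoid_scheme \<Rightarrow> ('c \<Rightarrow> 'y) \<Rightarrow> 'y \<Rightarrow> 'c \<times> bool \<Rightarrow> 'y" where
  "letter B a w x = a (fst x) \<otimes>\<^bsub>B\<^esub> (if snd x then w else inv\<^bsub>B\<^esub> w) \<otimes>\<^bsub>B\<^esub> inv\<^bsub>B\<^esub> (a (fst x))"

section \<open>Products of weights along walks in a tree\<close>

context serre_tree
begin

context
  fixes B :: "('b, 'm) monoid_scheme" and W :: "'e \<Rightarrow> 'b"
  assumes B: "group B"
    and W_closed: "\<And>f. f \<in> arcs T \<Longrightarrow> W f \<in> carrier B"
    and W_rev: "\<And>f. f \<in> arcs T \<Longrightarrow> W (rev f) = inv\<^bsub>B\<^esub> (W f)"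
begin

interpretation B: group B by (rule B)

lemma walk_prod_append:
  assumes "awalk u p v" "awalk v q w"
  shows "mprod B (map W (p @ q)) = mprod B (map W p) \<otimes>\<^bsub>B\<^esub> mprod B (map W q)"
  using assms W_closed by (fastforce simp: awalk_def intro!: B.mprod_append)

lemma walk_prod_closed: "awalk u p v \<Longrightarrow> mprod B (map W p) \<in> carrier B"
  using W_closed by (fastforce simp: awalk_def intro!: B.mprod_closed)

text \<open>Induction on the length. A nonempty closed walk without repeated vertices, apart from
  its ends, is a cycle and hence backtracks by \<open>no_circuit\<close>, so that two adjacent
  weights cancel; otherwise it contains a shorter closed walk, whose product is trivial and which
  can be cut out.\<close>

lemma closed_walk_prod: "awalk u p u \<Longrightarrow> mprod B (map W p) = \<one>\<^bsub>B\<^esub>"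
proof (induction "length p" arbitrary: u p rule: less_induct)
  case less
  show ?case
  proof (cases p)
    case Nil
    then show ?thesis by simp
  next
    case (Cons f p')
    have f: "f \<in> arcs T" "tail T f = u" and p': "awalk (head T f) p' u"
      using less.prems Cons by (auto simp: awalk_Cons_iff)
    show ?thesis
    proof (cases "distinct (tl (awalk_verts u p))")
      case True
      then have "cycle p" using less.prems Cons by (auto simp: cycle_def)
      then obtain i where i: "Suc i < length p" "p ! Suc i = rev (p ! i)"
        using no_circuit by blast
      define q r x where "q = take i p" and "r = drop (Suc (Suc i)) p" and "x = p ! i"
      have p: "p = q @ [x, rev x] @ r"
        using i unfolding q_def r_def x_def
        by (metis append_Cons append_Nil append_take_drop_id Cons_nth_drop_Suc Suc_lessD)
      have w: "awalk u q (tail T x)" "awalk (tail T x) r u" "x \<in> arcs T"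
        using less.prems unfolding p by (auto simp: awalk_Cons_iff)
      have "mprod B (map W p) = mprod B (map W q) \<otimes>\<^bsub>B\<^esub>
          (W x \<otimes>\<^bsub>B\<^esub> (inv\<^bsub>B\<^esub> W x \<otimes>\<^bsub>B\<^esub> mprod B (map W r)))"
      proof -
        have "awalk (tail T x) ([x, rev x] @ r) u"
          using w by (auto simp: awalk_Cons_iff)
        then show ?thesis
          unfolding p walk_prod_append[OF w(1) \<open>awalk (tail T x) ([x, rev x] @ r) u\<close>]
            using W_rev[OF w(3)] by simp
      qed
      also have "\<dots> = mprod B (map W q) \<otimes>\<^bsub>B\<^esub> mprod B (map W r)"
        using W_closed[OF w(3)] walk_prod_closed[OF w(2)] by (simp add: B.m_assoc[symmetric])
      also have "\<dots> = mprod B (map W (q @ r))"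
        using walk_prod_append[OF w(1,2)] by simp
      also have "\<dots> = \<one>\<^bsub>B\<^esub>"
        by (rule less.hyps[of _ u]) (use w p in auto)
      finally show ?thesis .
    next
      case False
      \<comment> \<open>\<open>tl\<close> discards the first visit to \<open>u\<close>, so the
        repetition is inside \<open>p'\<close>, and the closed part \<open>r\<close> is shorter than
        \<open>p\<close> even if it is all of \<open>p'\<close>.\<close>
      then have "\<not> distinct (awalk_verts (head T f) p')"
        using Cons by simp
      then obtain q r s where d: "p' = q @ r @ s" "distinct (awalk_verts (head T f) q)"
          "0 < length r" "\<exists>v. awalk (head T f) q v \<and> awalk v r v \<and> awalk v s u"
        using awalk_not_distinct_decomp[OF p'] by blast
      then obtain v where v: "awalk (head T f) q v" "awalk v r v" "awalk v s u" by blast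
      have fq: "awalk u (f # q) v" and rs: "awalk v (r @ s) u" using v f by (auto simp: awalk_Cons_iff)
      have "mprod B (map W p) = mprod B (map W ((f # q) @ r @ s))"
        unfolding Cons d(1) by simp
      also have "\<dots> = mprod B (map W (f # q)) \<otimes>\<^bsub>B\<^esub> (mprod B (map W r) \<otimes>\<^bsub>B\<^esub> mprod B (map W s))"
        by (simp only: walk_prod_append[OF fq rs] walk_prod_append[OF v(2,3)])
      also have "mprod B (map W r) = \<one>\<^bsub>B\<^esub>"
        by (rule less.hyps[OF _ v(2)]) (simp add: Cons d)
      also have "mprod B (map W (f # q)) \<otimes>\<^bsub>B\<^esub> (\<one>\<^bsub>B\<^esub> \<otimes>\<^bsub>B\<^esub> mprod B (map W s)) = mprod B (map W ((f # q) @ s))"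
        by (simp only: walk_prod_append[OF fq v(3)] B.l_one[OF walk_prod_closed[OF v(3)]])
      also have "\<dots> = \<one>\<^bsub>B\<^esub>"
      proof (rule less.hyps[of _ u])
        show "awalk u ((f # q) @ s) u"
          by (rule awalk_appendI[OF fq v(3)])
      qed (use d Cons in auto)
      finally show ?thesis .
    qed
  qed
qed

lemma awalk_reverse: "awalk u p v \<Longrightarrow> \<exists>q. awalk v q u"
  using symmetric_reachable'[OF reachable_awalkI] by (simp add: reachable_awalk)

text \<open>The same return walk closes up both walks.\<close>

lemma walk_prod_unique:
  assumes "awalk u p v" "awalk u q v"
  shows "mprod B (map W p) = mprod B (map W q)"
proof -
  obtain r where r: "awalk v r u" using awalk_reverse assms(1) by blast
  have "mprod B (map W p) \<otimes>\<^bsub>B\<^esub> mprod B (map W r) = \<one>\<^bsub>B\<^esub>"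
       "mprod B (map W q) \<otimes>\<^bsub>B\<^esub> mprod B (map W r) = \<one>\<^bsub>B\<^esub>"
    using closed_walk_prod[OF awalk_appendI[OF assms(1) r]] closed_walk_prod[OF awalk_appendI[OF assms(2) r]]
    by (simp_all only: walk_prod_append[OF assms(1) r] walk_prod_append[OF assms(2) r])
  then show ?thesis
    using B.inv_equality walk_prod_closed assms r by (metis B.r_inv B.right_cancel B.inv_closed)
qed

end

text \<open>The reverse of an arc would lead back to the tail of that arc, a vertex that the path
  has left for good.\<close>

lemma apath_no_backtrack:
  "apath u p v \<Longrightarrow> f \<in> set p \<Longrightarrow> rev f \<notin> set p"
proof (induction p arbitrary: u)
  case Nil
  then show ?case by simp
next
  case (Cons x p)
  have x: "x \<in> arcs T" "tail T x = u" "apath (head T x) p v" "u \<notin> set (awalk_verts (head T x) p)"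
    using Cons.prems(1) by (auto simp: apath_Cons_iff)
  then have aw: "awalk (head T x) p v" by (simp add: apath_def)
  have "rev x \<notin> set p"
    using awalk_verts_arc2[OF aw, of "rev x"] x by auto
  moreover have "rev x \<noteq> x" using arev_neq x by blast
  moreover have "rev f \<noteq> x" if "f \<in> set p"
    using that \<open>rev x \<notin> set p\<close> by (metis arev_arev)
  ultimately show ?case
    using Cons.IH[OF x(3)] Cons.prems(2) by auto
qed

lemma ex_apath:
  assumes "u \<in> verts T" "v \<in> verts T"
  shows "\<exists>p. apath u p v"
  using connected assms by (auto simp: strongly_connected_def reachable_apath)

end

section \<open>Words read off paths in the tree\<close>

context tree_action_without_inversion
begin

sublocale \<Gamma>: group \<Gamma>
  using V.group_hom group_hom.axioms(1) by blast

lemma psi_mult: "g \<in> carrier \<Gamma> \<Longrightarrow> h \<in> carrier \<Gamma> \<Longrightarrow> f \<in> arcs T \<Longrightarrow> \<psi> (g \<otimes>\<^bsub>\<Gamma>\<^esub> h) f = \<psi> g (\<psi> h f)"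
  by (rule E.composition_rule)

lemma phi_mult: "g \<in> carrier \<Gamma> \<Longrightarrow> h \<in> carrier \<Gamma> \<Longrightarrow> v \<in> verts T \<Longrightarrow> \<phi> (g \<otimes>\<^bsub>\<Gamma>\<^esub> h) v = \<phi> g (\<phi> h v)"
  by (rule V.composition_rule)

lemma psi_closed [simp]: "g \<in> carrier \<Gamma> \<Longrightarrow> f \<in> arcs T \<Longrightarrow> \<psi> g f \<in> arcs T"
  using E.element_image by blast

lemma phi_closed [simp]: "g \<in> carrier \<Gamma> \<Longrightarrow> v \<in> verts T \<Longrightarrow> \<phi> g v \<in> verts T"
  using V.element_image by blast

lemma psi_one [simp]: "f \<in> arcs T \<Longrightarrow> \<psi> \<one>\<^bsub>\<Gamma>\<^esub> f = f"
  using E.id_eq_one by (metis restrict_apply')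

lemma psi_inv: "g \<in> carrier \<Gamma> \<Longrightarrow> f \<in> arcs T \<Longrightarrow> \<psi> (inv\<^bsub>\<Gamma>\<^esub> g) (\<psi> g f) = f"
  using E.orbit_sym_aux by blast

lemma awalk_act:
  "g \<in> carrier \<Gamma> \<Longrightarrow> awalk u p v \<Longrightarrow> awalk (\<phi> g u) (map (\<psi> g) p) (\<phi> g v)"
  by (induction p arbitrary: u) (auto simp: awalk_simps act_tail act_head)

text \<open>Letters are a group element with a sign, so that the words exist before any permutation
  \<open>w\<close> is chosen. The element representing an arc is determined only up to right
  multiplication by the stabilizer of \<open>e\<close>; \<open>letter_cong\<close> makes this choice
  harmless.\<close>

definition arc_code :: "'b \<Rightarrow> 'b \<Rightarrow> ('c \<times> bool) list" where
  "arc_code e f =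
    (if \<exists>g\<in>carrier \<Gamma>. f = \<psi> g e then [(SOME g. g \<in> carrier \<Gamma> \<and> f = \<psi> g e, True)]
     else if \<exists>g\<in>carrier \<Gamma>. f = rev (\<psi> g e) then [(SOME g. g \<in> carrier \<Gamma> \<and> f = rev (\<psi> g e), False)]
     else [])"

text \<open>Any walk would give the same product of letters; a simple path gives a reduced
  word.\<close>

definition walk_code :: "'b \<Rightarrow> 'c \<Rightarrow> ('c \<times> bool) list" where
  "walk_code e g = concat (map (arc_code e) (SOME p. apath (tail T e) p (\<phi> g (tail T e))))"

lemma arc_code_cases:
  assumes "f \<in> arcs T"
  obtains (pos) g where "g \<in> carrier \<Gamma>" "f = \<psi> g e" "arc_code e f = [(g, True)]"
  | (neg) g where "g \<in> carrier \<Gamma>" "f = rev (\<psi> g e)" "arc_code e f = [(g, False)]"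
      "\<not> (\<exists>g\<in>carrier \<Gamma>. f = \<psi> g e)"
  | (other) "arc_code e f = []" "\<not> (\<exists>g\<in>carrier \<Gamma>. f = \<psi> g e)" "\<not> (\<exists>g\<in>carrier \<Gamma>. f = rev (\<psi> g e))"
proof (cases "\<exists>g\<in>carrier \<Gamma>. f = \<psi> g e")
  case True
  then have "(SOME g. g \<in> carrier \<Gamma> \<and> f = \<psi> g e) \<in> carrier \<Gamma> \<and> f = \<psi> (SOME g. g \<in> carrier \<Gamma> \<and> f = \<psi> g e) e"
    by (metis (mono_tags, lifting) someI_ex)
  then show ?thesis using True by (intro pos[of "SOME g. g \<in> carrier \<Gamma> \<and> f = \<psi> g e"]) (simp_all add: arc_code_def)
next
  case n: False
  show ?thesis
  proof (cases "\<exists>g\<in>carrier \<Gamma>. f = rev (\<psi> g e)")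
    case True
    then have "(SOME g. g \<in> carrier \<Gamma> \<and> f = rev (\<psi> g e)) \<in> carrier \<Gamma> \<and>
        f = rev (\<psi> (SOME g. g \<in> carrier \<Gamma> \<and> f = rev (\<psi> g e)) e)"
      by (metis (mono_tags, lifting) someI_ex)
    then show ?thesis using True n by (intro neg[of "SOME g. g \<in> carrier \<Gamma> \<and> f = rev (\<psi> g e)"]) (simp_all add: arc_code_def)
  next
    case False
    then show ?thesis using n other by (simp add: arc_code_def)
  qed
qed

text \<open>Otherwise \<open>g \<otimes> inv h\<close> would invert the arc
  \<open>\<psi> h e\<close>. So the positive and the negative case of \<open>arc_code\<close>
  exclude each other, and the weights are well defined.\<close>

lemma psi_ne_rev_psi:
  assumes "g \<in> carrier \<Gamma>" "h \<in> carrier \<Gamma>" "e \<in> arcs T"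
  shows "\<psi> g e \<noteq> rev (\<psi> h e)"
proof
  assume "\<psi> g e = rev (\<psi> h e)"
  then have "\<psi> (g \<otimes>\<^bsub>\<Gamma>\<^esub> inv\<^bsub>\<Gamma>\<^esub> h) (\<psi> h e) = rev (\<psi> h e)"
    using assms by (simp add: psi_mult psi_inv)
  then show False
    using no_inversion assms by auto
qed

lemma psi_eq_iff:
  assumes "g \<in> carrier \<Gamma>" "h \<in> carrier \<Gamma>" "e \<in> arcs T"
  shows "\<psi> g e = \<psi> h e \<longleftrightarrow> inv\<^bsub>\<Gamma>\<^esub> g \<otimes>\<^bsub>\<Gamma>\<^esub> h \<in> stabilizer \<Gamma> \<psi> e"
proof
  assume "\<psi> g e = \<psi> h e"
  then have "\<psi> (inv\<^bsub>\<Gamma>\<^esub> g) (\<psi> h e) = e"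
    using psi_inv[OF assms(1,3)] by simp
  then show "inv\<^bsub>\<Gamma>\<^esub> g \<otimes>\<^bsub>\<Gamma>\<^esub> h \<in> stabilizer \<Gamma> \<psi> e"
    using assms by (simp add: stabilizer_def psi_mult)
next
  assume s: "inv\<^bsub>\<Gamma>\<^esub> g \<otimes>\<^bsub>\<Gamma>\<^esub> h \<in> stabilizer \<Gamma> \<psi> e"
  have "\<psi> h e = \<psi> (g \<otimes>\<^bsub>\<Gamma>\<^esub> (inv\<^bsub>\<Gamma>\<^esub> g \<otimes>\<^bsub>\<Gamma>\<^esub> h)) e"
    using assms by (simp add: \<Gamma>.m_assoc[symmetric])
  also have "\<dots> = \<psi> g (\<psi> (inv\<^bsub>\<Gamma>\<^esub> g \<otimes>\<^bsub>\<Gamma>\<^esub> h) e)"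
    using assms by (intro psi_mult) auto
  finally show "\<psi> g e = \<psi> h e"
    using s by (simp add: stabilizer_def)
qed

lemma some_apath:
  assumes "g \<in> carrier \<Gamma>" "e \<in> arcs T"
  shows "apath (tail T e) (SOME p. apath (tail T e) p (\<phi> g (tail T e))) (\<phi> g (tail T e))"
  using ex_apath[of "tail T e" "\<phi> g (tail T e)"] assms by (auto intro: someI_ex)

lemma walk_code_carrier:
  assumes "g \<in> carrier \<Gamma>" "e \<in> arcs T"
  shows "fst ` set (walk_code e g) \<subseteq> carrier \<Gamma>"
proof
  let ?p = "SOME p. apath (tail T e) p (\<phi> g (tail T e))"
  have arcs: "set ?p \<subseteq> arcs T"
    using some_apath[OF assms] by (auto simp: apath_def)
  fix h assume "h \<in> fst ` set (walk_code e g)"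
  then obtain x f where x: "f \<in> set ?p" "x \<in> set (arc_code e f)" "h = fst x"
    unfolding walk_code_def by fastforce
  show "h \<in> carrier \<Gamma>"
    by (rule arc_code_cases[of f e]) (use x arcs in auto)
qed

text \<open>If the element were in the stabilizer, both letters would stem from the same translate
  of \<open>e\<close>, and the simple path would contain this arc together with its reverse.\<close>

lemma walk_code_reduced:
  assumes g: "g \<in> carrier \<Gamma>" and e: "e \<in> arcs T"
    and h: "(h, True) \<in> set (walk_code e g)" "(h', False) \<in> set (walk_code e g)"
  shows "inv\<^bsub>\<Gamma>\<^esub> h \<otimes>\<^bsub>\<Gamma>\<^esub> h' \<notin> stabilizer \<Gamma> \<psi> e"
proof
  assume c: "inv\<^bsub>\<Gamma>\<^esub> h \<otimes>\<^bsub>\<Gamma>\<^esub> h' \<in> stabilizer \<Gamma> \<psi> e"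
  let ?p = "SOME p. apath (tail T e) p (\<phi> g (tail T e))"
  have p: "apath (tail T e) ?p (\<phi> g (tail T e))"
    by (rule some_apath[OF g e])
  then have arcs: "set ?p \<subseteq> arcs T" by (auto simp: apath_def)
  obtain f f' where f: "f \<in> set ?p" "(h, True) \<in> set (arc_code e f)"
      "f' \<in> set ?p" "(h', False) \<in> set (arc_code e f')"
    using h by (auto simp: walk_code_def)
  have 1: "f = \<psi> h e"
    by (rule arc_code_cases[of f e]) (use f arcs in auto)
  have 2: "f' = rev (\<psi> h' e)"
    by (rule arc_code_cases[of f' e]) (use f arcs in auto)
  have "h \<in> carrier \<Gamma>" "h' \<in> carrier \<Gamma>"
    using walk_code_carrier[OF g e] h by force+
  then have "\<psi> h e = \<psi> h' e"
    using c psi_eq_iff e by blast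
  then show False
    using apath_no_backtrack[OF p f(1)] f(3) 1 2 by simp
qed

definition weight :: "('y, 'm) monoid_scheme \<Rightarrow> ('c \<Rightarrow> 'y) \<Rightarrow> 'y \<Rightarrow> 'b \<Rightarrow> 'b \<Rightarrow> 'y" where
  "weight B a w e f = mprod B (map (letter B a w) (arc_code e f))"

definition twist :: "('y, 'm) monoid_scheme \<Rightarrow> ('c \<Rightarrow> 'y) \<Rightarrow> 'y \<Rightarrow> 'b \<Rightarrow> 'c \<Rightarrow> 'y" where
  "twist B a w e g = mprod B (map (letter B a w) (walk_code e g)) \<otimes>\<^bsub>B\<^esub> a g"

section \<open>The twisted homomorphism and its values on vertex stabilizers\<close>

context
  fixes B :: "('y, 'm) monoid_scheme" and a :: "'c \<Rightarrow> 'y" and w :: 'y and e :: 'b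
  assumes B: "group B" and a: "a \<in> hom \<Gamma> B" and w: "w \<in> carrier B" and e: "e \<in> arcs T"
    and comm: "\<And>s. s \<in> stabilizer \<Gamma> \<psi> e \<Longrightarrow> a s \<otimes>\<^bsub>B\<^esub> w = w \<otimes>\<^bsub>B\<^esub> a s"
begin

interpretation B: group B by (rule B)
interpretation a: group_hom \<Gamma> B a
  by unfold_locales (rule a)

lemma letter_closed [simp]: "fst x \<in> carrier \<Gamma> \<Longrightarrow> letter B a w x \<in> carrier B"
  using w by (auto simp: letter_def)

text \<open>Two representatives of an arc differ by an element of the stabilizer of
  \<open>e\<close>, whose image under \<open>a\<close> commutes with \<open>w\<close> and with its
  inverse.\<close>

lemma letter_cong:
  assumes "g \<in> carrier \<Gamma>" "h \<in> carrier \<Gamma>" "\<psi> g e = \<psi> h e"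
  shows "letter B a w (g, b) = letter B a w (h, b)"
proof -
  define s x where "s = inv\<^bsub>\<Gamma>\<^esub> g \<otimes>\<^bsub>\<Gamma>\<^esub> h" and "x = (if b then w else inv\<^bsub>B\<^esub> w)"
  have s: "s \<in> carrier \<Gamma>" "s \<in> stabilizer \<Gamma> \<psi> e" "h = g \<otimes>\<^bsub>\<Gamma>\<^esub> s"
    using assms psi_eq_iff e by (auto simp: s_def \<Gamma>.m_assoc[symmetric])
  have x: "x \<in> carrier B" using w by (auto simp: x_def)
  have "a s \<otimes>\<^bsub>B\<^esub> w = w \<otimes>\<^bsub>B\<^esub> a s" using comm s by blast
  moreover have "a s \<otimes>\<^bsub>B\<^esub> inv\<^bsub>B\<^esub> w = inv\<^bsub>B\<^esub> w \<otimes>\<^bsub>B\<^esub> a s" if "a s \<otimes>\<^bsub>B\<^esub> w = w \<otimes>\<^bsub>B\<^esub> a s"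
  proof -
    have "inv\<^bsub>B\<^esub> w \<otimes>\<^bsub>B\<^esub> (a s \<otimes>\<^bsub>B\<^esub> w) \<otimes>\<^bsub>B\<^esub> inv\<^bsub>B\<^esub> w = a s \<otimes>\<^bsub>B\<^esub> inv\<^bsub>B\<^esub> w"
      unfolding that using w s by (simp add: B.m_assoc[symmetric])
    then show ?thesis using w s by (simp add: B.m_assoc)
  qed
  ultimately have "a s \<otimes>\<^bsub>B\<^esub> x = x \<otimes>\<^bsub>B\<^esub> a s"
    by (simp add: x_def)
  then have "a s \<otimes>\<^bsub>B\<^esub> x \<otimes>\<^bsub>B\<^esub> inv\<^bsub>B\<^esub> (a s) = x"
    using x s by (simp add: B.m_assoc)
  moreover have "a h \<otimes>\<^bsub>B\<^esub> x \<otimes>\<^bsub>B\<^esub> inv\<^bsub>B\<^esub> (a h) =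
      a g \<otimes>\<^bsub>B\<^esub> (a s \<otimes>\<^bsub>B\<^esub> x \<otimes>\<^bsub>B\<^esub> inv\<^bsub>B\<^esub> (a s)) \<otimes>\<^bsub>B\<^esub> inv\<^bsub>B\<^esub> (a g)"
    using s x assms(1) by (simp add: B.inv_mult_group B.m_assoc)
  ultimately have "a h \<otimes>\<^bsub>B\<^esub> x \<otimes>\<^bsub>B\<^esub> inv\<^bsub>B\<^esub> (a h) = a g \<otimes>\<^bsub>B\<^esub> x \<otimes>\<^bsub>B\<^esub> inv\<^bsub>B\<^esub> (a g)"
    by simp
  then show ?thesis by (simp add: letter_def x_def)
qed

lemma letter_mult:
  assumes "g \<in> carrier \<Gamma>" "h \<in> carrier \<Gamma>"
  shows "letter B a w (g \<otimes>\<^bsub>\<Gamma>\<^esub> h, b) = a g \<otimes>\<^bsub>B\<^esub> letter B a w (h, b) \<otimes>\<^bsub>B\<^esub> inv\<^bsub>B\<^esub> (a g)"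
  using assms w by (simp add: letter_def B.inv_mult_group B.m_assoc)

lemma letter_False: "g \<in> carrier \<Gamma> \<Longrightarrow> letter B a w (g, False) = inv\<^bsub>B\<^esub> letter B a w (g, True)"
  using w by (simp add: letter_def B.inv_mult_group B.m_assoc)

lemma weight_pos:
  assumes "g \<in> carrier \<Gamma>"
  shows "weight B a w e (\<psi> g e) = letter B a w (g, True)"
proof -
  have f: "\<psi> g e \<in> arcs T" using e assms by simp
  show ?thesis
  proof (rule arc_code_cases[OF f, of e])
    fix h assume "h \<in> carrier \<Gamma>" "\<psi> g e = \<psi> h e" "arc_code e (\<psi> g e) = [(h, True)]"
    then show ?thesis using letter_cong[of g h] assms by (simp add: weight_def)
  qed (use assms in auto)
qed

lemma weight_neg:
  assumes "g \<in> carrier \<Gamma>"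
  shows "weight B a w e (rev (\<psi> g e)) = letter B a w (g, False)"
proof -
  have f: "rev (\<psi> g e) \<in> arcs T" using e assms by simp
  show ?thesis
  proof (rule arc_code_cases[OF f, of e])
    fix h assume "h \<in> carrier \<Gamma>" "rev (\<psi> g e) = \<psi> h e"
    then show ?thesis using psi_ne_rev_psi[of h g e] assms e by simp
  next
    fix h assume "h \<in> carrier \<Gamma>" "rev (\<psi> g e) = rev (\<psi> h e)"
      "arc_code e (rev (\<psi> g e)) = [(h, False)]"
    then show ?thesis using letter_cong[of g h] assms by (simp add: weight_def arev_eq_iff)
  qed (use assms in auto)
qed

lemma weight_other:
  assumes "f \<in> arcs T" "\<not> (\<exists>g\<in>carrier \<Gamma>. f = \<psi> g e)" "\<not> (\<exists>g\<in>carrier \<Gamma>. f = rev (\<psi> g e))"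
  shows "weight B a w e f = \<one>\<^bsub>B\<^esub>"
  by (rule arc_code_cases[OF assms(1), of e]) (use assms(2,3) in \<open>auto simp: weight_def\<close>)

lemma weight_closed: "f \<in> arcs T \<Longrightarrow> weight B a w e f \<in> carrier B"
  by (rule arc_code_cases[of f e]) (auto simp: weight_def)

lemma weight_rev:
  assumes "f \<in> arcs T"
  shows "weight B a w e (rev f) = inv\<^bsub>B\<^esub> weight B a w e f"
proof -
  consider g where "g \<in> carrier \<Gamma>" "f = \<psi> g e" | g where "g \<in> carrier \<Gamma>" "f = rev (\<psi> g e)"
    | "\<not> (\<exists>g\<in>carrier \<Gamma>. f = \<psi> g e)" "\<not> (\<exists>g\<in>carrier \<Gamma>. f = rev (\<psi> g e))"
    by blast
  then show ?thesis
  proof cases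
    case 1
    then show ?thesis by (simp add: weight_pos weight_neg letter_False)
  next
    case 2
    then show ?thesis by (simp add: weight_pos weight_neg letter_False)
  next
    case 3
    then have "weight B a w e (rev f) = \<one>\<^bsub>B\<^esub>"
      using assms by (intro weight_other) (auto simp: arev_eq_iff dest: arg_cong[of _ _ rev])
    then show ?thesis using weight_other[OF assms] 3 by simp
  qed
qed

text \<open>On the orbits of \<open>e\<close> and of its reverse this is \<open>letter_mult\<close>.
  The other arcs form an invariant set, and their weight \<one> is unchanged by conjugation.\<close>

lemma weight_act:
  assumes "f \<in> arcs T" and g: "g \<in> carrier \<Gamma>"
  shows "weight B a w e (\<psi> g f) = a g \<otimes>\<^bsub>B\<^esub> weight B a w e f \<otimes>\<^bsub>B\<^esub> inv\<^bsub>B\<^esub> (a g)"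
proof -
  consider h where "h \<in> carrier \<Gamma>" "f = \<psi> h e" | h where "h \<in> carrier \<Gamma>" "f = rev (\<psi> h e)"
    | "\<not> (\<exists>g\<in>carrier \<Gamma>. f = \<psi> g e)" "\<not> (\<exists>g\<in>carrier \<Gamma>. f = rev (\<psi> g e))"
    by blast
  then show ?thesis
  proof cases
    case 1
    then show ?thesis
      using letter_mult[OF g 1(1)] e g by (simp add: weight_pos psi_mult[symmetric])
  next
    case 2
    then show ?thesis
      using letter_mult[OF g 2(1)] e g by (simp add: weight_neg act_rev psi_mult[symmetric])
  next
    case 3
    have "\<psi> g f \<noteq> \<psi> h e" if "h \<in> carrier \<Gamma>" for h
    proof
      assume "\<psi> g f = \<psi> h e"
      then have "f = \<psi> (inv\<^bsub>\<Gamma>\<^esub> g \<otimes>\<^bsub>\<Gamma>\<^esub> h) e"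
        using assms that e by (metis psi_inv psi_mult \<Gamma>.inv_closed)
      then show False using 3 that g by blast
    qed
    moreover have "\<psi> g f \<noteq> rev (\<psi> h e)" if "h \<in> carrier \<Gamma>" for h
    proof
      assume "\<psi> g f = rev (\<psi> h e)"
      then have "f = rev (\<psi> (inv\<^bsub>\<Gamma>\<^esub> g \<otimes>\<^bsub>\<Gamma>\<^esub> h) e)"
        using assms that e by (metis psi_inv psi_mult psi_closed act_rev \<Gamma>.inv_closed)
      then show False using 3 that g by blast
    qed
    ultimately have "weight B a w e (\<psi> g f) = \<one>\<^bsub>B\<^esub>"
      using assms by (intro weight_other) auto
    then show ?thesis using weight_other[OF assms(1)] 3 g by simp
  qed
qed

lemma weight_walk_act:
  assumes "g \<in> carrier \<Gamma>"
  shows "awalk u p v \<Longrightarrow>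
    mprod B (map (weight B a w e) (map (\<psi> g) p)) = a g \<otimes>\<^bsub>B\<^esub> mprod B (map (weight B a w e) p) \<otimes>\<^bsub>B\<^esub> inv\<^bsub>B\<^esub> (a g)"
proof (induction p arbitrary: u)
  case Nil
  then show ?case using assms by simp
next
  case (Cons f p)
  then have f: "f \<in> arcs T" and p: "awalk (head T f) p v" by (auto simp: awalk_Cons_iff)
  have "mprod B (map (weight B a w e) p) \<in> carrier B"
    using walk_prod_closed[where B=B and W="weight B a w e", OF B weight_closed weight_rev p] .
  then show ?case
    using Cons.IH[OF p] weight_act[OF f assms] assms weight_closed[OF f]
    by (simp add: B.m_assoc) (simp add: B.m_assoc[symmetric])
qed

text \<open>Passes from the simple path chosen in \<open>walk_code\<close> to an arbitrary walk, by
  \<open>walk_prod_unique\<close>.\<close>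

lemma twist_eq:
  assumes g: "g \<in> carrier \<Gamma>" and p: "awalk (tail T e) p (\<phi> g (tail T e))"
  shows "twist B a w e g = mprod B (map (weight B a w e) p) \<otimes>\<^bsub>B\<^esub> a g"
proof -
  let ?p = "SOME p. apath (tail T e) p (\<phi> g (tail T e))"
  have p': "awalk (tail T e) ?p (\<phi> g (tail T e))"
    using some_apath[OF g e] by (simp add: apath_def)
  have "mprod B (map (letter B a w) (concat (map (arc_code e) q))) = mprod B (map (weight B a w e) q)"
    if "set q \<subseteq> arcs T" for q
    using that
  proof (induction q)
    case (Cons f q)
    have *: "set (map (letter B a w) (arc_code e f)) \<subseteq> carrier B" if "f \<in> arcs T" for f
      by (rule arc_code_cases[OF that, of e]) auto
    have "set (map (letter B a w) (concat (map (arc_code e) q))) \<subseteq> carrier B"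
      using Cons.prems * by fastforce
    then show ?case
      using Cons * by (simp add: B.mprod_append weight_def)
  qed simp
  from this[of ?p] p' have "mprod B (map (letter B a w) (walk_code e g)) = mprod B (map (weight B a w e) ?p)"
    unfolding walk_code_def by blast
  also have "\<dots> = mprod B (map (weight B a w e) p)"
    by (rule walk_prod_unique[where B=B and W="weight B a w e", OF B weight_closed weight_rev p' p])
  finally show ?thesis by (simp add: twist_def)
qed

text \<open>A walk for \<open>g\<close> followed by the \<open>g\<close>-translate of a walk for
  \<open>h\<close> is a walk for the product. The translate contributes the conjugate by
  \<open>a g\<close>, so the walk products form a cocycle, and multiplication by \<open>a\<close>
  turns the cocycle into a homomorphism.\<close>

lemma twist_hom: "twist B a w e \<in> hom \<Gamma> B"
proof (rule homI)
  fix g assume g: "g \<in> carrier \<Gamma>"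
  then obtain p where p: "awalk (tail T e) p (\<phi> g (tail T e))"
    using some_apath e by (auto simp: apath_def)
  then show "twist B a w e g \<in> carrier B"
    using twist_eq[OF g p] g walk_prod_closed[where B=B and W="weight B a w e", OF B weight_closed weight_rev p] by simp
next
  fix g h assume g: "g \<in> carrier \<Gamma>" and h: "h \<in> carrier \<Gamma>"
  obtain p q where p: "awalk (tail T e) p (\<phi> g (tail T e))" and q: "awalk (tail T e) q (\<phi> h (tail T e))"
    using some_apath g h e by (meson apath_def)
  have gq: "awalk (\<phi> g (tail T e)) (map (\<psi> g) q) (\<phi> (g \<otimes>\<^bsub>\<Gamma>\<^esub> h) (tail T e))"
    using awalk_act[OF g q] g h e by (simp add: phi_mult)
  have "awalk (tail T e) (p @ map (\<psi> g) q) (\<phi> (g \<otimes>\<^bsub>\<Gamma>\<^esub> h) (tail T e))"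
    by (rule awalk_appendI[OF p gq])
  then have "twist B a w e (g \<otimes>\<^bsub>\<Gamma>\<^esub> h) = mprod B (map (weight B a w e) (p @ map (\<psi> g) q)) \<otimes>\<^bsub>B\<^esub> a (g \<otimes>\<^bsub>\<Gamma>\<^esub> h)"
    using g h by (intro twist_eq) auto
  also have "mprod B (map (weight B a w e) (p @ map (\<psi> g) q)) =
      mprod B (map (weight B a w e) p) \<otimes>\<^bsub>B\<^esub> (a g \<otimes>\<^bsub>B\<^esub> mprod B (map (weight B a w e) q) \<otimes>\<^bsub>B\<^esub> inv\<^bsub>B\<^esub> (a g))"
    by (simp only: walk_prod_append[where B=B and W="weight B a w e", OF B weight_closed weight_rev p gq] weight_walk_act[OF g q])
  also have "\<dots> \<otimes>\<^bsub>B\<^esub> a (g \<otimes>\<^bsub>\<Gamma>\<^esub> h) =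
      mprod B (map (weight B a w e) p) \<otimes>\<^bsub>B\<^esub> a g \<otimes>\<^bsub>B\<^esub> (mprod B (map (weight B a w e) q) \<otimes>\<^bsub>B\<^esub> a h)"
    using g h walk_prod_closed[where B=B and W="weight B a w e", OF B weight_closed weight_rev p]
      walk_prod_closed[where B=B and W="weight B a w e", OF B weight_closed weight_rev q]
    by (simp add: B.m_assoc) (simp add: B.m_assoc[symmetric])
  finally show "twist B a w e (g \<otimes>\<^bsub>\<Gamma>\<^esub> h) = twist B a w e g \<otimes>\<^bsub>B\<^esub> twist B a w e h"
    using twist_eq[OF g p] twist_eq[OF h q] by simp
qed

text \<open>The empty walk serves.\<close>

lemma twist_tail:
  assumes "g \<in> stabilizer \<Gamma> \<phi> (tail T e)"
  shows "twist B a w e g = a g"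
proof -
  have "g \<in> carrier \<Gamma>" "\<phi> g (tail T e) = tail T e" using assms by (auto simp: stabilizer_def)
  then show ?thesis using twist_eq[of g "[]"] e by (simp add: awalk_Nil_iff)
qed

lemma twist_head:
  assumes "g \<in> stabilizer \<Gamma> \<phi> (head T e)"
  shows "twist B a w e g = w \<otimes>\<^bsub>B\<^esub> a g \<otimes>\<^bsub>B\<^esub> inv\<^bsub>B\<^esub> w"
proof -
  have g: "g \<in> carrier \<Gamma>" "\<phi> g (head T e) = head T e" using assms by (auto simp: stabilizer_def)
  \<comment> \<open>The walk crosses \<open>e\<close> and returns along the translate of
    \<open>e\<close>, which has the same head since \<open>g\<close> fixes it. The weights are
    \<open>w\<close> and the conjugate of its inverse by \<open>a g\<close>.\<close>
  have "awalk (tail T e) [e, rev (\<psi> g e)] (\<phi> g (tail T e))"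
    using g e by (simp add: awalk_simps act_tail act_head)
  then have "twist B a w e g = weight B a w e e \<otimes>\<^bsub>B\<^esub> (weight B a w e (rev (\<psi> g e)) \<otimes>\<^bsub>B\<^esub> \<one>\<^bsub>B\<^esub>) \<otimes>\<^bsub>B\<^esub> a g"
    using twist_eq[OF g(1)] by simp
  moreover have "weight B a w e e = w"
    using weight_pos[of "\<one>\<^bsub>\<Gamma>\<^esub>"] e w by (simp add: letter_def)
  ultimately show ?thesis
    using g w by (simp add: weight_neg letter_def B.m_assoc)
qed

end

end

section \<open>Uniqueness of the Urysohn space and conclusion\<close>

text \<open>The one-point form of the extension property, in the manner of Katetov: \<open>f\<close>
  lists the distances to a point to be added. Positivity excludes the points of \<open>F\<close>
  themselves, and the case of empty \<open>F\<close> says that \<open>X\<close> is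
  inhabited.\<close>

definition one_point_property :: "real set \<Rightarrow> 'a set \<Rightarrow> ('a \<Rightarrow> 'a \<Rightarrow> real) \<Rightarrow> bool" where
  "one_point_property S X d \<longleftrightarrow> (\<forall>F f. finite F \<and> F \<subseteq> X \<and> (\<forall>a\<in>F. f a \<in> S \<and> f a > 0) \<and>
     (\<forall>a\<in>F. \<forall>b\<in>F. f a \<le> d a b + f b \<and> d a b \<le> f a + f b) \<longrightarrow> (\<exists>y\<in>X. \<forall>a\<in>F. d y a = f a))"

lemma S_Urysohn_one_point_property:
  assumes U: "S_Urysohn_space S U d" and S: "0 \<in> S"
  shows "one_point_property S U d"
  unfolding one_point_property_def
proof (intro allI impI, elim conjE)
  fix F and f :: "'a \<Rightarrow> real"
  assume F: "finite F" "F \<subseteq> U" and f: "\<forall>a\<in>F. f a \<in> S \<and> f a > 0"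
    and kat: "\<forall>a\<in>F. \<forall>b\<in>F. f a \<le> d a b + f b \<and> d a b \<le> f a + f b"
  have M: "Metric_space U d" and dS: "\<And>x y. x \<in> U \<Longrightarrow> y \<in> U \<Longrightarrow> d x y \<in> S"
    using U by (auto simp: S_Urysohn_space_def S_metric_space_def)
  interpret Metric_space U d by (rule M)
  \<comment> \<open>\<open>None\<close> is the added point. The absolute values matter only off
    \<open>F\<close>: \<open>Metric_space\<close> demands nonnegativity for all arguments, whereas
    \<open>f\<close> is known to be positive on \<open>F\<close> alone.\<close>
  define e where "e x y = (case x of
      None \<Rightarrow> (case y of None \<Rightarrow> 0 | Some b \<Rightarrow> \<bar>f b\<bar>)
    | Some a \<Rightarrow> (case y of None \<Rightarrow> \<bar>f a\<bar> | Some b \<Rightarrow> d a b))" for x y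
  let ?Y = "insert None (Some ` F)"
  have FU: "a \<in> U" if "a \<in> F" for a using F that by blast
  have "Metric_space ?Y e"
  proof
    show "0 \<le> e x y" for x y by (auto simp: e_def split: option.splits)
    show "e x y = e y x" for x y by (auto simp: e_def commute split: option.splits)
    show "e x y = 0 \<longleftrightarrow> x = y" if "x \<in> ?Y" "y \<in> ?Y" for x y
      using that f FU by (auto simp: e_def)
    show "e x z \<le> e x y + e y z" if "x \<in> ?Y" "y \<in> ?Y" "z \<in> ?Y" for x y z
      using that
    proof (elim insertE imageE)
      fix a b assume "x = Some a" "y = None" "z = Some b" "a \<in> F" "b \<in> F"
      then show ?thesis using kat f by (fastforce simp: e_def)
    next
      fix a b assume *: "x = None" "y = Some a" "z = Some b" "a \<in> F" "b \<in> F"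
      then have "f b \<le> d b a + f a" "0 < f a" "0 < f b" using kat f by auto
      then show ?thesis using * commute[of a b] by (simp add: e_def)
    next
      fix a b assume *: "x = Some a" "y = Some b" "z = None" "a \<in> F" "b \<in> F"
      then have "f a \<le> d a b + f b" "0 < f a" "0 < f b" using kat f by auto
      then show ?thesis using * by (simp add: e_def)
    next
      fix a b c assume "x = Some a" "y = Some b" "z = Some c" "a \<in> F" "b \<in> F" "c \<in> F"
      then show ?thesis using triangle[of a b c] FU by (simp add: e_def)
    qed (auto simp: e_def)
  qed
  then have "S_metric_space S ?Y e"
    using f dS FU S by (auto simp: S_metric_space_def e_def)
  moreover have "isometric_embedding (Some ` F) e U d the"
    using FU by (auto simp: isometric_embedding_def e_def)
  ultimately obtain g where g: "isometric_embedding ?Y e U d g" "\<forall>x\<in>Some ` F. g x = the x"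
    using S_Urysohn_space_extension[OF U, of ?Y e "Some ` F" the] F by auto
  show "\<exists>y\<in>U. \<forall>a\<in>F. d y a = f a"
  proof (intro bexI[of _ "g None"] ballI)
    fix a assume a: "a \<in> F"
    have "d (g None) (g (Some a)) = e None (Some a)"
      using g(1) a by (simp add: isometric_embedding_def)
    moreover have "f a > 0" using f a by blast
    ultimately show "d (g None) a = f a" using g(2) a by (simp add: e_def)
  next
    show "g None \<in> U" using g(1) by (auto simp: isometric_embedding_def)
  qed
qed

text \<open>The distances from \<open>x\<close>, carried along \<open>p\<close>, satisfy the
  one-point conditions on the range of \<open>p\<close>; a point realizing them can be paired with
  \<open>x\<close>.\<close>

lemma extend_partial_isometry:
  assumes X: "Metric_space X dX" "\<And>x y. x \<in> X \<Longrightarrow> y \<in> X \<Longrightarrow> dX x y \<in> S"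
    and Y: "Metric_space Y dY" "one_point_property S Y dY"
    and p: "finite p" "p \<subseteq> X \<times> Y" "\<And>a b a' b'. (a, b) \<in> p \<Longrightarrow> (a', b') \<in> p \<Longrightarrow> dX a a' = dY b b'"
    and x: "x \<in> X" "x \<notin> Domain p"
  shows "\<exists>y\<in>Y. \<forall>(a, b)\<in>p. dX x a = dY y b"
proof -
  interpret X: Metric_space X dX by (rule X)
  interpret Y: Metric_space Y dY by (rule Y)
  define pre where "pre b = (SOME a. (a, b) \<in> p)" for b
  have pre: "(pre b, b) \<in> p" if "b \<in> Range p" for b
    using that unfolding pre_def by (metis Range.cases someI_ex)
  have pre_X: "pre b \<in> X" if "b \<in> Range p" for b using pre[OF that] p by blast
  have pre_eq: "pre b = a" if ab: "(a, b) \<in> p" for a b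
  proof -
    have b: "b \<in> Range p" using ab by blast
    have "dX (pre b) a = dY b b" using p(3)[OF pre[OF b] ab] .
    also have "\<dots> = 0" using ab p(2) by auto
    finally show ?thesis using pre_X[OF b] ab p(2) by auto
  qed
  have fin: "finite (Range p)" "Range p \<subseteq> Y" using p by (auto simp: finite_Range)
  have f1: "\<forall>b\<in>Range p. dX x (pre b) \<in> S \<and> 0 < dX x (pre b)"
  proof
    fix b assume b: "b \<in> Range p"
    have "x \<noteq> pre b" using pre[OF b] x by blast
    then show "dX x (pre b) \<in> S \<and> 0 < dX x (pre b)" using X(2) x pre_X[OF b] by simp
  qed
  have f2: "\<forall>b\<in>Range p. \<forall>c\<in>Range p. dX x (pre b) \<le> dY b c + dX x (pre c) \<and> dY b c \<le> dX x (pre b) + dX x (pre c)"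
  proof (intro ballI)
    fix b c assume b: "b \<in> Range p" and c: "c \<in> Range p"
    have "dY b c = dX (pre b) (pre c)" using p(3)[OF pre[OF b] pre[OF c]] by simp
    then show "dX x (pre b) \<le> dY b c + dX x (pre c) \<and> dY b c \<le> dX x (pre b) + dX x (pre c)"
      using X.triangle[OF x(1) pre_X[OF c] pre_X[OF b]] X.triangle[OF pre_X[OF b] x(1) pre_X[OF c]]
        X.commute[of "pre b" "pre c"] X.commute[of "pre b" x] by simp
  qed
  obtain y where "y \<in> Y" "\<forall>b\<in>Range p. dY y b = dX x (pre b)"
    using Y(2)[unfolded one_point_property_def, rule_format, of "Range p" "\<lambda>b. dX x (pre b)"] fin f1 f2 by blast
  moreover have "dX x a = dY y b" if "(a, b) \<in> p" for a b
    using calculation(2) pre_eq[OF that] that by (metis RangeI)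
  ultimately show ?thesis by blast
qed

text \<open>Back and forth, arranged as a chain of finite partial isometries that meets the sets
  putting a given point into the domain or the range. Partial isometries are kept as relations;
  being isometric makes them single-valued and injective.\<close>

lemma one_point_property_isometric:
  assumes X: "Metric_space X dX" "\<And>x y. x \<in> X \<Longrightarrow> y \<in> X \<Longrightarrow> dX x y \<in> S" "one_point_property S X dX" "countable X"
    and Y: "Metric_space Y dY" "\<And>x y. x \<in> Y \<Longrightarrow> y \<in> Y \<Longrightarrow> dY x y \<in> S" "one_point_property S Y dY" "countable Y"
  obtains \<theta> where "bij_betw \<theta> X Y" "\<And>x y. \<lbrakk>x \<in> X; y \<in> X\<rbrakk> \<Longrightarrow> dY (\<theta> x) (\<theta> y) = dX x y"
proof -
  interpret X: Metric_space X dX by (rule X)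
  interpret Y: Metric_space Y dY by (rule Y)
  define P where "P = {p. finite p \<and> p \<subseteq> X \<times> Y \<and> (\<forall>(a, b)\<in>p. \<forall>(a', b')\<in>p. dX a a' = dY b b')}"
  have dom: "\<exists>q\<in>P. p \<subseteq> q \<and> x \<in> Domain q" if p: "p \<in> P" and x: "x \<in> X" for p x
  proof (cases "x \<in> Domain p")
    case False
    obtain y where y: "y \<in> Y" "\<forall>(a, b)\<in>p. dX x a = dY y b"
      using extend_partial_isometry[OF X(1,2) Y(1,3), of p x] p x False unfolding P_def by blast
    have "\<forall>(a, b)\<in>p. dX a x = dY b y"
    proof safe
      fix a b assume "(a, b) \<in> p"
      then have "dX x a = dY y b" using y(2) by blast
      then show "dX a x = dY b y" by (simp add: X.commute[of a x] Y.commute[of b y])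
    qed
    then have "insert (x, y) p \<in> P" using p x y by (auto simp: P_def)
    then show ?thesis by blast
  qed (use p in blast)
  have ran: "\<exists>q\<in>P. p \<subseteq> q \<and> y \<in> Range q" if p: "p \<in> P" and y: "y \<in> Y" for p y
  proof (cases "y \<in> Range p")
    case False
    have *: "dY b b' = dX a a'" if "(a, b) \<in> p" "(a', b') \<in> p" for a b a' b'
      using p that unfolding P_def by fastforce
    have "\<exists>x\<in>X. \<forall>(a, b)\<in>p\<inverse>. dY y a = dX x b"
      by (rule extend_partial_isometry[OF Y(1,2) X(1,3)]) (use p y False * in \<open>auto simp: P_def\<close>)
    then obtain x where x0: "x \<in> X" "\<forall>(a, b)\<in>p\<inverse>. dY y a = dX x b" by blast
    have "\<forall>(a, b)\<in>p. dX x a = dY y b"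
    proof safe
      fix a b assume "(a, b) \<in> p"
      then show "dX x a = dY y b" using x0(2) by (metis (mono_tags, lifting) case_prodD converse.intros)
    qed
    note x = x0(1) this
    have "\<forall>(a, b)\<in>p. dX a x = dY b y"
    proof safe
      fix a b assume "(a, b) \<in> p"
      then have "dX x a = dY y b" using x(2) by blast
      then show "dX a x = dY b y" by (simp add: X.commute[of a x] Y.commute[of b y])
    qed
    then have "insert (x, y) p \<in> P" using p x y by (auto simp: P_def)
    then show ?thesis by blast
  qed (use p in blast)
  define \<D> where "\<D> = (\<lambda>x. {q. x \<in> Domain q}) ` X \<union> (\<lambda>y. {q. y \<in> Range q}) ` Y"
  have "countable \<D>" using X(4) Y(4) by (simp add: \<D>_def)
  moreover have "{} \<in> P" by (simp add: P_def)
  moreover have "\<exists>q\<in>P. p \<subseteq> q \<and> q \<in> E" if "E \<in> \<D>" "p \<in> P" for E p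
    using that dom ran by (auto simp: \<D>_def)
  ultimately obtain c where c: "\<And>k. c k \<in> P" "\<And>k. c k \<subseteq> c (Suc k)" "\<And>E. E \<in> \<D> \<Longrightarrow> \<exists>k. c k \<in> E"
    using generic_chain[of \<D> "{}" P "(\<subseteq>)"] by blast
  define \<rho> where "\<rho> = (\<Union>k. c k)"
  have mono: "c k \<subseteq> c l" if "k \<le> l" for k l
    using lift_Suc_mono_le[of c, OF c(2) that] .
  have \<rho>_iso: "dX a a' = dY b b'" if ab: "(a, b) \<in> \<rho>" "(a', b') \<in> \<rho>" for a b a' b'
  proof -
    obtain k l where "(a, b) \<in> c k" "(a', b') \<in> c l" using ab unfolding \<rho>_def by blast
    then have "(a, b) \<in> c (max k l)" "(a', b') \<in> c (max k l)"
      using mono[of k "max k l"] mono[of l "max k l"] by auto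
    then show ?thesis using c(1)[of "max k l"] unfolding P_def by blast
  qed
  have \<rho>_XY: "a \<in> X" "b \<in> Y" if "(a, b) \<in> \<rho>" for a b
    using that c(1) unfolding \<rho>_def P_def by blast+
  have \<rho>_inj: "a = a' \<longleftrightarrow> b = b'" if "(a, b) \<in> \<rho>" "(a', b') \<in> \<rho>" for a b a' b'
    using \<rho>_iso[OF that] \<rho>_XY that X.zero Y.zero by metis
  have \<rho>_dom: "\<exists>b. (a, b) \<in> \<rho>" if "a \<in> X" for a
  proof -
    have "{q. a \<in> Domain q} \<in> \<D>" using that by (simp add: \<D>_def)
    from c(3)[OF this] show ?thesis unfolding \<rho>_def by blast
  qed
  have \<rho>_ran: "\<exists>a. (a, b) \<in> \<rho>" if "b \<in> Y" for b
  proof -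
    have "{q. b \<in> Range q} \<in> \<D>" using that by (simp add: \<D>_def)
    from c(3)[OF this] show ?thesis unfolding \<rho>_def by blast
  qed
  define \<theta> where "\<theta> a = (THE b. (a, b) \<in> \<rho>)" for a
  have \<theta>: "\<theta> a = b" if "(a, b) \<in> \<rho>" for a b
    unfolding \<theta>_def using that \<rho>_inj by blast
  have \<theta>_\<rho>: "(a, \<theta> a) \<in> \<rho>" if "a \<in> X" for a
    using \<rho>_dom[OF that] \<theta> by metis
  show ?thesis
  proof (rule that)
    show "bij_betw \<theta> X Y"
    proof (rule bij_betwI')
      show "\<theta> x = \<theta> y \<longleftrightarrow> x = y" if "x \<in> X" "y \<in> X" for x y
        using \<rho>_inj[OF \<theta>_\<rho>[OF that(1)] \<theta>_\<rho>[OF that(2)]] by blast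
      show "\<theta> x \<in> Y" if "x \<in> X" for x using \<theta>_\<rho>[OF that] \<rho>_XY by blast
      show "\<exists>x\<in>X. y = \<theta> x" if "y \<in> Y" for y
        using \<rho>_ran[OF that] \<theta> \<rho>_XY by metis
    qed
    show "dY (\<theta> x) (\<theta> y) = dX x y" if "x \<in> X" "y \<in> X" for x y
      using \<rho>_iso[OF \<theta>_\<rho>[OF that(1)] \<theta>_\<rho>[OF that(2)]] by simp
  qed
qed

text \<open>Conjugation with \<theta> carries over the action, its faithfulness and its
  homogeneity.\<close>

lemma in_class_H_isometric:
  assumes X: "in_class_H \<Gamma> X dX" and \<theta>: "bij_betw \<theta> X Y"
    and iso: "\<And>x y. \<lbrakk>x \<in> X; y \<in> X\<rbrakk> \<Longrightarrow> dY (\<theta> x) (\<theta> y) = dX x y"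
  shows "in_class_H \<Gamma> Y dY"
proof -
  obtain \<alpha> where \<Gamma>: "group \<Gamma>" "countable (carrier \<Gamma>)" and f: "faithful_action \<Gamma> X \<alpha>"
      and h: "homogeneous_isometric_action \<Gamma> X dX \<alpha>"
    using X by (auto simp: in_class_H_def)
  interpret faithful_action \<Gamma> X \<alpha> by (rule f)
  define \<eta> where "\<eta> = inv_into X \<theta>"
  \<comment> \<open>Members of \<open>BijGroup\<close> are extensional, hence the restriction to
    \<open>Y\<close>.\<close>
  define \<beta> where "\<beta> g = (\<lambda>y\<in>Y. \<theta> (\<alpha> g (\<eta> y)))" for g
  have \<eta>\<theta> [simp]: "\<eta> (\<theta> x) = x" if "x \<in> X" for x
    using that \<theta> by (simp add: \<eta>_def bij_betw_def)
  have \<theta>\<eta> [simp]: "\<theta> (\<eta> y) = y" if "y \<in> Y" for y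
    using that \<theta> by (simp add: \<eta>_def bij_betw_inv_into_right)
  have \<theta>Y [simp]: "\<theta> x \<in> Y" if "x \<in> X" for x using that \<theta> by (auto simp: bij_betw_def)
  have \<eta>: "bij_betw \<eta> Y X" unfolding \<eta>_def by (rule bij_betw_inv_into[OF \<theta>])
  have \<eta>X [simp]: "\<eta> y \<in> X" if "y \<in> Y" for y using that \<eta> by (auto simp: bij_betw_def)
  have \<eta>_iso: "dX (\<eta> x) (\<eta> y) = dY x y" if "x \<in> Y" "y \<in> Y" for x y
    using iso[of "\<eta> x" "\<eta> y"] that by simp
  have \<alpha>X [simp]: "\<alpha> g x \<in> X" if "g \<in> carrier \<Gamma>" "x \<in> X" for g x
    using element_image that by blast
  have \<beta>_Bij: "\<beta> g \<in> Bij Y" if "g \<in> carrier \<Gamma>" for g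
  proof -
    have "bij_betw (\<alpha> g) X X" using bij_prop0[OF that] by (simp add: Bij_def)
    then have "bij_betw (\<theta> \<circ> (\<alpha> g \<circ> \<eta>)) Y Y"
      using \<eta> \<theta> by (blast intro: bij_betw_trans)
    then have "bij_betw (\<beta> g) Y Y"
      by (rule bij_betw_cong[THEN iffD1, rotated]) (simp add: \<beta>_def)
    then show ?thesis by (simp add: Bij_def \<beta>_def)
  qed
  have "\<beta> \<in> hom \<Gamma> (BijGroup Y)"
  proof (rule homI)
    show "\<beta> g \<in> carrier (BijGroup Y)" if "g \<in> carrier \<Gamma>" for g
      using \<beta>_Bij[OF that] by (simp add: BijGroup_def)
    show "\<beta> (g \<otimes>\<^bsub>\<Gamma>\<^esub> h) = \<beta> g \<otimes>\<^bsub>BijGroup Y\<^esub> \<beta> h" if "g \<in> carrier \<Gamma>" "h \<in> carrier \<Gamma>" for g h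
    proof -
      have "\<beta> (g \<otimes>\<^bsub>\<Gamma>\<^esub> h) = compose Y (\<beta> g) (\<beta> h)"
        using that by (auto simp: fun_eq_iff \<beta>_def compose_def composition_rule)
      then show ?thesis using \<beta>_Bij that by (simp add: BijGroup_def)
    qed
  qed
  then have \<beta>_action: "group_action \<Gamma> Y \<beta>"
    by (simp add: group_action_def group_hom_def group_hom_axioms_def group_BijGroup \<Gamma>)
  \<comment> \<open>\<beta> determines \<alpha>, which gives faithfulness. The equation holds as
    functions because \<open>\<alpha> g\<close> is itself extensional.\<close>
  have \<alpha>_\<beta>: "\<alpha> g = (\<lambda>x\<in>X. \<eta> (\<beta> g (\<theta> x)))" if "g \<in> carrier \<Gamma>" for g
    using bij_prop0[OF that] that by (auto simp: \<beta>_def Bij_def extensional_def fun_eq_iff)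
  have "inj_on \<beta> (carrier \<Gamma>)"
    by (rule inj_onI) (metis \<alpha>_\<beta> faithful inj_on_eq_iff)
  then have "faithful_action \<Gamma> Y \<beta>"
    using \<beta>_action by (simp add: faithful_action_def faithful_action_axioms_def)
  moreover have "homogeneous_isometric_action \<Gamma> Y dY \<beta>"
    unfolding homogeneous_isometric_action_def
  proof (intro conjI allI impI ballI)
    fix g assume g: "g \<in> carrier \<Gamma>"
    have "isometric_embedding X dX X dX (\<alpha> g)"
      using h g by (simp add: homogeneous_isometric_action_def)
    then show "isometric_embedding Y dY Y dY (\<beta> g)"
      using g by (auto simp: isometric_embedding_def \<beta>_def iso \<eta>_iso)
  next
    fix A B f assume a: "finite A \<and> A \<subseteq> Y \<and> B \<subseteq> Y \<and> isometric_embedding A dY B dY f \<and> f ` A = B"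
    have AY: "y \<in> Y" "f y \<in> Y" if "y \<in> A" for y using a that by auto
    have "isometric_embedding (\<eta> ` A) dX (\<eta> ` B) dX (\<lambda>x. \<eta> (f (\<theta> x)))"
      using a AY by (auto simp: isometric_embedding_def \<eta>_iso)
    moreover have "(\<lambda>x. \<eta> (f (\<theta> x))) ` \<eta> ` A = \<eta> ` B"
      using a AY by (force simp: image_image)
    moreover have "finite (\<eta> ` A)" "\<eta> ` A \<subseteq> X" "\<eta> ` B \<subseteq> X" using a by auto
    ultimately obtain g where g: "g \<in> carrier \<Gamma>" "\<forall>x\<in>\<eta> ` A. \<alpha> g x = \<eta> (f (\<theta> x))"
      using h unfolding homogeneous_isometric_action_def by blast
    then show "\<exists>\<gamma>\<in>carrier \<Gamma>. \<forall>x\<in>A. \<beta> \<gamma> x = f x"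
      using AY by (intro bexI[of _ g]) (auto simp: \<beta>_def)
  qed (rule \<beta>_action)
  ultimately show ?thesis using \<Gamma> by (auto simp: in_class_H_def)
qed

text \<open>High core-freeness is applied to the part of \<open>K\<close> inside \<open>X\<close>
  together with \<one>. Disjointness, at the element \<one>, keeps \<open>s \<gamma>\<close> out of
  \<open>K\<close>; injectivity keeps the conjugates out, since \<open>(s, \<one>)\<close> and
  \<open>(\<one>, \<gamma>\<^sup>-\<^sup>1 s \<gamma>)\<close> have the same image.\<close>

lemma highly_core_free_spread:
  assumes "group G" and X: "subgroup X G" and H: "highly_core_free H (G\<lparr>carrier := X\<rparr>)" and K: "finite K"
  shows "\<exists>\<gamma>\<in>X. \<forall>s\<in>H. s \<otimes>\<^bsub>G\<^esub> \<gamma> \<notin> K \<and> (s \<noteq> \<one>\<^bsub>G\<^esub> \<longrightarrow> inv\<^bsub>G\<^esub> \<gamma> \<otimes>\<^bsub>G\<^esub> s \<otimes>\<^bsub>G\<^esub> \<gamma> \<notin> K)"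
proof -
  interpret group G by fact
  define F where "F = insert \<one>\<^bsub>G\<^esub> (K \<inter> X)"
  have X1: "\<one>\<^bsub>G\<^esub> \<in> X" "\<And>x. x \<in> X \<Longrightarrow> x \<in> carrier G" "\<And>x y. x \<in> X \<Longrightarrow> y \<in> X \<Longrightarrow> x \<otimes>\<^bsub>G\<^esub> y \<in> X"
    "\<And>x. x \<in> X \<Longrightarrow> inv\<^bsub>G\<^esub> x \<in> X"
    using X by (auto simp: subgroup_def)
  have HX: "H \<subseteq> X" "\<one>\<^bsub>G\<^esub> \<in> H"
    using H by (auto simp: highly_core_free_def subgroup_def)
  have "finite F" "F \<subseteq> X" using K X1 by (auto simp: F_def)
  then obtain \<gamma> where \<gamma>: "\<gamma> \<in> X" "inj_on (\<lambda>(\<sigma>, f). \<sigma> \<otimes>\<^bsub>G\<^esub> \<gamma> \<otimes>\<^bsub>G\<^esub> f) (H \<times> F)"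
    "(\<lambda>(\<sigma>, f). \<sigma> \<otimes>\<^bsub>G\<^esub> \<gamma> \<otimes>\<^bsub>G\<^esub> f) ` (H \<times> F) \<inter> F = {}"
    using H unfolding highly_core_free_def by auto
  have 1: "s \<otimes>\<^bsub>G\<^esub> \<gamma> \<notin> K" if s: "s \<in> H" for s
  proof
    assume "s \<otimes>\<^bsub>G\<^esub> \<gamma> \<in> K"
    moreover have "s \<otimes>\<^bsub>G\<^esub> \<gamma> \<in> X" using s HX X1 \<gamma> by blast
    ultimately have "s \<otimes>\<^bsub>G\<^esub> \<gamma> \<in> F" by (simp add: F_def)
    moreover have "s \<otimes>\<^bsub>G\<^esub> \<gamma> \<in> (\<lambda>(\<sigma>, f). \<sigma> \<otimes>\<^bsub>G\<^esub> \<gamma> \<otimes>\<^bsub>G\<^esub> f) ` (H \<times> F)"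
      using s HX X1 \<gamma> by (intro image_eqI[of _ _ "(s, \<one>\<^bsub>G\<^esub>)"]) (auto simp: F_def subset_iff)
    ultimately show False using \<gamma>(3) by blast
  qed
  have 2: "inv\<^bsub>G\<^esub> \<gamma> \<otimes>\<^bsub>G\<^esub> s \<otimes>\<^bsub>G\<^esub> \<gamma> \<notin> K" if s: "s \<in> H" "s \<noteq> \<one>\<^bsub>G\<^esub>" for s
  proof
    let ?k = "inv\<^bsub>G\<^esub> \<gamma> \<otimes>\<^bsub>G\<^esub> s \<otimes>\<^bsub>G\<^esub> \<gamma>"
    assume "?k \<in> K"
    have sX: "s \<in> carrier G" "\<gamma> \<in> carrier G" "s \<in> X" using s HX X1 \<gamma> by auto
    then have "?k \<in> F" using \<open>?k \<in> K\<close> X1 \<gamma> by (simp add: F_def)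
    moreover have "s \<otimes>\<^bsub>G\<^esub> \<gamma> \<otimes>\<^bsub>G\<^esub> \<one>\<^bsub>G\<^esub> = \<one>\<^bsub>G\<^esub> \<otimes>\<^bsub>G\<^esub> \<gamma> \<otimes>\<^bsub>G\<^esub> ?k"
      using sX by (simp add: m_assoc) (simp add: m_assoc[symmetric])
    ultimately have "(s, \<one>\<^bsub>G\<^esub>) = (\<one>\<^bsub>G\<^esub>, ?k)"
      using s HX by (intro inj_onD[OF \<gamma>(2)]) (auto simp: F_def)
    then show False using s by simp
  qed
  show ?thesis using \<gamma>(1) 1 2 by blast
qed

section \<open>The twisted action on the limit space and its transfer to the given Urysohn
  space\<close>

theorem theorem1:
  fixes \<Gamma> :: "('g, 'x) monoid_scheme"
    and T :: "('v, 'e) pre_digraph" and rev :: "'e \<Rightarrow> 'e"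
    and \<phi> :: "'g \<Rightarrow> 'v \<Rightarrow> 'v" and \<psi> :: "'g \<Rightarrow> 'e \<Rightarrow> 'e"
    and S :: "real set" and U :: "'u set" and d :: "'u \<Rightarrow> 'u \<Rightarrow> real"
  assumes "group \<Gamma>" and "countable (carrier \<Gamma>)"
    and "tree_action_without_inversion T rev \<Gamma> \<phi> \<psi>"
    and "arcs T \<noteq> {}"
    and "\<And>e v. \<lbrakk>e \<in> arcs T; v \<in> {tail T e, head T e}\<rbrakk> \<Longrightarrow>
           highly_core_free (stabilizer \<Gamma> \<psi> e) (\<Gamma>\<lparr>carrier := stabilizer \<Gamma> \<phi> v\<rparr>)"
    and "bounded_distance_set S"
    and "S_Urysohn_space S U d"
  shows "in_class_H \<Gamma> U d"
proof -
  interpret tree_action_without_inversion T rev \<Gamma> \<phi> \<psi> by fact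
  obtain e where e: "e \<in> arcs T" using assms(4) by blast
  define H A B where "H = stabilizer \<Gamma> \<psi> e" and "A = stabilizer \<Gamma> \<phi> (tail T e)"
    and "B = stabilizer \<Gamma> \<phi> (head T e)"
  have sub: "subgroup H \<Gamma>" "subgroup A \<Gamma>" "subgroup B \<Gamma>"
    unfolding H_def A_def B_def using e V.stabilizer_subgroup E.stabilizer_subgroup by auto
  obtain M where M: "M \<in> S" "M > 0" "\<forall>s\<in>S. s \<le> M" "\<forall>s\<in>S. \<forall>t\<in>S. min (s + t) M \<in> S"
    using assms(6) by (auto simp: bounded_distance_set_def)
  have S: "countable S" "S \<subseteq> {0..}" "0 \<in> S"
    using assms(6) by (auto simp: bounded_distance_set_def)
  have spread: "\<exists>\<gamma>\<in>X. \<forall>s\<in>H. s \<otimes>\<^bsub>\<Gamma>\<^esub> \<gamma> \<notin> K \<and> (s \<noteq> \<one>\<^bsub>\<Gamma>\<^esub> \<longrightarrow> inv\<^bsub>\<Gamma>\<^esub> \<gamma> \<otimes>\<^bsub>\<Gamma>\<^esub> s \<otimes>\<^bsub>\<Gamma>\<^esub> \<gamma> \<notin> K)"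
    if X: "X \<in> {A, B}" and K: "finite K" for X K
  proof (rule highly_core_free_spread[OF assms(1) _ _ K])
    show "subgroup X \<Gamma>" using X sub by auto
    show "highly_core_free H (\<Gamma>\<lparr>carrier := X\<rparr>)"
      using X assms(5)[OF e, of "tail T e"] assms(5)[OF e, of "head T e"] by (auto simp: H_def A_def B_def)
  qed
  have "free_orbits \<Gamma> S M"
    by unfold_locales (use S M assms(2) in auto)
  then interpret F: twisting_data \<Gamma> S M H A B
    unfolding twisting_data_def twisting_data_axioms_def
    using sub spread subgroup.subset[OF sub(2)] subgroup.subset[OF sub(3)] by blast
  \<comment> \<open>The words come from the tree alone; \<open>walk_code_reduced\<close> is the
    condition on \<open>code\<close> that excludes cancellation.\<close>
  obtain D W where metric: "Metric_space F.points D"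
    and DS: "\<And>x y. \<lbrakk>x \<in> F.points; y \<in> F.points\<rbrakk> \<Longrightarrow> D x y \<in> S"
    and D_act: "\<And>g x y. \<lbrakk>g \<in> carrier \<Gamma>; x \<in> F.points; y \<in> F.points\<rbrakk> \<Longrightarrow> D (F.act g x) (F.act g y) = D x y"
    and kat: "\<And>F f. \<lbrakk>finite F; F \<subseteq> F.points; \<And>a. a \<in> F \<Longrightarrow> f a \<in> S \<and> f a > 0;
       \<And>a b. \<lbrakk>a \<in> F; b \<in> F\<rbrakk> \<Longrightarrow> f a \<le> D a b + f b \<and> D a b \<le> f a + f b\<rbrakk> \<Longrightarrow>
       \<exists>y\<in>F.points. \<forall>a\<in>F. D y a = f a"
    and W: "bij_betw W F.points F.points"
    and W_iso: "\<And>x y. \<lbrakk>x \<in> F.points; y \<in> F.points\<rbrakk> \<Longrightarrow> D (W x) (W y) = D x y"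
    and W_act: "\<And>s x. \<lbrakk>s \<in> H; x \<in> F.points\<rbrakk> \<Longrightarrow> W (F.act s x) = F.act s (W x)"
    and hom: "\<And>L. \<lbrakk>finite L; L \<subseteq> F.points \<times> F.points;
        \<And>p p'. \<lbrakk>p \<in> L; p' \<in> L\<rbrakk> \<Longrightarrow> D (fst p) (fst p') = D (snd p) (snd p')\<rbrakk> \<Longrightarrow>
        \<exists>g1\<in>A. \<exists>g2\<in>A. \<exists>h1\<in>B. \<exists>h2\<in>B. \<forall>p\<in>L. W (F.act h1 (fst p)) = F.act g1 (fst p) \<and>
           W (F.act h2 (fst p)) = F.act g2 (snd p)"
    and moved: "\<And>g. \<lbrakk>g \<in> carrier \<Gamma>; g \<noteq> \<one>\<^bsub>\<Gamma>\<^esub>\<rbrakk> \<Longrightarrow>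
        \<exists>x\<in>F.points. \<exists>z\<in>F.points. trace \<Gamma> {(x, W x) |x. x \<in> F.points} (walk_code e g) (F.act g x) z \<and> z \<noteq> x"
    by (rule F.generic_space[of "walk_code e"])
      (use walk_code_carrier walk_code_reduced e in \<open>simp_all add: H_def\<close>)
  let ?X = F.points
  let ?B = "BijGroup ?X"
  interpret B: group ?B by (rule group_BijGroup)
  have B_mult: "(f \<otimes>\<^bsub>?B\<^esub> g) x = f (g x)" if "f \<in> carrier ?B" "g \<in> carrier ?B" "x \<in> ?X" for f g x
    using that by (simp add: BijGroup_def compose_eq)
  have B_one: "\<one>\<^bsub>?B\<^esub> x = x" if "x \<in> ?X" for x
    using that by (simp add: BijGroup_def)
  have B_closed: "f x \<in> ?X" if "f \<in> carrier ?B" "x \<in> ?X" for f x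
    using that by (auto simp: BijGroup_def Bij_def bij_betw_def)
  have B_eqI: "f = g" if "f \<in> carrier ?B" "g \<in> carrier ?B" "\<And>x. x \<in> ?X \<Longrightarrow> f x = g x" for f g
    using that by (auto simp: BijGroup_def Bij_def intro: extensionalityI)
  have B_inv: "(inv\<^bsub>?B\<^esub> f) (f x) = x" if "f \<in> carrier ?B" "x \<in> ?X" for f x
    using B_mult[of "inv\<^bsub>?B\<^esub> f" f x] that B_one by simp
  \<comment> \<open>\<open>a\<close> is the free action by translations and \<open>w\<close> the
    generic isometry, both cut down to permutations in the sense of \<open>BijGroup\<close>.\<close>
  define a where "a g = restrict (F.act g) ?X" for g
  define w where "w = restrict W ?X"
  have act_act: "F.act g (F.act h x) = F.act (g \<otimes>\<^bsub>\<Gamma>\<^esub> h) x"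
    if "g \<in> carrier \<Gamma>" "h \<in> carrier \<Gamma>" "x \<in> ?X" for g h x
    using that by (auto simp: F.points_def F.act_def \<Gamma>.m_assoc)
  have act_one: "F.act \<one>\<^bsub>\<Gamma>\<^esub> x = x" if "x \<in> ?X" for x
    using that by (auto simp: F.points_def F.act_def)
  have a_closed: "a g \<in> carrier ?B" if g: "g \<in> carrier \<Gamma>" for g
  proof -
    have "bij_betw (F.act g) ?X ?X"
      by (rule bij_betw_byWitness[where f' = "F.act (inv\<^bsub>\<Gamma>\<^esub> g)"])
        (use g in \<open>auto simp del: F.act_pair simp: act_act act_one\<close>)
    then show ?thesis by (simp add: BijGroup_def Bij_def a_def)
  qed
  have a_hom: "a \<in> hom \<Gamma> ?B"
  proof (rule homI)
    fix g h assume gh: "g \<in> carrier \<Gamma>" "h \<in> carrier \<Gamma>"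
    show "a (g \<otimes>\<^bsub>\<Gamma>\<^esub> h) = a g \<otimes>\<^bsub>?B\<^esub> a h"
    proof (rule B_eqI)
      fix x assume x: "x \<in> ?X"
      have "(a g \<otimes>\<^bsub>?B\<^esub> a h) x = a g (a h x)" using B_mult a_closed gh x by blast
      then show "a (g \<otimes>\<^bsub>\<Gamma>\<^esub> h) x = (a g \<otimes>\<^bsub>?B\<^esub> a h) x"
        using gh x by (simp add: a_def act_act)
    qed (use gh a_closed in auto)
  qed (rule a_closed)
  have w_closed: "w \<in> carrier ?B"
    using W by (simp add: BijGroup_def Bij_def w_def)
  have comm: "a s \<otimes>\<^bsub>?B\<^esub> w = w \<otimes>\<^bsub>?B\<^esub> a s" if "s \<in> stabilizer \<Gamma> \<psi> e" for s
  proof (rule B_eqI)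
    have "s \<in> H" using that unfolding H_def .
    note s = this F.Hc[OF this]
    show "a s \<otimes>\<^bsub>?B\<^esub> w \<in> carrier ?B" "w \<otimes>\<^bsub>?B\<^esub> a s \<in> carrier ?B"
      by (rule B.m_closed[OF a_closed[OF s(2)] w_closed], rule B.m_closed[OF w_closed a_closed[OF s(2)]])
    fix x assume x: "x \<in> ?X"
    have "W x \<in> ?X" using bij_betwE[OF W] x by blast
    then show "(a s \<otimes>\<^bsub>?B\<^esub> w) x = (w \<otimes>\<^bsub>?B\<^esub> a s) x"
      using B_mult[OF a_closed[OF s(2)] w_closed x] B_mult[OF w_closed a_closed[OF s(2)] x] W_act[OF s(1) x] x s
      by (simp add: a_def w_def)
  qed
  note tw = group_BijGroup a_hom w_closed e comm
  let ?l = "letter ?B a w"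
  define \<alpha> where "\<alpha> = twist ?B a w e"
  have \<alpha>_hom: "\<alpha> \<in> hom \<Gamma> ?B"
    unfolding \<alpha>_def by (rule twist_hom[OF tw])
  interpret \<alpha>: group_hom \<Gamma> ?B \<alpha>
    by unfold_locales (rule \<alpha>_hom)
  interpret a: group_hom \<Gamma> ?B a
    by unfold_locales (rule a_hom)
  have a_apply: "a g x = F.act g x" if "x \<in> ?X" for g x using that by (simp add: a_def)
  have w_apply: "w x = W x" if "x \<in> ?X" for x using that by (simp add: w_def)
  have WX: "W x \<in> ?X" if "x \<in> ?X" for x using bij_betwE[OF W] that by blast
  have w_inv: "(inv\<^bsub>?B\<^esub> w) (W x) = x" if "x \<in> ?X" for x
    using B_inv[OF w_closed that] that by (simp add: w_def)
  have a_inv: "inv\<^bsub>?B\<^esub> (a g) = a (inv\<^bsub>\<Gamma>\<^esub> g)" if "g \<in> carrier \<Gamma>" for g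
    using that by simp
  have actX: "F.act g x \<in> ?X" if "g \<in> carrier \<Gamma>" "x \<in> ?X" for g x
    using that by (rule F.act_points)
  have l_closed: "?l c \<in> carrier ?B" if "fst c \<in> carrier \<Gamma>" for c
    using that w_closed by (simp add: letter_def)
  have l_apply: "?l c x = F.act (fst c) ((if snd c then w else inv\<^bsub>?B\<^esub> w) (F.act (inv\<^bsub>\<Gamma>\<^esub> (fst c)) x))"
    if c: "fst c \<in> carrier \<Gamma>" and x: "x \<in> ?X" for c x
  proof -
    define v where "v = (if snd c then w else inv\<^bsub>?B\<^esub> w)"
    have v: "v \<in> carrier ?B" using w_closed by (simp add: v_def)
    have x': "F.act (inv\<^bsub>\<Gamma>\<^esub> (fst c)) x \<in> ?X" using actX c x by blast
    have ic: "inv\<^bsub>\<Gamma>\<^esub> (fst c) \<in> carrier \<Gamma>" using c by simp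
    have "?l c = a (fst c) \<otimes>\<^bsub>?B\<^esub> v \<otimes>\<^bsub>?B\<^esub> a (inv\<^bsub>\<Gamma>\<^esub> (fst c))"
      unfolding letter_def v_def a_inv[OF c] ..
    then have "?l c x = (a (fst c) \<otimes>\<^bsub>?B\<^esub> v) (F.act (inv\<^bsub>\<Gamma>\<^esub> (fst c)) x)"
      using B_mult[OF B.m_closed[OF a_closed[OF c] v] a_closed[OF ic] x] a_apply[OF x] by metis
    also have "\<dots> = F.act (fst c) (v (F.act (inv\<^bsub>\<Gamma>\<^esub> (fst c)) x))"
      unfolding B_mult[OF a_closed[OF c] v x'] by (rule a_apply[OF B_closed[OF v x']])
    finally show ?thesis unfolding v_def .
  qed
  let ?\<rho> = "{(x, W x) |x. x \<in> ?X}"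
  \<comment> \<open>This and \<open>trace_l\<close> identify the relational words of the
    construction with products in \<open>BijGroup\<close>.\<close>
  have step_l: "?l c x = z" if st: "step \<Gamma> ?\<rho> c x z" and c: "fst c \<in> carrier \<Gamma>" for c x z
  proof -
    let ?t = "F.act (inv\<^bsub>\<Gamma>\<^esub> (fst c))"
    have xz: "x \<in> ?X" "z \<in> ?X" and r: "if snd c then (?t x, ?t z) \<in> ?\<rho> else (?t z, ?t x) \<in> ?\<rho>"
      using st by (simp_all add: step_def F.act_def F.points_def mem_Times_iff split: if_splits)
    have "(if snd c then w else inv\<^bsub>?B\<^esub> w) (?t x) = ?t z"
    proof (cases "snd c")
      case True
      then have "?t z = W (?t x)" "?t x \<in> ?X" using r by auto
      then show ?thesis using True by (simp add: w_apply)
    next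
      case False
      then have "?t x = W (?t z)" "?t z \<in> ?X" using r by auto
      then show ?thesis using False by (simp add: w_inv)
    qed
    then have "?l c x = F.act (fst c) (?t z)"
      using l_apply[OF c xz(1)] by simp
    also have "\<dots> = z" using act_act[of "fst c" "inv\<^bsub>\<Gamma>\<^esub> (fst c)" z] c xz act_one by simp
    finally show ?thesis .
  qed
  have step_X: "z \<in> ?X" if "step \<Gamma> \<rho> c x z" for \<rho> c x z
    using that by (simp add: step_def F.points_def mem_Times_iff Let_def)
  have l_prod: "mprod ?B (map ?l p) \<in> carrier ?B" if "fst ` set p \<subseteq> carrier \<Gamma>" for p
    using that l_closed by (intro B.mprod_closed) auto
  have trace_l: "mprod ?B (map ?l p) x = z \<and> z \<in> ?X"
    if "trace \<Gamma> ?\<rho> p x z" "x \<in> ?X" "fst ` set p \<subseteq> carrier \<Gamma>" for p x z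
    using that
  proof (induction p arbitrary: z)
    case Nil
    then show ?case using B_one by simp
  next
    case (Cons c p)
    then obtain y where y: "trace \<Gamma> ?\<rho> p x y" "step \<Gamma> ?\<rho> c y z"
      unfolding trace.simps by blast
    have c: "fst c \<in> carrier \<Gamma>" "fst ` set p \<subseteq> carrier \<Gamma>" using Cons.prems(3) by simp_all
    have "mprod ?B (map ?l (c # p)) x = ?l c (mprod ?B (map ?l p) x)"
      using B_mult[OF l_closed[OF c(1)] l_prod[OF c(2)] Cons.prems(2)] by simp
    also have "mprod ?B (map ?l p) x = y"
      using Cons.IH[OF y(1) Cons.prems(2) c(2)] by blast
    finally show ?case
      using step_l[OF y(2) c(1)] step_X[OF y(2)] by blast
  qed
  have code_c: "fst ` set (walk_code e g) \<subseteq> carrier \<Gamma>" if "g \<in> carrier \<Gamma>" for g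
    using walk_code_carrier[OF that e] .
  have \<alpha>_apply: "\<alpha> g x = mprod ?B (map ?l (walk_code e g)) (F.act g x)" if g: "g \<in> carrier \<Gamma>" and x: "x \<in> ?X" for g x
    using B_mult[OF l_prod[OF code_c[OF g]] a_closed[OF g] x] x by (simp add: \<alpha>_def twist_def a_apply)
  \<comment> \<open>The value of \<open>\<alpha> g\<close> at \<open>x\<close> is the end of the
    trace of \<open>walk_code e g\<close> from the translate of \<open>x\<close>, and the limit was
    built to contain such a trace that does not end at \<open>x\<close>.\<close>
  have \<alpha>_moves: "\<exists>x\<in>?X. \<alpha> g x \<noteq> x" if g: "g \<in> carrier \<Gamma>" "g \<noteq> \<one>\<^bsub>\<Gamma>\<^esub>" for g
  proof -
    obtain x z where xz: "x \<in> ?X" "trace \<Gamma> ?\<rho> (walk_code e g) (F.act g x) z" "z \<noteq> x"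
      using moved[OF g] by blast
    then have "\<alpha> g x = z"
      using \<alpha>_apply[OF g(1) xz(1)] trace_l[OF xz(2) actX[OF g(1) xz(1)] code_c[OF g(1)]] by simp
    then show ?thesis using xz by blast
  qed
  have faithful: "faithful_action \<Gamma> ?X \<alpha>"
  proof -
    have "inj_on \<alpha> (carrier \<Gamma>)"
    proof (rule inj_onI)
      fix g h assume gh: "g \<in> carrier \<Gamma>" "h \<in> carrier \<Gamma>" "\<alpha> g = \<alpha> h"
      then have "\<alpha> (inv\<^bsub>\<Gamma>\<^esub> g \<otimes>\<^bsub>\<Gamma>\<^esub> h) = \<one>\<^bsub>?B\<^esub>"
        by (simp add: \<alpha>.hom_mult \<alpha>.hom_inv)
      then have "inv\<^bsub>\<Gamma>\<^esub> g \<otimes>\<^bsub>\<Gamma>\<^esub> h = \<one>\<^bsub>\<Gamma>\<^esub>"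
        using \<alpha>_moves[of "inv\<^bsub>\<Gamma>\<^esub> g \<otimes>\<^bsub>\<Gamma>\<^esub> h"] B_one gh by fastforce
      then show "g = h" using gh by (metis \<Gamma>.inv_equality \<Gamma>.inv_inv \<Gamma>.inv_closed)
    qed
    then show ?thesis
      by (simp add: faithful_action_def faithful_action_axioms_def group_action_def \<alpha>.group_hom_axioms)
  qed
  \<comment> \<open>The isometric permutations are closed under products and inverses and contain
    \<open>w\<close> and all \<open>a g\<close>, hence all products of letters and the whole image
    of \<alpha>.\<close>
  define I where "I = {f \<in> carrier ?B. \<forall>x\<in>?X. \<forall>y\<in>?X. D (f x) (f y) = D x y}"
  have I_mult: "f \<otimes>\<^bsub>?B\<^esub> g \<in> I" if fg: "f \<in> I" "g \<in> I" for f g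
  proof -
    have c: "f \<in> carrier ?B" "g \<in> carrier ?B" using fg by (auto simp: I_def)
    have "D ((f \<otimes>\<^bsub>?B\<^esub> g) x) ((f \<otimes>\<^bsub>?B\<^esub> g) y) = D x y" if "x \<in> ?X" "y \<in> ?X" for x y
      using B_mult[OF c] B_closed[OF c(2)] that fg unfolding I_def by simp
    then show ?thesis using c unfolding I_def by simp
  qed
  have I_inv: "inv\<^bsub>?B\<^esub> f \<in> I" if f: "f \<in> I" for f
  proof -
    have c: "f \<in> carrier ?B" using f by (auto simp: I_def)
    have fi: "f ((inv\<^bsub>?B\<^esub> f) x) = x" "(inv\<^bsub>?B\<^esub> f) x \<in> ?X" if "x \<in> ?X" for x
      using B_inv[of "inv\<^bsub>?B\<^esub> f" x] B_closed[of "inv\<^bsub>?B\<^esub> f" x] c that by simp_all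
    have "D ((inv\<^bsub>?B\<^esub> f) x) ((inv\<^bsub>?B\<^esub> f) y) = D x y" if "x \<in> ?X" "y \<in> ?X" for x y
    proof -
      have "D (f ((inv\<^bsub>?B\<^esub> f) x)) (f ((inv\<^bsub>?B\<^esub> f) y)) = D ((inv\<^bsub>?B\<^esub> f) x) ((inv\<^bsub>?B\<^esub> f) y)"
        using f fi(2)[OF that(1)] fi(2)[OF that(2)] unfolding I_def by blast
      then show ?thesis using fi(1)[OF that(1)] fi(1)[OF that(2)] by simp
    qed
    then show ?thesis using c unfolding I_def by simp
  qed
  have I_a: "a g \<in> I" if "g \<in> carrier \<Gamma>" for g
    using a_closed[OF that] D_act[OF that] by (simp add: I_def a_apply)
  have I_w: "w \<in> I"
    using w_closed W_iso by (simp add: I_def w_apply)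
  have I_letter: "?l c \<in> I" if "fst c \<in> carrier \<Gamma>" for c
    using I_mult[OF I_mult[OF I_a[OF that], of "if snd c then w else inv\<^bsub>?B\<^esub> w"] I_inv[OF I_a[OF that]]] I_w I_inv[OF I_w]
    unfolding letter_def by (simp split: if_splits)
  have I_prod: "mprod ?B (map ?l p) \<in> I" if "fst ` set p \<subseteq> carrier \<Gamma>" for p
    using that
  proof (induction p)
    case Nil
    then show ?case using B_one B.one_closed by (simp add: I_def)
  next
    case (Cons c p)
    then show ?case using I_mult I_letter by simp
  qed
  have I_\<alpha>: "\<alpha> g \<in> I" if "g \<in> carrier \<Gamma>" for g
    unfolding \<alpha>_def twist_def by (rule I_mult[OF I_prod[OF code_c[OF that]] I_a[OF that]])
  have \<alpha>_A: "\<alpha> g x = F.act g x" if "g \<in> A" "x \<in> ?X" for g x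
    using twist_tail[OF tw, of g] that by (simp add: A_def \<alpha>_def a_apply)
  have \<alpha>_B: "\<alpha> h (W x) = W (F.act h x)" if h: "h \<in> B" and x: "x \<in> ?X" for h x
  proof -
    have hc: "h \<in> carrier \<Gamma>" using h F.AB by blast
    have "\<alpha> h = w \<otimes>\<^bsub>?B\<^esub> a h \<otimes>\<^bsub>?B\<^esub> inv\<^bsub>?B\<^esub> w"
      using twist_head[OF tw, of h] h by (simp add: B_def \<alpha>_def)
    moreover have "(w \<otimes>\<^bsub>?B\<^esub> a h \<otimes>\<^bsub>?B\<^esub> inv\<^bsub>?B\<^esub> w) (W x) = (w \<otimes>\<^bsub>?B\<^esub> a h) ((inv\<^bsub>?B\<^esub> w) (W x))"
      using B_mult[of "w \<otimes>\<^bsub>?B\<^esub> a h" "inv\<^bsub>?B\<^esub> w" "W x"] w_closed a_closed[OF hc] WX[OF x] by simp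
    moreover have "(w \<otimes>\<^bsub>?B\<^esub> a h) x = W (F.act h x)"
      using B_mult[OF w_closed a_closed[OF hc] x] x actX[OF hc x] by (simp add: a_apply w_apply)
    ultimately show ?thesis using w_inv[OF x] by simp
  qed
  have homogeneous: "homogeneous_isometric_action \<Gamma> ?X D \<alpha>"
    unfolding homogeneous_isometric_action_def
  proof (intro conjI allI impI ballI)
    show "group_action \<Gamma> ?X \<alpha>" using faithful by (simp add: faithful_action_def)
    show "isometric_embedding ?X D ?X D (\<alpha> g)" if "g \<in> carrier \<Gamma>" for g
      using I_\<alpha>[OF that] B_closed[of "\<alpha> g"] by (auto simp: isometric_embedding_def I_def)
    fix P Q f assume a: "finite P \<and> P \<subseteq> ?X \<and> Q \<subseteq> ?X \<and> isometric_embedding P D Q D f \<and> f ` P = Q"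
    define L where "L = (\<lambda>x. (x, f x)) ` P"
    have "\<exists>g1\<in>A. \<exists>g2\<in>A. \<exists>h1\<in>B. \<exists>h2\<in>B. \<forall>p\<in>L. W (F.act h1 (fst p)) = F.act g1 (fst p) \<and>
           W (F.act h2 (fst p)) = F.act g2 (snd p)"
    proof (rule hom)
      show "finite L" "L \<subseteq> ?X \<times> ?X" using a unfolding L_def by blast+
      show "D (fst p) (fst p') = D (snd p) (snd p')" if "p \<in> L" "p' \<in> L" for p p'
        using that a by (auto simp: L_def isometric_embedding_def)
    qed
    then have "\<exists>g1\<in>A. \<exists>g2\<in>A. \<exists>h1\<in>B. \<exists>h2\<in>B. \<forall>x\<in>P. W (F.act h1 x) = F.act g1 x \<and>
           W (F.act h2 x) = F.act g2 (f x)"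
      unfolding L_def ball_simps by simp
    then obtain g1 g2 h1 h2 where g: "g1 \<in> A" "g2 \<in> A" "h1 \<in> B" "h2 \<in> B"
      and gh: "\<And>x. x \<in> P \<Longrightarrow> W (F.act h1 x) = F.act g1 x \<and> W (F.act h2 x) = F.act g2 (f x)"
      by blast
    have gc: "g1 \<in> carrier \<Gamma>" "g2 \<in> carrier \<Gamma>" "h1 \<in> carrier \<Gamma>" "h2 \<in> carrier \<Gamma>"
      using g F.AB by blast+
    \<comment> \<open>Read from the right: \<open>x\<close> goes to \<open>F.act g1 x\<close>, which
      is \<open>W (F.act h1 x)\<close>; then to \<open>W x\<close>; then to
      \<open>W (F.act h2 x)\<close>, which is \<open>F.act g2 (f x)\<close>; and finally to
      \<open>f x\<close>. Elements of \<open>A\<close> act by translation, those of \<open>B\<close>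
      by translation conjugated with \<open>W\<close>.\<close>
    let ?g = "inv\<^bsub>\<Gamma>\<^esub> g2 \<otimes>\<^bsub>\<Gamma>\<^esub> (h2 \<otimes>\<^bsub>\<Gamma>\<^esub> (inv\<^bsub>\<Gamma>\<^esub> h1 \<otimes>\<^bsub>\<Gamma>\<^esub> g1))"
    have "\<alpha> ?g x = f x" if x: "x \<in> P" for x
    proof -
      have xX: "x \<in> ?X" "f x \<in> ?X" using a x by blast+
      have mult: "\<alpha> (g \<otimes>\<^bsub>\<Gamma>\<^esub> h) y = \<alpha> g (\<alpha> h y)" if "g \<in> carrier \<Gamma>" "h \<in> carrier \<Gamma>" "y \<in> ?X" for g h y
        using B_mult[OF \<alpha>.hom_closed \<alpha>.hom_closed, OF that] \<alpha>.hom_mult[OF that(1,2)] by simp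
      have inv: "\<alpha> (inv\<^bsub>\<Gamma>\<^esub> g) (\<alpha> g y) = y" if "g \<in> carrier \<Gamma>" "y \<in> ?X" for g y
        using B_inv[of "\<alpha> g" y] that by simp
      have "\<alpha> (inv\<^bsub>\<Gamma>\<^esub> h1) (F.act g1 x) = W x"
        using inv[OF gc(3) WX[OF xX(1)]] \<alpha>_B[OF g(3) xX(1)] gh[OF x] by simp
      moreover have "\<alpha> h2 (W x) = F.act g2 (f x)"
        using \<alpha>_B[OF g(4) xX(1)] gh[OF x] by simp
      moreover have "\<alpha> (inv\<^bsub>\<Gamma>\<^esub> g2) (F.act g2 (f x)) = f x"
        using inv[OF gc(2) xX(2)] \<alpha>_A[OF g(2) xX(2)] by simp
      ultimately show ?thesis
        using \<alpha>_A[OF g(1) xX(1)]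
        by (simp only: mult gc xX \<Gamma>.m_closed \<Gamma>.inv_closed WX actX B_closed[OF \<alpha>.hom_closed])
    qed
    then show "\<exists>\<gamma>\<in>carrier \<Gamma>. \<forall>x\<in>P. \<alpha> \<gamma> x = f x"
      using gc by (intro bexI[of _ ?g]) auto
  qed
  have X: "in_class_H \<Gamma> ?X D"
    using faithful homogeneous assms(1,2) by (auto simp: in_class_H_def)
  have one_point: "one_point_property S ?X D"
    unfolding one_point_property_def using kat by blast
  have U: "Metric_space U d" "countable U" "\<And>x y. x \<in> U \<Longrightarrow> y \<in> U \<Longrightarrow> d x y \<in> S"
    using assms(7) by (simp_all add: S_Urysohn_space_def S_metric_space_def)
  \<comment> \<open>Both spaces are countable with the one-point property, so the constructed space
    is isometric to the given \<open>U\<close>.\<close>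
  have "\<exists>\<theta>. bij_betw \<theta> ?X U \<and> (\<forall>x\<in>?X. \<forall>y\<in>?X. d (\<theta> x) (\<theta> y) = D x y)"
    by (rule one_point_property_isometric[OF metric DS one_point F.points_countable U(1,3)
        S_Urysohn_one_point_property[OF assms(7) S(3)] U(2)])
      blast+
  then obtain \<theta> where \<theta>: "bij_betw \<theta> ?X U" "\<forall>x\<in>?X. \<forall>y\<in>?X. d (\<theta> x) (\<theta> y) = D x y"
    by blast
  show ?thesis
    by (rule in_class_H_isometric[OF X \<theta>(1)]) (use \<theta>(2) in blast)
qed

end
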